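(* Let $0<\Theta<1$, $0<p_0,p_1<\infty$, $0<q_0,q_1\le\infty$ and $s_0,s_1\in\mathbb{R}$. Put $$\frac1p:=\frac{1-\Theta}{p_0}+\frac{\Theta}{p_1},\qquad \frac1q:=\frac{1-\Theta}{q_0}+\frac{\Theta}{q_1},\qquad s:=(1-\Theta)s_0+\Theta s_1 .$$ Let $w_0,w_1\in\mathcal{A}_\infty^{\ell oc}$ be weights on $\mathbb{R}^d$ and define $w:=w_0^{\frac{(1-\Theta)p}{p_0}}\,w_1^{\frac{\Theta p}{p_1}}$. Then the Calderón product satisfies $$f^{s_0}_{p_0,q_0}(\mathbb{R}^d,w_0)^{1-\Theta}\,f^{s_1}_{p_1,q_1}(\mathbb{R}^d,w_1)^{\Theta}=f^{s}_{p,q}(\mathbb{R}^d,w)$$ in the sense of equivalent quasi-norms (the two sets coincide and their quasi-norms are equivalent).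
   Context: Weights: a weight is a nonnegative locally integrable function $w$ on $\mathbb{R}^d$. For $1<r<\infty$, $1/r+1/r'=1$, $w\in\mathcal{A}_r^{\ell oc}$ (local Muckenhoupt class) if $\sup_{|B|\le 1}\big(\frac1{|B|}\int_B w\,dx\big)^{1/r}\big(\frac1{|B|}\int_B w^{-r'/r}\,dx\big)^{1/r'}<\infty$, the supremum being over all balls $B\subset\mathbb{R}^d$ of volume $\le 1$ (so $w>0$ a.e.). $\mathcal{A}_\infty^{\ell oc}:=\bigcup_{r>1}\mathcal{A}_r^{\ell oc}$. $\|f|L_p(\mathbb{R}^d,w)\|:=\big(\int|f|^p\,w\,dx\big)^{1/p}$. Sequence spaces: for $j\in\mathbb{N}_0$, $k\in\mathbb{Z}^d$, $Q_{j,k}:=\{x: 2^{-j}k_\ell\le x_\ell<2^{-j}(k_\ell+1),\ \ell=1,\dots,d\}$ and $\mathcal{X}_{j,k}$ is its characteristic function. For $0<p<\infty$, $0<q\le\infty$, $s\in\mathbb{R}$, $f^s_{p,q}(\mathbb{R}^d,w)$ is the set of complex sequences $\lambda=(\lambda_{j,k})_{j\in\mathbb{N}_0,k\in\mathbb{Z}^d}$ with $$\|\lambda|f^s_{p,q}(\mathbb{R}^d,w)\|:=\Big\|\Big(\sum_{j=0}^\infty\sum_{k\in\mathbb{Z}^d}2^{sjq}|\lambda_{j,k}|^q\mathcal{X}_{j,k}(\cdot)\Big)^{1/q}\Big|L_p(\mathbb{R}^d,w)\Big\|<\infty$$ (supremum instead of the sum if $q=\infty$). Calderón product: for quasi-Banach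 lattices $X_0,X_1$ of functions on a $\sigma$-finite measure space (here $\mathbb{N}_0\times\mathbb{Z}^d$ with counting measure), $X_0^{1-\Theta}X_1^\Theta$ is the set of measurable functions $f$ for which $\|f|X_0^{1-\Theta}X_1^\Theta\|:=\inf\{\|f_0|X_0\|^{1-\Theta}\|f_1|X_1\|^{\Theta}: |f|\le|f_0|^{1-\Theta}|f_1|^\Theta\text{ a.e.},\ f_j\in X_j,\ j=0,1\}$ is finite. *)

theory Defs
  imports "HOL-Analysis.Analysis"
begin

(* Real powers on [0, \<infinity>], with 0 powr a = \<infinity> and \<infinity> powr a = 0 for a < 0. *)
definition enn_powr :: "ennreal \<Rightarrow> real \<Rightarrow> ennreal" where
  "enn_powr x a =
     (if a = 0 then 1
      else if x = 0 then (if a > 0 then 0 else \<infinity>)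
      else if x = \<infinity> then (if a > 0 then \<infinity> else 0)
      else ennreal (enn2real x powr a))"

definition weight :: "(real ^ 'd \<Rightarrow> real) \<Rightarrow> bool" where
  "weight w \<longleftrightarrow> (\<forall>x. 0 \<le> w x) \<and> (\<forall>K. compact K \<longrightarrow> w absolutely_integrable_on K)"

(* Here r / (r - 1) is the conjugate exponent of r. The negative power of w is taken in
   [0, \<infinity>]. Positivity a.e. is stated explicitly because 0 * \<infinity> = 0 in ennreal would otherwise
   admit the zero weight. *)
definition muckenhoupt_loc :: "real \<Rightarrow> (real ^ 'd \<Rightarrow> real) set" where
  "muckenhoupt_loc r = {w. weight w \<and> (AE x in lebesgue. 0 < w x) \<and>
     (let r' = r / (r - 1) in
      (SUP (c, \<rho>) \<in> {(c, \<rho>). 0 < \<rho> \<and> measure lebesgue (ball c \<rho>) \<le> 1}.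
         enn_powr ((1 / emeasure lebesgue (ball c \<rho>)) *
             (\<integral>\<^sup>+ x \<in> ball c \<rho>. ennreal (w x) \<partial>lebesgue)) (1 / r) *
         enn_powr ((1 / emeasure lebesgue (ball c \<rho>)) *
             (\<integral>\<^sup>+ x \<in> ball c \<rho>. enn_powr (ennreal (w x)) (- (r' / r)) \<partial>lebesgue)) (1 / r'))
      < \<infinity>)}"

definition muckenhoupt_loc_infinity :: "(real ^ 'd \<Rightarrow> real) set" where
  "muckenhoupt_loc_infinity = (\<Union>r\<in>{1<..}. muckenhoupt_loc r)"

(* Weighted Lp quasi-norm of a [0, \<infinity>]-valued function. *)
definition Lp_weighted_norm :: "real \<Rightarrow> (real ^ 'd \<Rightarrow> real) \<Rightarrow> (real ^ 'd \<Rightarrow> ennreal) \<Rightarrow> ennreal" where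
  "Lp_weighted_norm p w F =
     enn_powr (\<integral>\<^sup>+ x. enn_powr (F x) p * ennreal (w x) \<partial>lebesgue) (1 / p)"

definition dyadic_cube :: "nat \<Rightarrow> int ^ 'd \<Rightarrow> (real ^ 'd) set" where
  "dyadic_cube j k =
     {x. \<forall>l. real_of_int (k $ l) / 2 ^ j \<le> x $ l \<and> x $ l < (real_of_int (k $ l) + 1) / 2 ^ j}"

definition f_norm ::
    "real \<Rightarrow> real \<Rightarrow> ennreal \<Rightarrow> (real ^ 'd \<Rightarrow> real) \<Rightarrow> (nat \<times> (int ^ 'd) \<Rightarrow> complex) \<Rightarrow> ennreal" where
  "f_norm s p q w lam = Lp_weighted_norm p w (\<lambda>x.
     if q = \<infinity>
     then (SUP (j, k). ennreal (2 powr (s * real j) * cmod (lam (j, k)) * indicator (dyadic_cube j k) x))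
     else enn_powr (\<Sum>j. \<Sum>\<^sub>\<infinity>k.
            ennreal (2 powr (s * real j * enn2real q) * cmod (lam (j, k)) powr enn2real q
              * indicator (dyadic_cube j k) x)) (1 / enn2real q))"

definition f_space ::
    "real \<Rightarrow> real \<Rightarrow> ennreal \<Rightarrow> (real ^ 'd \<Rightarrow> real) \<Rightarrow> (nat \<times> (int ^ 'd) \<Rightarrow> complex) set" where
  "f_space s p q w = {lam. f_norm s p q w lam < \<infinity>}"

(* A quasi-Banach function lattice over M is given by its carrier X and its quasi-norm n.
   The infimum over the empty set is \<infinity>. *)
definition calderon_norm ::
    "'a measure \<Rightarrow> real
     \<Rightarrow> ('a \<Rightarrow> complex) set \<Rightarrow> (('a \<Rightarrow> complex) \<Rightarrow> ennreal)
     \<Rightarrow> ('a \<Rightarrow> complex) set \<Rightarrow> (('a \<Rightarrow> complex) \<Rightarrow> ennreal)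
     \<Rightarrow> ('a \<Rightarrow> complex) \<Rightarrow> ennreal" where
  "calderon_norm M \<Theta> X\<^sub>0 n\<^sub>0 X\<^sub>1 n\<^sub>1 f =
     Inf {enn_powr (n\<^sub>0 f\<^sub>0) (1 - \<Theta>) * enn_powr (n\<^sub>1 f\<^sub>1) \<Theta> | f\<^sub>0 f\<^sub>1.
            f\<^sub>0 \<in> X\<^sub>0 \<and> f\<^sub>1 \<in> X\<^sub>1 \<and>
            (AE x in M. cmod (f x) \<le> cmod (f\<^sub>0 x) powr (1 - \<Theta>) * cmod (f\<^sub>1 x) powr \<Theta>)}"

definition calderon_product ::
    "'a measure \<Rightarrow> real
     \<Rightarrow> ('a \<Rightarrow> complex) set \<Rightarrow> (('a \<Rightarrow> complex) \<Rightarrow> ennreal)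
     \<Rightarrow> ('a \<Rightarrow> complex) set \<Rightarrow> (('a \<Rightarrow> complex) \<Rightarrow> ennreal)
     \<Rightarrow> ('a \<Rightarrow> complex) set" where
  "calderon_product M \<Theta> X\<^sub>0 n\<^sub>0 X\<^sub>1 n\<^sub>1 =
     {f \<in> borel_measurable M. calderon_norm M \<Theta> X\<^sub>0 n\<^sub>0 X\<^sub>1 n\<^sub>1 f < \<infinity>}"

definition equivalent_norms_on ::
    "'b set \<Rightarrow> ('b \<Rightarrow> ennreal) \<Rightarrow> ('b \<Rightarrow> ennreal) \<Rightarrow> bool" where
  "equivalent_norms_on X n m \<longleftrightarrow>
     (\<exists>c C. 0 < c \<and> 0 < C \<and> (\<forall>f\<in>X. ennreal c * n f \<le> m f \<and> m f \<le> ennreal C * n f))"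

end

theory Submission
  imports Defs
begin

text \<open>
  The inclusion of the Calderon product in the space on the right is Hoelder's inequality, applied once to the sum
  over the generations \<open>j\<close> and once to the integral.

  For the converse put \<open>t\<^sub>i = q / q\<^sub>i\<close>, let \<open>F\<close> be the function whose weighted norm is the norm of \<open>\<lambda>\<close>, and let
  \<open>H\<^sub>i = F\<^bsup>p/p\<^sub>i - t\<^sub>i\<^esup> (w/w\<^sub>i)\<^bsup>1/p\<^sub>i\<^esup>\<close>. Then \<open>H\<^sub>0\<^bsup>1-\<Theta>\<^esup> H\<^sub>1\<^bsup>\<Theta>\<^esup> = 1\<close>, and \<open>F\<^bsup>t\<^sub>i\<^esup> H\<^sub>i\<close> has the norm
  \<open>\<parallel>\<lambda>\<parallel>\<^bsup>p/p\<^sub>i\<^esup>\<close> in \<open>L\<^bsub>p\<^sub>i\<^esub>(w\<^sub>i)\<close>. On each dyadic cube replace \<open>H\<^sub>0\<close> by its median \<open>m\<^sub>0\<close> and \<open>H\<^sub>1\<close> by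
  \<open>m\<^sub>1 = m\<^sub>0\<^bsup>-(1-\<Theta>)/\<Theta>\<^esup>\<close>, and let \<open>\<lambda>\<^sub>i\<close> be \<open>|\<lambda>|\<^bsup>t\<^sub>i\<^esup> m\<^sub>i\<close> up to powers of \<open>2\<^sup>j\<close>. Since \<open>m\<^sub>i \<le> H\<^sub>i\<close> on half
  of the cube, \<open>\<lambda>\<^sub>i\<close> is under control if the norm may be computed with the cubes replaced by such halves. The
  \<open>A\<^sub>\<infinity>\<close> condition says that the halves carry a fixed proportion of the weight of the cube, and then the
  replacement is an elementary estimate for sums adapted to the dyadic filtration: telescope the power \<open>S\<^bsup>t\<^esup>\<close>
  of the sum along the partial sums, which are constant on cubes.
\<close>

section \<open>Powers and Hoelder's inequality in the extended nonnegative reals\<close>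

text \<open>The obstacle is that each factor must be one number per cube, whereas
  \<open>H\<^sub>0\<close> and \<open>H\<^sub>1\<close> vary with the point, and the two numbers
  chosen on a cube must keep the weighted geometric mean one. The product relation makes
  \<open>H\<^sub>1\<close> a decreasing function of \<open>H\<^sub>0\<close>, so
  \<open>m\<^sub>1 \<le> H\<^sub>1\<close> holds wherever \<open>H\<^sub>0 \<le> m\<^sub>0\<close>.
  A number that meets both demands on half of the cube is thus exactly a median of
  \<open>H\<^sub>0\<close>. Halves are measured by Lebesgue measure, so that one median serves both
  weights; the Muckenhoupt condition then converts them, separately for \<open>w\<^sub>0\<close> and
  for \<open>w\<^sub>1\<close>, and is never asked of \<open>w\<close>. The form of
  \<open>H\<^sub>i\<close> is forced: the \<open>q\<^sub>i\<close>-norm of the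
  \<open>t\<^sub>i\<close>-th powers is the \<open>t\<^sub>i\<close>-th power of \<open>F\<close>,
  and \<open>H\<^sub>i\<close> is the multiplier that turns this into a function whose
  \<open>p\<^sub>i\<close>-th power times \<open>w\<^sub>i\<close> is \<open>F\<close> to the power
  \<open>p\<close> times \<open>w\<close>. The product relation then only says that the numbers
  \<open>t\<^sub>i\<close>, and likewise the numbers \<open>p / p\<^sub>i\<close>, have the average
  one with respect to the weights \<open>1 - \<Theta>\<close> and \<open>\<Theta>\<close>.\<close>

lemma enn_powr_0 [simp]: "enn_powr x 0 = 1"
  and enn_powr_zero [simp]: "0 < a \<Longrightarrow> enn_powr 0 a = 0"
  and enn_powr_top [simp]: "0 < a \<Longrightarrow> enn_powr top a = top"
  by (auto simp: enn_powr_def)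

lemma enn_powr_ennreal: "0 \<le> x \<Longrightarrow> 0 < a \<Longrightarrow> enn_powr (ennreal x) a = ennreal (x powr a)"
  by (cases "x = 0") (auto simp: enn_powr_def ennreal_eq_0_iff)

lemma enn_powr_ennreal_pos: "0 < x \<Longrightarrow> enn_powr (ennreal x) a = ennreal (x powr a)"
  by (auto simp: enn_powr_def ennreal_eq_0_iff)

lemma enn_powr_1 [simp]: "enn_powr x 1 = x"
  by (cases x) (auto simp: enn_powr_ennreal)

lemma enn_powr_less_top: "x < top \<Longrightarrow> 0 \<le> a \<Longrightarrow> enn_powr x a < top"
  by (cases x; cases "a = 0") (auto simp: enn_powr_ennreal)

lemma enn_powr_eq_0_iff: "0 < a \<Longrightarrow> enn_powr x a = 0 \<longleftrightarrow> x = 0"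
  by (cases x) (auto simp: enn_powr_ennreal powr_def split: if_splits)

lemma enn_powr_mono: "x \<le> y \<Longrightarrow> 0 \<le> a \<Longrightarrow> enn_powr x a \<le> enn_powr y a"
  by (cases x; cases y; cases "a = 0")
     (auto simp: enn_powr_ennreal top_unique intro!: ennreal_leI powr_mono2)

lemma enn_powr_mult:
  assumes "0 \<le> a"
  shows "enn_powr (x * y) a = enn_powr x a * enn_powr y a"
proof (cases "a = 0")
  case False
  with assms have a: "0 < a" by simp
  show ?thesis
  proof (cases "x = 0 \<or> y = 0")
    case False
    then have "x \<noteq> 0" "y \<noteq> 0" by auto
    then show ?thesis
      using a by (cases x; cases y)
        (auto simp: enn_powr_ennreal ennreal_mult[symmetric] ennreal_mult_top
          ennreal_top_mult ennreal_eq_0_iff powr_def ln_mult distrib_left exp_add)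
  qed (use a in auto)
qed simp

lemma enn_powr_powr:
  assumes "0 \<le> a" "0 \<le> b"
  shows "enn_powr (enn_powr x a) b = enn_powr x (a * b)"
proof (cases "a = 0 \<or> b = 0")
  case True
  then show ?thesis
    by (auto simp: enn_powr_def)
next
  case False
  with assms have "0 < a" "0 < b" by auto
  then show ?thesis
    by (cases x) (auto simp: enn_powr_ennreal powr_powr)
qed

lemma enn_powr_add:
  assumes "0 \<le> a" "0 \<le> b"
  shows "enn_powr x (a + b) = enn_powr x a * enn_powr x b"
proof (cases "a = 0 \<or> b = 0")
  case False
  with assms have "0 < a" "0 < b" by auto
  then show ?thesis
    by (cases x) (auto simp: enn_powr_ennreal powr_add ennreal_mult[symmetric])
qed auto

text \<open>A positive power is an order isomorphism of the extended half-line, with the power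
  \<open>1 / a\<close> as its inverse, and so it commutes with suprema.\<close>

lemma enn_powr_SUP:
  assumes "0 < a" "I \<noteq> {}"
  shows "enn_powr (SUP i\<in>I. f i) a = (SUP i\<in>I. enn_powr (f i) a)"
proof (rule antisym)
  define S where "S = (SUP i\<in>I. enn_powr (f i) a)"
  have "f i \<le> enn_powr S (1 / a)" if "i \<in> I" for i
  proof -
    have "enn_powr (f i) a \<le> S"
      unfolding S_def by (rule SUP_upper) (rule that)
    from enn_powr_mono[OF this, of "1 / a"] show ?thesis
      using assms by (simp add: enn_powr_powr)
  qed
  then have "enn_powr (SUP i\<in>I. f i) a \<le> enn_powr (enn_powr S (1 / a)) a"
    using assms by (intro enn_powr_mono SUP_least) auto
  then show "enn_powr (SUP i\<in>I. f i) a \<le> (SUP i\<in>I. enn_powr (f i) a)"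
    using assms by (simp add: enn_powr_powr S_def)
qed (use assms in \<open>auto intro!: SUP_least enn_powr_mono SUP_upper\<close>)

lemma measurable_enn_powr [measurable (raw)]:
  assumes [measurable]: "f \<in> borel_measurable M"
  shows "(\<lambda>x. enn_powr (f x) a) \<in> borel_measurable M"
  unfolding enn_powr_def by measurable

lemma enn_powr_Young:
  assumes "0 < a" "0 < b" "a + b = 1"
  shows "enn_powr x a * enn_powr y b \<le> ennreal a * x + ennreal b * y"
proof (cases "x = 0 \<or> y = 0 \<or> x = top \<or> y = top")
  case True
  then show ?thesis
    using assms by (auto simp: ennreal_mult_top ennreal_top_mult)
next
  case False
  then obtain u v where uv: "x = ennreal u" "y = ennreal v" "0 < u" "0 < v"
    by (metis ennreal_cases ennreal_0 less_eq_real_def)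
  have "ennreal (u powr a * v powr b) \<le> ennreal (a * u + b * v)"
    using Youngs_inequality_0[of a b u v] assms uv by (intro ennreal_leI) auto
  then show ?thesis
    using uv assms by (simp add: enn_powr_ennreal ennreal_mult[symmetric] ennreal_plus[symmetric] del: ennreal_plus)
qed

text \<open>Normalizing both integrals to one reduces the claim to Young's inequality at each point;
  integrals that are zero or infinite cannot be normalized and come first. With the powers on the
  outside, one statement serves sums (counting measure), the integral over space and the Muckenhoupt
  condition.\<close>

lemma nn_integral_Holder:
  assumes [measurable]: "f \<in> borel_measurable M" "g \<in> borel_measurable M"
    and ab: "0 < a" "0 < b" "a + b = 1"
  shows "(\<integral>\<^sup>+x. enn_powr (f x) a * enn_powr (g x) b \<partial>M)
    \<le> enn_powr (\<integral>\<^sup>+x. f x \<partial>M) a * enn_powr (\<integral>\<^sup>+x. g x \<partial>M) b" (is "?L \<le> enn_powr ?A a * enn_powr ?B b")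
proof (cases "?A = 0 \<or> ?B = 0 \<or> ?A = top \<or> ?B = top")
  case True
  have "?L = 0" if "?A = 0 \<or> ?B = 0"
  proof -
    have "AE x in M. f x = 0 \<or> g x = 0"
      using that by (auto simp: nn_integral_0_iff_AE)
    then have "AE x in M. enn_powr (f x) a * enn_powr (g x) b = 0"
      by eventually_elim (use ab in auto)
    then show ?thesis
      by (simp add: nn_integral_0_iff_AE)
  qed
  moreover have "enn_powr ?A a * enn_powr ?B b = top" if "?A \<noteq> 0" "?B \<noteq> 0"
    using True that ab by (auto simp: ennreal_mult_top ennreal_top_mult enn_powr_eq_0_iff)
  ultimately show ?thesis
    by (metis top_greatest zero_le)
next
  case False
  then obtain A B where AB: "?A = ennreal A" "?B = ennreal B" "0 < A" "0 < B"
    by (metis ennreal_cases ennreal_0 less_eq_real_def)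
  have scale: "enn_powr (f x) a * enn_powr (g x) b = ennreal (A powr a * B powr b) *
      (enn_powr (ennreal (1 / A) * f x) a * enn_powr (ennreal (1 / B) * g x) b)" for x
  proof -
    have "ennreal (A powr a * B powr b) * (ennreal ((1 / A) powr a) * ennreal ((1 / B) powr b)) = 1"
      using AB by (simp add: ennreal_mult[symmetric] powr_divide)
    then show ?thesis
      using AB ab by (simp add: enn_powr_mult enn_powr_ennreal) (metis mult.assoc mult.left_commute mult_1)
  qed
  have "(\<integral>\<^sup>+x. enn_powr (ennreal (1 / A) * f x) a * enn_powr (ennreal (1 / B) * g x) b \<partial>M)
      \<le> (\<integral>\<^sup>+x. ennreal a * (ennreal (1 / A) * f x) + ennreal b * (ennreal (1 / B) * g x) \<partial>M)"
    by (intro nn_integral_mono enn_powr_Young ab)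
  also have "\<dots> = ennreal a * (ennreal (1 / A) * ennreal A) + ennreal b * (ennreal (1 / B) * ennreal B)"
    by (simp add: nn_integral_add nn_integral_cmult AB)
  also have "\<dots> = 1"
    using AB ab by (simp add: ennreal_mult[symmetric] ennreal_plus[symmetric] del: ennreal_plus)
  finally have "?L \<le> ennreal (A powr a * B powr b) * 1"
    unfolding scale by (subst nn_integral_cmult) (auto simp del: mult_1_right intro!: mult_left_mono)
  then show ?thesis
    using AB ab by (simp add: enn_powr_ennreal ennreal_mult)
qed

lemma less_top_ennreal:
  assumes "x < top"
  obtains A where "0 \<le> A" "x = ennreal A"
  using assms by (cases x) auto

section \<open>Sums adapted to a filtration by cells\<close>

text \<open>For \<open>t \<le> 1\<close> an increment of the power is comparable to the increment of
  the base times the power \<open>t - 1\<close> at the right end point. The first bound opens a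
  telescoping sum, the second closes it again. The second is concavity, the tangent at
  \<open>x\<close>.\<close>

lemma powr_diff_le:
  fixes x y t :: real
  assumes "0 < t" "t \<le> 1" "0 \<le> y" "y \<le> x"
  shows "x powr t - y powr t \<le> (x - y) * x powr (t - 1)"
    and "t * ((x - y) * x powr (t - 1)) \<le> x powr t - y powr t"
proof -
  have x: "x powr t = x * x powr (t - 1)" if "0 \<le> x" for x :: real
    using that by (simp add: powr_mult_base)
  have "y * x powr (t - 1) \<le> y powr t"
    if "y \<noteq> 0"
    unfolding x[OF assms(3)] using assms that by (intro mult_left_mono powr_mono2') auto
  then show "x powr t - y powr t \<le> (x - y) * x powr (t - 1)"
    using assms x[of x] by (cases "y = 0"; cases "x = 0") (auto simp: algebra_simps)
  have "y powr t \<le> x powr t - t * ((x - y) * x powr (t - 1))" if "0 < y"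
  proof -
    have "y powr t * x powr (1 - t) * x powr (t - 1) \<le> (t * y + (1 - t) * x) * x powr (t - 1)"
      using Youngs_inequality_0[of t "1 - t" y x] assms that by (intro mult_right_mono) auto
    also have "y powr t * x powr (1 - t) * x powr (t - 1) = y powr t"
      using that assms by (simp add: mult.assoc powr_add[symmetric])
    finally show ?thesis
      using x[of x] that assms by (simp add: algebra_simps)
  qed
  moreover have "t * (x * x powr (t - 1)) \<le> 1 * x powr t"
    using x[of x] assms by (cases "x = 0") (auto intro: mult_right_mono)
  ultimately show "t * ((x - y) * x powr (t - 1)) \<le> x powr t - y powr t"
    using assms by (cases "y = 0") (auto simp: algebra_simps)
qed

text \<open>For \<open>t \<ge> 1\<close> the function is convex, and its tangent at \<open>x\<close>
  now bounds the increment from above.\<close>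

lemma powr_diff_le_ge1:
  fixes x y t :: real
  assumes "1 \<le> t" "0 \<le> y" "y \<le> x"
  shows "x powr t - y powr t \<le> t * ((x - y) * x powr (t - 1))"
proof (cases "y = 0")
  case True
  have "1 * (x * x powr (t - 1)) \<le> t * (x * x powr (t - 1))"
    using assms by (intro mult_right_mono) auto
  with True show ?thesis
    using assms by (cases "x = 0") (auto simp: powr_mult_base)
next
  case False
  then have "0 < y" "0 < x" using assms by auto
  have "(y powr t) powr (1 / t) * (x powr t) powr (1 - 1 / t) \<le> 1 / t * y powr t + (1 - 1 / t) * x powr t"
    using \<open>0 < y\<close> \<open>0 < x\<close> assms by (intro Youngs_inequality_0) auto
  also have "(y powr t) powr (1 / t) * (x powr t) powr (1 - 1 / t) = y * x powr (t - 1)"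
    using \<open>0 < y\<close> assms by (simp add: powr_powr algebra_simps)
  finally have "t * (y * x powr (t - 1)) \<le> t * (1 / t * y powr t + (1 - 1 / t) * x powr t)"
    using assms by (intro mult_left_mono) auto
  also have "\<dots> = y powr t + (t - 1) * x powr t"
    using assms by (simp add: field_simps)
  finally show ?thesis
    using \<open>0 < x\<close> by (simp add: algebra_simps powr_mult_base)
qed

lemma ennreal_sum_le_suminf:
  assumes "\<And>j. 0 \<le> f j"
  shows "ennreal (\<Sum>j<n. f j) \<le> (\<Sum>j. ennreal (f j))"
proof -
  have "ennreal (\<Sum>j<n. f j) = (\<Sum>j<n. ennreal (f j))"
    by (simp add: sum_ennreal assms)
  also have "\<dots> \<le> (\<Sum>j. ennreal (f j))"
    by (intro sum_le_suminf) auto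
  finally show ?thesis .
qed

text \<open>Since \<open>f\<close> is constant on cells, its integral is a sum over the countably
  many labels, and the claim can be checked cell by cell.\<close>

lemma nn_integral_cells_le:
  fixes \<pi> :: "'a \<Rightarrow> 'b::countable" and f :: "'a \<Rightarrow> ennreal"
  assumes [measurable]: "\<pi> \<in> measurable M (count_space UNIV)" "E \<in> sets M"
    and const: "\<And>x y. x \<in> space M \<Longrightarrow> y \<in> space M \<Longrightarrow> \<pi> x = \<pi> y \<Longrightarrow> f x = f y"
    and cell: "\<And>z. z \<in> space M \<Longrightarrow> f z \<noteq> 0 \<Longrightarrow> emeasure M {x \<in> space M. \<pi> x = \<pi> z}
      \<le> K * emeasure M {x \<in> space M. \<pi> x = \<pi> z \<and> x \<in> E}"
  shows "(\<integral>\<^sup>+x. f x \<partial>M) \<le> K * (\<integral>\<^sup>+x. f x * indicator E x \<partial>M)"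
proof -
  define h where "h k = (if \<exists>z\<in>space M. \<pi> z = k then f (SOME z. z \<in> space M \<and> \<pi> z = k) else 0)" for k
  have h: "h (\<pi> x) = f x" if "x \<in> space M" for x
    using that const[of "SOME z. z \<in> space M \<and> \<pi> z = \<pi> x" x] someI[of "\<lambda>z. z \<in> space M \<and> \<pi> z = \<pi> x" x]
    by (auto simp: h_def)
  \<comment> \<open>Both integrals in the claim are instances, with \<open>A\<close> the whole space
    and with \<open>A\<close> equal to \<open>E\<close>.\<close>
  have split: "(\<integral>\<^sup>+x. f x * indicator A x \<partial>M)
      = (\<integral>\<^sup>+k. h k * emeasure M {x \<in> space M. \<pi> x = k \<and> x \<in> A} \<partial>count_space UNIV)"
    if [measurable]: "A \<in> sets M" for A
  proof -
    have "(\<integral>\<^sup>+x. f x * indicator A x \<partial>M)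
        = (\<integral>\<^sup>+x. (\<integral>\<^sup>+k. h k * indicator {x \<in> space M. \<pi> x = k \<and> x \<in> A} x \<partial>count_space UNIV) \<partial>M)"
    proof (rule nn_integral_cong)
      fix x assume x: "x \<in> space M"
      have "(\<integral>\<^sup>+k. h k * indicator {x \<in> space M. \<pi> x = k \<and> x \<in> A} x \<partial>count_space UNIV)
          = (\<integral>\<^sup>+k. h k * indicator {x \<in> space M. \<pi> x = k \<and> x \<in> A} x \<partial>count_space {\<pi> x})"
        by (rule nn_integral_count_space_eq) (auto simp: indicator_def)
      also have "\<dots> = f x * indicator A x"
        using x by (simp add: nn_integral_count_space_finite h indicator_def)
      finally show "f x * indicator A x
          = (\<integral>\<^sup>+k. h k * indicator {x \<in> space M. \<pi> x = k \<and> x \<in> A} x \<partial>count_space UNIV)" ..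
    qed
    also have "\<dots> = (\<integral>\<^sup>+k. (\<integral>\<^sup>+x. h k * indicator {x \<in> space M. \<pi> x = k \<and> x \<in> A} x \<partial>M) \<partial>count_space UNIV)"
      by (rule nn_integral_count_space_nn_integral) auto
    finally show ?thesis
      by (simp add: nn_integral_cmult)
  qed
  have "(\<integral>\<^sup>+x. f x \<partial>M) = (\<integral>\<^sup>+x. f x * indicator (space M) x \<partial>M)"
    by (intro nn_integral_cong) auto
  also have "\<dots> = (\<integral>\<^sup>+k. h k * emeasure M {x \<in> space M. \<pi> x = k} \<partial>count_space UNIV)"
    by (subst split) (auto intro!: nn_integral_cong arg_cong2[where f = "(*)"] arg_cong2[where f = emeasure])
  also have "\<dots> \<le> (\<integral>\<^sup>+k. K * (h k * emeasure M {x \<in> space M. \<pi> x = k \<and> x \<in> E}) \<partial>count_space UNIV)"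
  proof (rule nn_integral_mono)
    fix k
    show "h k * emeasure M {x \<in> space M. \<pi> x = k}
        \<le> K * (h k * emeasure M {x \<in> space M. \<pi> x = k \<and> x \<in> E})"
    proof (cases "h k = 0")
      case False
      then obtain z where "z \<in> space M" "\<pi> z = k"
        by (auto simp: h_def split: if_splits)
      then show ?thesis
        using cell[of z] h[of z] False by (auto simp: mult.left_commute[of K] intro!: mult_left_mono)
    qed simp
  qed
  also have "\<dots> = K * (\<integral>\<^sup>+x. f x * indicator E x \<partial>M)"
    by (simp add: nn_integral_cmult split)
  finally show ?thesis .
qed

text \<open>\<open>\<pi> j x\<close> is the label of the cell of generation \<open>j\<close> containing \<open>x\<close>.\<close>

locale cell_filtration =
  fixes M :: "'a measure" and \<pi> :: "nat \<Rightarrow> 'a \<Rightarrow> 'b::countable"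
  assumes label_measurable [measurable]: "\<pi> j \<in> measurable M (count_space UNIV)"
    and label_refine: "i \<le> j \<Longrightarrow> \<pi> j x = \<pi> j y \<Longrightarrow> \<pi> i x = \<pi> i y"
    and cell_finite: "emeasure M {x \<in> space M. \<pi> j x = k} < top"

text \<open>In the application \<open>M\<close> has the weight as its density, \<open>E j\<close>
  collects the chosen halves of all cubes of generation \<open>j\<close>, and \<open>K\<close> comes
  from the Muckenhoupt condition. Ampleness is demanded only where the coefficient is nonzero,
  because the halves are only known to be large on such cubes.\<close>

locale ample_subsets = cell_filtration M \<pi>
  for M :: "'a measure" and \<pi> :: "nat \<Rightarrow> 'a \<Rightarrow> 'b::countable" +
  fixes K :: real and E :: "nat \<Rightarrow> 'a set" and c :: "nat \<Rightarrow> 'b \<Rightarrow> real"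
  assumes K_pos: "0 < K"
    and E_sets [measurable]: "E j \<in> sets M"
    and c_nonneg: "0 \<le> c j k"
    and ample: "c j k \<noteq> 0 \<Longrightarrow> emeasure M {x \<in> space M. \<pi> j x = k}
      \<le> ennreal K * emeasure M {x \<in> space M. \<pi> j x = k \<and> x \<in> E j}"
begin

text \<open>Being linear in \<open>d\<close>, the estimate splits into single generations, on whose
  cells \<open>d j\<close> is constant. Every nonlinear estimate below is brought to this form by
  finding suitable increments \<open>d j\<close>.\<close>

lemma nn_integral_adapted_le:
  fixes d :: "nat \<Rightarrow> 'a \<Rightarrow> real"
  assumes d: "\<And>j x. 0 \<le> d j x" "\<And>j x. c j (\<pi> j x) = 0 \<Longrightarrow> d j x = 0"
    and adapted: "\<And>j x y. \<pi> j x = \<pi> j y \<Longrightarrow> d j x = d j y"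
    and [measurable]: "\<And>j. d j \<in> borel_measurable M"
  shows "(\<integral>\<^sup>+x. ennreal (\<Sum>j<n. d j x) \<partial>M) \<le> ennreal K * (\<integral>\<^sup>+x. ennreal (\<Sum>j<n. d j x * indicator (E j) x) \<partial>M)"
proof -
  have "(\<integral>\<^sup>+x. ennreal (\<Sum>j<n. d j x) \<partial>M) = (\<Sum>j<n. \<integral>\<^sup>+x. ennreal (d j x) \<partial>M)"
    by (subst nn_integral_sum[symmetric]) (auto simp: sum_ennreal d)
  also have "\<dots> \<le> (\<Sum>j<n. ennreal K * (\<integral>\<^sup>+x. ennreal (d j x) * indicator (E j) x \<partial>M))"
  proof (intro sum_mono nn_integral_cells_le[where \<pi> = "\<pi> j" for j])
    fix j x y assume "\<pi> j x = \<pi> j y"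
    from adapted[OF this] show "ennreal (d j x) = ennreal (d j y)" by simp
  next
    fix j z assume "ennreal (d j z) \<noteq> 0"
    then have "c j (\<pi> j z) \<noteq> 0"
      using d(2)[of j z] by auto
    then show "emeasure M {x \<in> space M. \<pi> j x = \<pi> j z}
        \<le> ennreal K * emeasure M {x \<in> space M. \<pi> j x = \<pi> j z \<and> x \<in> E j}"
      by (rule ample)
  qed auto
  also have "\<dots> = ennreal K * (\<integral>\<^sup>+x. (\<Sum>j<n. ennreal (d j x) * indicator (E j) x) \<partial>M)"
    by (subst nn_integral_sum) (simp_all only: sum_distrib_left, measurable)
  also have "(\<lambda>x. \<Sum>j<n. ennreal (d j x) * indicator (E j) x) = (\<lambda>x. ennreal (\<Sum>j<n. d j x * indicator (E j) x))"
  proof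
    fix x
    have "ennreal (d j x) * indicator (E j) x = ennreal (d j x * indicator (E j) x)" for j
      by (auto split: split_indicator)
    then have "(\<Sum>j<n. ennreal (d j x) * indicator (E j) x) = (\<Sum>j<n. ennreal (d j x * indicator (E j) x))"
      by (simp only:)
    also have "\<dots> = ennreal (\<Sum>j<n. d j x * indicator (E j) x)"
      by (rule sum_ennreal) (simp add: d)
    finally show "(\<Sum>j<n. ennreal (d j x) * indicator (E j) x) = ennreal (\<Sum>j<n. d j x * indicator (E j) x)" .
  qed
  finally show ?thesis .
qed

definition s :: "nat \<Rightarrow> 'a \<Rightarrow> real" where
  "s n x = (\<Sum>j<n. c j (\<pi> j x))"

definition g :: "nat \<Rightarrow> 'a \<Rightarrow> real" where
  "g n x = (\<Sum>j<n. c j (\<pi> j x) * indicator (E j) x)"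

lemma s_nonneg: "0 \<le> s n x" and g_nonneg: "0 \<le> g n x"
  by (auto simp: s_def g_def c_nonneg intro!: sum_nonneg)

lemma g_le_s: "g n x \<le> s n x"
  unfolding s_def g_def by (intro sum_mono) (auto simp: c_nonneg split: split_indicator)

lemma s_Suc: "s (Suc n) x = s n x + c n (\<pi> n x)"
  and g_Suc: "g (Suc n) x = g n x + c n (\<pi> n x) * indicator (E n) x"
  by (simp_all add: s_def g_def)

lemma s_mono: "m \<le> n \<Longrightarrow> s m x \<le> s n x"
  unfolding s_def by (intro sum_mono2) (auto simp: c_nonneg)

text \<open>\<open>s (Suc j)\<close> adds the generations up to and including \<open>j\<close>,
  whose labels are determined by that of generation \<open>j\<close>. Hence the right end point of
  an increment may appear in \<open>d j\<close>.\<close>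

lemma s_adapted: "\<pi> j x = \<pi> j y \<Longrightarrow> s (Suc j) x = s (Suc j) y"
  unfolding s_def by (intro sum.cong refl arg_cong2[where f = c]) (auto intro: label_refine[of _ j])

lemma c_measurable [measurable]: "(\<lambda>x. c j (\<pi> j x)) \<in> borel_measurable M"
  by (rule measurable_compose[OF label_measurable]) auto

lemma s_measurable [measurable]: "s n \<in> borel_measurable M"
  and g_measurable [measurable]: "g n \<in> borel_measurable M"
  unfolding s_def g_def by measurable

text \<open>Telescoping writes the power of \<open>s\<close> as a sum of adapted increments, which
  can be cut down to the sets \<open>E j\<close>. Since \<open>t - 1 \<le> 0\<close> and
  \<open>g \<le> s\<close>, the power of \<open>s\<close> in an increment may then be replaced by
  that of \<open>g\<close>, and the sum telescopes back to the power of \<open>g\<close> at the cost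
  of \<open>1 / t\<close>.\<close>

lemma nn_integral_partial_sum_le_concave:
  assumes t: "0 < t" "t \<le> 1"
  shows "(\<integral>\<^sup>+x. ennreal (s n x powr t) \<partial>M) \<le> ennreal (K / t) * (\<integral>\<^sup>+x. ennreal (g n x powr t) \<partial>M)"
proof -
  define d where "d j x = c j (\<pi> j x) * s (Suc j) x powr (t - 1)" for j x
  have "s n x powr t \<le> (\<Sum>j<n. d j x)" for x
  proof (induction n)
    case (Suc n)
    have "s (Suc n) x powr t - s n x powr t \<le> d n x"
      using powr_diff_le(1)[OF t s_nonneg s_mono[of n "Suc n"], of x] by (simp add: d_def s_Suc)
    with Suc show ?case by simp
  qed (simp add: s_def)
  then have "(\<integral>\<^sup>+x. ennreal (s n x powr t) \<partial>M) \<le> (\<integral>\<^sup>+x. ennreal (\<Sum>j<n. d j x) \<partial>M)"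
    by (intro nn_integral_mono ennreal_leI)
  also have "\<dots> \<le> ennreal K * (\<integral>\<^sup>+x. ennreal (\<Sum>j<n. d j x * indicator (E j) x) \<partial>M)"
  proof (rule nn_integral_adapted_le)
    show "d j x = d j y" if "\<pi> j x = \<pi> j y" for j x y
      using s_adapted[OF that] that by (simp add: d_def)
    show "d j \<in> borel_measurable M" for j
      unfolding d_def by measurable
  qed (auto simp: d_def c_nonneg)
  also have "\<dots> \<le> ennreal K * (\<integral>\<^sup>+x. ennreal (1 / t) * ennreal (g n x powr t) \<partial>M)"
  proof (intro mult_left_mono nn_integral_mono)
    fix x
    have "t * (\<Sum>j<n. d j x * indicator (E j) x) \<le> g n x powr t"
    proof (induction n)
      case (Suc n)
      \<comment> \<open>Comparing the nonpositive powers of \<open>s\<close> and \<open>g\<close>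
        requires \<open>g (Suc n) x > 0\<close>, since \<open>0 powr (t - 1)\<close> is
        \<open>0\<close>. This positivity holds exactly where the new term contributes; elsewhere
        both sides vanish.\<close>
      have "d n x * indicator (E n) x \<le> (g (Suc n) x - g n x) * g (Suc n) x powr (t - 1)"
      proof (cases "x \<in> E n \<and> c n (\<pi> n x) \<noteq> 0")
        case True
        then have "0 < g (Suc n) x"
          using g_nonneg[of n x] c_nonneg[of n "\<pi> n x"] by (auto simp: g_Suc)
        then have "s (Suc n) x powr (t - 1) \<le> g (Suc n) x powr (t - 1)"
          using t by (intro powr_mono2' g_le_s) auto
        then show ?thesis
          using True c_nonneg[of n "\<pi> n x"] by (auto simp: d_def g_Suc intro!: mult_left_mono)
      qed (auto simp: d_def g_Suc)
      then have "t * (d n x * indicator (E n) x) \<le> t * ((g (Suc n) x - g n x) * g (Suc n) x powr (t - 1))"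
        using t by (intro mult_left_mono) auto
      also have "\<dots> \<le> g (Suc n) x powr t - g n x powr t"
        by (rule powr_diff_le(2)[OF t g_nonneg]) (simp add: g_Suc c_nonneg)
      finally show ?case
        using Suc by (simp add: algebra_simps)
    qed (simp add: g_def)
    then show "ennreal (\<Sum>j<n. d j x * indicator (E j) x) \<le> ennreal (1 / t) * ennreal (g n x powr t)"
      using t by (subst ennreal_mult[symmetric]) (auto simp: field_simps intro!: ennreal_leI)
  qed simp
  also have "\<dots> = ennreal (K / t) * (\<integral>\<^sup>+x. ennreal (g n x powr t) \<partial>M)"
    using t K_pos
    by (subst nn_integral_cmult) (auto simp: mult.assoc[symmetric] ennreal_mult[symmetric])
  finally show ?thesis .
qed

text \<open>Here the finiteness assumption is what allows the absorption of half of the left-hand side.\<close>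

lemma nn_integral_partial_sum_le_convex:
  assumes t: "1 \<le> t" and fin: "(\<integral>\<^sup>+x. ennreal (s n x powr t) \<partial>M) < top"
  shows "(\<integral>\<^sup>+x. ennreal (s n x powr t) \<partial>M)
    \<le> ennreal (2 * K * t * (2 * K * t) powr (t - 1)) * (\<integral>\<^sup>+x. ennreal (g n x powr t) \<partial>M)"
proof -
  define C where "C = t * (2 * K * t) powr (t - 1)"
  have C: "0 \<le> C" using t K_pos by (simp add: C_def)
  define d where "d j x = t * (c j (\<pi> j x) * s (Suc j) x powr (t - 1))" for j x
  define I where "I = (\<integral>\<^sup>+x. ennreal (s n x powr t) \<partial>M)"
  define J where "J = (\<integral>\<^sup>+x. ennreal (g n x powr t) \<partial>M)"
  have "s n x powr t \<le> (\<Sum>j<n. d j x)" for x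
  proof (induction n)
    case (Suc n)
    have "s (Suc n) x powr t - s n x powr t \<le> d n x"
      using powr_diff_le_ge1[OF t s_nonneg s_mono[of n "Suc n"], of x] by (simp add: d_def s_Suc)
    with Suc show ?case by simp
  qed (simp add: s_def)
  then have "I \<le> (\<integral>\<^sup>+x. ennreal (\<Sum>j<n. d j x) \<partial>M)"
    unfolding I_def by (intro nn_integral_mono ennreal_leI)
  also have "\<dots> \<le> ennreal K * (\<integral>\<^sup>+x. ennreal (\<Sum>j<n. d j x * indicator (E j) x) \<partial>M)"
  proof (rule nn_integral_adapted_le)
    show "d j x = d j y" if "\<pi> j x = \<pi> j y" for j x y
      using s_adapted[OF that] that by (simp add: d_def)
    show "d j \<in> borel_measurable M" for j
      unfolding d_def by measurable
  qed (use t in \<open>auto simp: d_def c_nonneg\<close>)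
  \<comment> \<open>The factor \<open>1 / (2 * K)\<close> is chosen so that multiplication by
    \<open>K\<close> leaves half of \<open>I\<close>, which is absorbed at the end.\<close>
  also have "\<dots> \<le> ennreal K * (\<integral>\<^sup>+x. ennreal (1 / (2 * K)) * ennreal (s n x powr t) + ennreal C * ennreal (g n x powr t) \<partial>M)"
  proof (intro mult_left_mono nn_integral_mono)
    fix x
    \<comment> \<open>For \<open>t \<ge> 1\<close> the power of \<open>s (Suc j)\<close> can be
      enlarged to that of \<open>s n\<close>; it leaves the sum, and what remains is
      \<open>g n\<close>.\<close>
    have "(\<Sum>j<n. d j x * indicator (E j) x) \<le> (\<Sum>j<n. t * s n x powr (t - 1) * (c j (\<pi> j x) * indicator (E j) x))"
    proof (intro sum_mono)
      fix j assume "j \<in> {..<n}"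
      then have "s (Suc j) x powr (t - 1) \<le> s n x powr (t - 1)"
        using t by (intro powr_mono2 s_nonneg s_mono) auto
      then have "c j (\<pi> j x) * s (Suc j) x powr (t - 1) \<le> c j (\<pi> j x) * s n x powr (t - 1)"
        by (intro mult_left_mono c_nonneg)
      then show "d j x * indicator (E j) x \<le> t * s n x powr (t - 1) * (c j (\<pi> j x) * indicator (E j) x)"
        using t by (auto simp: d_def mult_ac split: split_indicator)
    qed
    also have "\<dots> = t * s n x powr (t - 1) * g n x"
      unfolding g_def by (rule sum_distrib_left[symmetric])
    \<comment> \<open>Either \<open>g\<close> is so small against \<open>s\<close> that the product
      is absorbed, or \<open>s \<le> 2 * K * t * g\<close> and the power of \<open>s\<close> is
      bounded by that of \<open>g\<close>. The second case produces \<open>C\<close>.\<close>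
    also have "\<dots> \<le> 1 / (2 * K) * s n x powr t + C * g n x powr t"
    proof (cases "t * g n x \<le> 1 / (2 * K) * s n x")
      case True
      then have "(t * g n x) * s n x powr (t - 1) \<le> (1 / (2 * K) * s n x) * s n x powr (t - 1)"
        by (intro mult_right_mono) auto
      also have "\<dots> = 1 / (2 * K) * s n x powr t"
        using s_nonneg[of n x] by (cases "s n x = 0") (simp_all add: powr_mult_base mult.assoc)
      finally show ?thesis
        using mult_nonneg_nonneg[OF C powr_ge_zero[of "g n x" t]] by (simp add: mult_ac)
    next
      case False
      then have "s n x \<le> 2 * K * t * g n x"
        using K_pos by (simp add: field_simps)
      then have "s n x powr (t - 1) \<le> (2 * K * t * g n x) powr (t - 1)"
        using t by (intro powr_mono2 s_nonneg) auto
      also have "\<dots> = (2 * K * t) powr (t - 1) * g n x powr (t - 1)"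
        using t K_pos g_nonneg by (intro powr_mult)
      finally have "t * g n x * s n x powr (t - 1)
          \<le> t * g n x * ((2 * K * t) powr (t - 1) * g n x powr (t - 1))"
        using t g_nonneg[of n x] by (intro mult_left_mono) auto
      also have "\<dots> = C * (g n x * g n x powr (t - 1))"
        by (simp add: C_def)
      also have "g n x * g n x powr (t - 1) = g n x powr t"
        using g_nonneg[of n x] by (cases "g n x = 0") (simp_all add: powr_mult_base)
      finally show ?thesis
        using K_pos by (simp add: mult_ac add_increasing)
    qed
    finally show "ennreal (\<Sum>j<n. d j x * indicator (E j) x)
        \<le> ennreal (1 / (2 * K)) * ennreal (s n x powr t) + ennreal C * ennreal (g n x powr t)"
      using C K_pos by (auto simp: ennreal_mult[symmetric] ennreal_plus[symmetric] simp del: ennreal_plus intro!: ennreal_leI)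
  qed simp
  also have "\<dots> = ennreal K * (ennreal (1 / (2 * K)) * I + ennreal C * J)"
    by (simp add: nn_integral_add nn_integral_cmult I_def J_def)
  also have "\<dots> = ennreal (1 / 2) * I + ennreal (K * C) * J"
    using K_pos C by (simp add: distrib_left mult.assoc[symmetric] ennreal_mult[symmetric])
  finally have IJ: "I \<le> ennreal (1 / 2) * I + ennreal (K * C) * J" .
  have "I \<le> ennreal (2 * K * C) * J"
  proof (cases "J = top")
    case True
    then show ?thesis
      using t K_pos by (auto simp: ennreal_mult_top C_def)
  next
    case False
    then obtain i j where "I = ennreal i" "J = ennreal j" "0 \<le> i" "0 \<le> j"
      using fin by (metis I_def ennreal_cases less_irrefl)
    have half: "ennreal h * ennreal i + ennreal (K * C) * ennreal j = ennreal (h * i + K * C * j)"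
      if "0 \<le> h" "0 \<le> i" "0 \<le> j" for h i j
      using that K_pos C by (simp add: ennreal_mult)
    have "ennreal i \<le> ennreal (1 / 2) * ennreal i + ennreal (K * C) * ennreal j"
      using IJ unfolding \<open>I = ennreal i\<close> \<open>J = ennreal j\<close> .
    also have "\<dots> = ennreal (1 / 2 * i + K * C * j)"
      by (rule half) (use \<open>0 \<le> i\<close> \<open>0 \<le> j\<close> in auto)
    finally have "ennreal i \<le> ennreal (1 / 2 * i + K * C * j)" .
    then have "i \<le> 1 / 2 * i + K * C * j"
      using \<open>0 \<le> i\<close> \<open>0 \<le> j\<close> K_pos C by (subst (asm) ennreal_le_iff) auto
    then show ?thesis
      using \<open>I = ennreal i\<close> \<open>J = ennreal j\<close> \<open>0 \<le> j\<close> K_pos C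
      by (simp add: ennreal_mult[symmetric] ennreal_leI)
  qed
  then show ?thesis
    by (simp add: I_def J_def C_def mult_ac)
qed

text \<open>Truncation leaves fewer labels at which ampleness is demanded, so the estimates hold for
  truncated coefficients with the same \<open>K\<close> and \<open>E\<close>.\<close>

lemma ample_subsets_restrict: "ample_subsets M \<pi> K E (\<lambda>j k. if P k then c j k else 0)"
  by unfold_locales (use ample in \<open>auto simp: K_pos c_nonneg split: if_splits\<close>)

end

context cell_filtration
begin

text \<open>Supplies the finiteness that absorption needs: with finitely many labels the partial sum
  is bounded by \<open>B\<close> and vanishes outside a finite union \<open>U\<close> of cells of
  finite measure.\<close>

lemma nn_integral_partial_sum_finite:
  assumes c: "\<And>j k. 0 \<le> c j k" "\<And>j k. k \<notin> A \<Longrightarrow> c j k = 0" and A: "finite A" and t: "0 < (t::real)"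
  shows "(\<integral>\<^sup>+x. ennreal ((\<Sum>j<n. c j (\<pi> j x)) powr t) \<partial>M) < top"
proof -
  define B where "B = (\<Sum>j<n. \<Sum>k\<in>A. c j k)"
  define U where "U = (\<Union>j<n. \<Union>k\<in>A. {x \<in> space M. \<pi> j x = k})"
  have [measurable]: "U \<in> sets M"
    unfolding U_def using A by (intro sets.finite_UN) auto
  have "(\<integral>\<^sup>+x. ennreal ((\<Sum>j<n. c j (\<pi> j x)) powr t) \<partial>M) \<le> (\<integral>\<^sup>+x. ennreal (B powr t) * indicator U x \<partial>M)"
  proof (rule nn_integral_mono)
    fix x assume x: "x \<in> space M"
    show "ennreal ((\<Sum>j<n. c j (\<pi> j x)) powr t) \<le> ennreal (B powr t) * indicator U x"
    proof (cases "x \<in> U")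
      case True
      have "c j (\<pi> j x) \<le> (\<Sum>k\<in>A. c j k)" for j
        using c A by (cases "\<pi> j x \<in> A") (auto intro: member_le_sum sum_nonneg)
      then have "(\<Sum>j<n. c j (\<pi> j x)) \<le> B"
        unfolding B_def by (rule sum_mono)
      with True t c show ?thesis
        by (auto intro!: ennreal_leI powr_mono2 sum_nonneg)
    next
      case False
      with x c have "c j (\<pi> j x) = 0" if "j < n" for j
        using that by (auto simp: U_def)
      then show ?thesis by simp
    qed
  qed
  also have "\<dots> = ennreal (B powr t) * emeasure M U"
    by (simp add: nn_integral_cmult)
  also have "\<dots> < top"
  proof -
    have "emeasure M U \<le> (\<Sum>j<n. \<Sum>k\<in>A. emeasure M {x \<in> space M. \<pi> j x = k})"
      unfolding U_def using A
      by (intro order_trans[OF emeasure_subadditive_finite] sum_mono sets.finite_UN) auto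
    also have "\<dots> < top"
      using cell_finite A by (simp add: ennreal_sum_less_top)
    finally show ?thesis
      by (simp add: ennreal_mult_less_top)
  qed
  finally show ?thesis .
qed

end

context ample_subsets
begin

text \<open>The constant involves \<open>K\<close> and \<open>t\<close> only, not the coefficients
  or the sets \<open>E j\<close>. This uniformity is what the sequence norms need, where the sets
  are chosen after the sequence is given.\<close>

definition sum_const :: "real \<Rightarrow> real" where
  "sum_const t = (if t \<le> 1 then K / t else 2 * K * t * (2 * K * t) powr (t - 1))"

lemma nn_integral_partial_sum_le:
  assumes t: "0 < t"
  shows "(\<integral>\<^sup>+x. ennreal (s n x powr t) \<partial>M) \<le> ennreal (sum_const t) * (\<integral>\<^sup>+x. ennreal (g n x powr t) \<partial>M)"
proof (cases "t \<le> 1")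
  case True
  with nn_integral_partial_sum_le_concave[of t n] t show ?thesis
    by (simp add: sum_const_def)
next
  case False
  \<comment> \<open>The integral of the power need not be finite a priori, as infinitely many cells
    may carry a coefficient. Keeping only the labels with code below \<open>N\<close> makes it
    finite, and the bound does not depend on \<open>N\<close>.\<close>
  define cN where "cN N j k = (if to_nat k < N then c j k else 0)" for N j k
  define sN where "sN N x = (\<Sum>j<n. cN N j (\<pi> j x))" for N x
  have [measurable]: "sN N \<in> borel_measurable M" for N
  proof -
    have "(\<lambda>x. cN N j (\<pi> j x)) \<in> borel_measurable M" for j
      by (rule measurable_compose[OF label_measurable]) auto
    then show ?thesis unfolding sN_def by measurable
  qed
  have cN: "0 \<le> cN N j k" "cN N j k \<le> c j k" for N j k
    by (auto simp: cN_def c_nonneg)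
  have sN: "0 \<le> sN N x" "sN N x \<le> s n x" for N x
    unfolding sN_def s_def by (auto intro!: sum_nonneg sum_mono cN)
  have bound: "(\<integral>\<^sup>+x. ennreal (sN N x powr t) \<partial>M) \<le> ennreal (sum_const t) * (\<integral>\<^sup>+x. ennreal (g n x powr t) \<partial>M)" for N
  proof -
    interpret N: ample_subsets M \<pi> K E "cN N"
      unfolding cN_def by (rule ample_subsets_restrict)
    have fin: "finite {k :: 'b. to_nat k < N}"
      using finite_vimageI[OF finite_lessThan[of N] inj_to_nat[where 'a = 'b]] by (simp add: vimage_def)
    have "N.s n = sN N"
      by (simp add: N.s_def[abs_def] sN_def[abs_def])
    then have "(\<integral>\<^sup>+x. ennreal (sN N x powr t) \<partial>M) < top"
      unfolding sN_def using False
      by (intro nn_integral_partial_sum_finite[OF _ _ fin]) (auto simp: cN_def c_nonneg)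
    then have "(\<integral>\<^sup>+x. ennreal (sN N x powr t) \<partial>M) \<le> ennreal (sum_const t) * (\<integral>\<^sup>+x. ennreal (N.g n x powr t) \<partial>M)"
      using N.nn_integral_partial_sum_le_convex[of t n] False \<open>N.s n = sN N\<close> by (simp add: sum_const_def)
    also have "\<dots> \<le> ennreal (sum_const t) * (\<integral>\<^sup>+x. ennreal (g n x powr t) \<partial>M)"
      using t cN by (intro mult_left_mono nn_integral_mono ennreal_leI powr_mono2 N.g_nonneg)
        (auto simp: N.g_def g_def intro!: sum_mono mult_right_mono)
    finally show ?thesis .
  qed
  have "(\<integral>\<^sup>+x. ennreal (s n x powr t) \<partial>M) = (\<integral>\<^sup>+x. (SUP N. ennreal (sN N x powr t)) \<partial>M)"
  proof (rule nn_integral_cong, rule antisym)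
    fix x
    \<comment> \<open>At a fixed point only the \<open>n\<close> cells containing it matter. The
      truncation is exact there once \<open>N\<close> exceeds their codes, each of which is at most
      the sum of all.\<close>
    define N where "N = Suc (\<Sum>j<n. to_nat (\<pi> j x))"
    have "to_nat (\<pi> j x) < N" if "j < n" for j
      unfolding N_def using that by (intro le_imp_less_Suc member_le_sum) auto
    then have "s n x = sN N x"
      unfolding s_def sN_def cN_def by (intro sum.cong) auto
    then show "ennreal (s n x powr t) \<le> (SUP N. ennreal (sN N x powr t))"
      by (auto intro: SUP_upper)
    show "(SUP N. ennreal (sN N x powr t)) \<le> ennreal (s n x powr t)"
      using t sN by (intro SUP_least ennreal_leI powr_mono2) auto
  qed
  also have "\<dots> = (SUP N. \<integral>\<^sup>+x. ennreal (sN N x powr t) \<partial>M)"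
  proof (rule nn_integral_monotone_convergence_SUP)
    show "incseq (\<lambda>N x. ennreal (sN N x powr t))"
      using t sN by (auto simp: incseq_def le_fun_def intro!: ennreal_leI powr_mono2)
        (auto simp: sN_def cN_def c_nonneg intro!: sum_mono)
  qed auto
  also have "\<dots> \<le> ennreal (sum_const t) * (\<integral>\<^sup>+x. ennreal (g n x powr t) \<partial>M)"
    by (intro SUP_least bound)
  finally show ?thesis .
qed

lemma nn_integral_sum_le:
  assumes t: "0 < t"
  shows "(\<integral>\<^sup>+x. enn_powr (\<Sum>j. ennreal (c j (\<pi> j x))) t \<partial>M)
    \<le> ennreal (sum_const t) * (\<integral>\<^sup>+x. enn_powr (\<Sum>j. ennreal (c j (\<pi> j x) * indicator (E j) x)) t \<partial>M)"
proof -
  have "(\<Sum>j. ennreal (c j (\<pi> j x))) = (SUP n. ennreal (s n x))" for x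
    by (simp add: suminf_eq_SUP s_def sum_ennreal c_nonneg)
  then have "(\<integral>\<^sup>+x. enn_powr (\<Sum>j. ennreal (c j (\<pi> j x))) t \<partial>M) = (\<integral>\<^sup>+x. (SUP n. ennreal (s n x powr t)) \<partial>M)"
    using t by (simp add: enn_powr_SUP enn_powr_ennreal s_nonneg)
  also have "\<dots> = (SUP n. \<integral>\<^sup>+x. ennreal (s n x powr t) \<partial>M)"
  proof (rule nn_integral_monotone_convergence_SUP)
    show "incseq (\<lambda>n x. ennreal (s n x powr t))"
      using t by (auto simp: incseq_def le_fun_def intro!: ennreal_leI powr_mono2 s_mono s_nonneg)
  qed auto
  also have "\<dots> \<le> (SUP n. ennreal (sum_const t) * (\<integral>\<^sup>+x. ennreal (g n x powr t) \<partial>M))"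
    by (intro SUP_mono' nn_integral_partial_sum_le t)
  also have "\<dots> \<le> ennreal (sum_const t) * (\<integral>\<^sup>+x. enn_powr (\<Sum>j. ennreal (c j (\<pi> j x) * indicator (E j) x)) t \<partial>M)"
  proof (intro SUP_least mult_left_mono nn_integral_mono)
    fix n x
    have "ennreal (g n x) \<le> (\<Sum>j. ennreal (c j (\<pi> j x) * indicator (E j) x))"
      unfolding g_def by (intro ennreal_sum_le_suminf) (simp add: c_nonneg)
    then show "ennreal (g n x powr t) \<le> enn_powr (\<Sum>j. ennreal (c j (\<pi> j x) * indicator (E j) x)) t"
      using t by (subst enn_powr_ennreal[symmetric]) (auto simp: g_nonneg intro!: enn_powr_mono)
  qed simp
  finally show ?thesis .
qed

section \<open>Running maxima, the substitute for partial sums when the inner exponent is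
  infinite\<close>

primrec m :: "nat \<Rightarrow> 'a \<Rightarrow> real" where
  "m 0 x = 0"
| "m (Suc n) x = max (m n x) (c n (\<pi> n x))"

lemma m_nonneg: "0 \<le> m n x"
  by (induction n) auto

text \<open>The bound is \<open>Suc i\<close> because \<open>m (Suc i)\<close> sees the generations
  up to and including \<open>i\<close>; both ends of the increment of generation \<open>i\<close>
  are therefore constant on its cells.\<close>

lemma m_adapted: "j \<le> Suc i \<Longrightarrow> \<pi> i x = \<pi> i y \<Longrightarrow> m j x = m j y"
proof (induction j)
  case (Suc j)
  then show ?case using label_refine[of j i x y] by simp
qed simp

lemma m_measurable [measurable]: "m n \<in> borel_measurable M"
proof (induction n)
  case 0
  then show ?case by (simp add: m_def)
next
  case (Suc n)
  note [measurable] = Suc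
  have "m (Suc n) = (\<lambda>x. max (m n x) (c n (\<pi> n x)))" by auto
  then show ?case by simp
qed

lemma nn_integral_SUP_le:
  "(\<integral>\<^sup>+x. (SUP j. ennreal (c j (\<pi> j x))) \<partial>M)
    \<le> ennreal K * (\<integral>\<^sup>+x. (SUP j. ennreal (c j (\<pi> j x) * indicator (E j) x)) \<partial>M)"
proof -
  define d where "d j x = m (Suc j) x - m j x" for j x
  have sum_d: "(\<Sum>j<n. d j x) = m n x" for n x
    by (induction n) (auto simp: d_def)
  have "(SUP j. ennreal (c j (\<pi> j x))) = (SUP n. ennreal (m n x))" for x
  proof (rule antisym)
    have "c j (\<pi> j x) \<le> m (Suc j) x" for j by simp
    then show "(SUP j. ennreal (c j (\<pi> j x))) \<le> (SUP n. ennreal (m n x))"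
      by (blast intro: SUP_mono ennreal_leI)
    have "ennreal (m n x) \<le> (SUP j. ennreal (c j (\<pi> j x)))" for n
    proof (induction n)
      case (Suc n)
      then show ?case
        using SUP_upper[of n UNIV "\<lambda>j. ennreal (c j (\<pi> j x))"] by (auto simp: max_def)
    qed simp
    then show "(SUP n. ennreal (m n x)) \<le> (SUP j. ennreal (c j (\<pi> j x)))"
      by (rule SUP_least)
  qed
  then have "(\<integral>\<^sup>+x. (SUP j. ennreal (c j (\<pi> j x))) \<partial>M) = (\<integral>\<^sup>+x. (SUP n. ennreal (m n x)) \<partial>M)"
    by simp
  also have "\<dots> = (SUP n. \<integral>\<^sup>+x. ennreal (m n x) \<partial>M)"
  proof (rule nn_integral_monotone_convergence_SUP)
    show "incseq (\<lambda>n x. ennreal (m n x))"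
      by (rule incseq_SucI) (auto simp: le_fun_def intro!: ennreal_leI)
  qed auto
  also have "\<dots> \<le> ennreal K * (\<integral>\<^sup>+x. (SUP j. ennreal (c j (\<pi> j x) * indicator (E j) x)) \<partial>M)"
  proof (rule SUP_least)
    fix n
    have "(\<integral>\<^sup>+x. ennreal (m n x) \<partial>M) \<le> ennreal K * (\<integral>\<^sup>+x. ennreal (\<Sum>j<n. d j x * indicator (E j) x) \<partial>M)"
      unfolding sum_d[symmetric]
    proof (rule nn_integral_adapted_le)
      show "d j x = 0" if "c j (\<pi> j x) = 0" for j x
        using that m_nonneg[of j x] by (simp add: d_def)
      show "d j x = d j y" if "\<pi> j x = \<pi> j y" for j x y
        using that m_adapted[of j j x y] m_adapted[of "Suc j" j x y] by (simp add: d_def)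
      show "d j \<in> borel_measurable M" for j
        unfolding d_def by measurable
    qed (simp add: d_def)
    also have "\<dots> \<le> ennreal K * (\<integral>\<^sup>+x. (SUP j. ennreal (c j (\<pi> j x) * indicator (E j) x)) \<partial>M)"
    proof (intro mult_left_mono nn_integral_mono)
      fix x
      have le: "(\<Sum>j<n. d j x * indicator (E j) x) \<le> (\<Sum>j<n. d j x)" for n
        by (intro sum_mono) (auto simp: d_def split: split_indicator)
      show "ennreal (\<Sum>j<n. d j x * indicator (E j) x) \<le> (SUP j. ennreal (c j (\<pi> j x) * indicator (E j) x))"
      proof (induction n)
        case (Suc n)
        show ?case
        \<comment> \<open>If generation \<open>n\<close> raises the maximum at a point of
          \<open>E n\<close>, the whole partial sum is at most the new maximum
          \<open>c n (\<pi> n x)\<close>, a member of the restricted supremum. Otherwise the last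
          term is zero.\<close>
        proof (cases "x \<in> E n \<and> m n x < c n (\<pi> n x)")
          case True
          then have "(\<Sum>j<Suc n. d j x * indicator (E j) x) \<le> c n (\<pi> n x) * indicator (E n) x"
            using le[of "Suc n"] sum_d[of x "Suc n"] by simp
          then show ?thesis
            using SUP_upper[of n UNIV "\<lambda>j. ennreal (c j (\<pi> j x) * indicator (E j) x)"]
            by (meson ennreal_leI order_trans UNIV_I)
        next
          case False
          then have "d n x * indicator (E n) x = 0"
            by (auto simp: d_def)
          with Suc show ?thesis by (simp only: sum.lessThan_Suc add_0_right)
        qed
      qed simp
    qed simp
    finally show "(\<integral>\<^sup>+x. ennreal (m n x) \<partial>M) \<le> ennreal K * (\<integral>\<^sup>+x. (SUP j. ennreal (c j (\<pi> j x) * indicator (E j) x)) \<partial>M)" .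
  qed
  finally show ?thesis .
qed

end

section \<open>Dyadic cubes and sequence norms\<close>

definition dyadic_index :: "nat \<Rightarrow> real ^ 'd \<Rightarrow> int ^ 'd" where
  "dyadic_index j x = (\<chi> l. \<lfloor>2 ^ j * x $ l\<rfloor>)"

lemma dyadic_cube_iff: "x \<in> dyadic_cube j k \<longleftrightarrow> dyadic_index j x = k"
  by (auto simp: dyadic_cube_def dyadic_index_def vec_eq_iff floor_eq_iff field_simps)

text \<open>In each coordinate the coarser index is the integer quotient of the finer one by
  \<open>2 ^ (j - i)\<close>.\<close>

lemma dyadic_index_refine:
  assumes "i \<le> j" "dyadic_index j x = dyadic_index j y"
  shows "dyadic_index i x = dyadic_index i y"
proof -
  have "\<lfloor>2 ^ i * x\<rfloor> = \<lfloor>2 ^ j * x\<rfloor> div 2 ^ (j - i)" for x :: real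
  proof -
    have "2 ^ i * x = (2 ^ j * x) / of_nat (2 ^ (j - i))"
      using assms(1) by (simp add: field_simps power_add[symmetric])
    then show ?thesis
      using floor_divide_real_eq_div[of "2 ^ (j - i)" "2 ^ j * x"] by simp
  qed
  with assms(2) show ?thesis
    by (simp add: dyadic_index_def vec_eq_iff)
qed

lemma dyadic_cube_borel [measurable]: "dyadic_cube j k \<in> sets borel"
proof -
  have "dyadic_cube j k = {x \<in> space borel. \<forall>l. real_of_int (k $ l) / 2 ^ j \<le> x $ l \<and> x $ l < (real_of_int (k $ l) + 1) / 2 ^ j}"
    by (simp add: dyadic_cube_def)
  also have "\<dots> \<in> sets borel"
    by measurable
  finally show ?thesis .
qed

lemma dyadic_cube_lebesgue [measurable]: "dyadic_cube j k \<in> sets lebesgue"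
  using dyadic_cube_borel sets_completionI_sets by (metis sets_lborel)

lemma dyadic_index_measurable [measurable]: "dyadic_index j \<in> measurable lebesgue (count_space UNIV)"
proof (subst measurable_count_space_eq2_countable, intro conjI ballI)
  fix k :: "int ^ 'd"
  have "dyadic_index j -` {k} \<inter> space lebesgue = dyadic_cube j k"
    by (auto simp: dyadic_cube_iff)
  then show "dyadic_index j -` {k} \<inter> space lebesgue \<in> sets lebesgue"
    by simp
qed auto

lemma dyadic_cube_bounds:
  fixes k :: "int ^ 'd" and j :: nat
  defines "a \<equiv> \<chi> l. real_of_int (k $ l) / 2 ^ j" and "b \<equiv> \<chi> l. (real_of_int (k $ l) + 1) / 2 ^ j"
  shows "box a b \<subseteq> dyadic_cube j k" "dyadic_cube j k \<subseteq> cbox a b"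
  by (auto simp: dyadic_cube_def mem_box_cart a_def b_def less_imp_le)

lemma emeasure_dyadic_cube:
  fixes k :: "int ^ 'd"
  shows "emeasure lebesgue (dyadic_cube j k) = ennreal ((1 / 2 ^ j) ^ CARD('d))"
proof -
  define a where "a = (\<chi> l. real_of_int (k $ l) / 2 ^ j)"
  define b where "b = (\<chi> l. (real_of_int (k $ l) + 1) / 2 ^ j)"
  have ab: "a \<bullet> i \<le> b \<bullet> i" "(b - a) \<bullet> i = 1 / 2 ^ j" if "i \<in> Basis" for i
    using that by (auto simp: Basis_vec_def a_def b_def inner_axis diff_divide_distrib[symmetric] field_simps)
  have "(\<Prod>i\<in>Basis. (b - a) \<bullet> i) = (1 / 2 ^ j) ^ CARD('d)"
    using ab by simp
  then have "emeasure lborel (box a b) = ennreal ((1 / 2 ^ j) ^ CARD('d))"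
    "emeasure lborel (cbox a b) = ennreal ((1 / 2 ^ j) ^ CARD('d))"
    using ab(1) by (auto simp: emeasure_lborel_box_eq emeasure_lborel_cbox_eq)
  moreover have "emeasure lborel (box a b) \<le> emeasure lborel (dyadic_cube j k)"
    "emeasure lborel (dyadic_cube j k) \<le> emeasure lborel (cbox a b)"
    using dyadic_cube_bounds[where j = j and k = k] unfolding a_def b_def by (auto intro!: emeasure_mono)
  ultimately show ?thesis
    by (simp add: emeasure_completion)
qed

text \<open>\<open>weight\<close> only speaks of integrability on compact sets; measurability
  follows by writing \<open>w\<close> as the limit of its restrictions to growing balls.\<close>

lemma weight_measurable:
  fixes w :: "real ^ 'd \<Rightarrow> real"
  assumes "weight w"
  shows "w \<in> borel_measurable lebesgue"
proof (rule borel_measurable_LIMSEQ_real)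
  fix n :: nat
  have "w absolutely_integrable_on cball 0 (real n)"
    using assms by (simp add: weight_def)
  then show "(\<lambda>x. indicat_real (cball 0 (real n)) x *\<^sub>R w x) \<in> borel_measurable lebesgue"
    unfolding set_integrable_def by (rule borel_measurable_integrable)
next
  fix x :: "real ^ 'd"
  obtain N :: nat where "norm x \<le> real N"
    using real_arch_simple by blast
  then have "\<forall>\<^sub>F n in sequentially. indicat_real (cball 0 (real n)) x *\<^sub>R w x = w x"
    unfolding eventually_sequentially by (intro exI[of _ N]) (auto simp: indicator_def)
  then show "(\<lambda>n. indicat_real (cball 0 (real n)) x *\<^sub>R w x) \<longlonglongrightarrow> w x"
    by (rule tendsto_eventually)
qed

lemma weight_locally_finite:
  fixes w :: "real ^ 'd \<Rightarrow> real"
  assumes "weight w" "bounded A"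
  shows "(\<integral>\<^sup>+x\<in>A. ennreal (w x) \<partial>lebesgue) < top"
proof -
  obtain r where r: "A \<subseteq> cball 0 r"
    using bounded_subset_ballD[OF assms(2), of 0] ball_subset_cball by blast
  have "w absolutely_integrable_on cball 0 r"
    using assms(1) by (simp add: weight_def)
  then have "(\<integral>\<^sup>+x. ennreal (norm (indicat_real (cball 0 r) x *\<^sub>R w x)) \<partial>lebesgue) < top"
    unfolding set_integrable_def integrable_iff_bounded by simp
  moreover have "(\<integral>\<^sup>+x\<in>A. ennreal (w x) \<partial>lebesgue)
      \<le> (\<integral>\<^sup>+x. ennreal (norm (indicat_real (cball 0 r) x *\<^sub>R w x)) \<partial>lebesgue)"
    using r assms(1) by (intro nn_integral_mono) (auto simp: weight_def split: split_indicator)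
  ultimately show ?thesis by order
qed

lemma bounded_dyadic_cube: "bounded (dyadic_cube j k)"
  using dyadic_cube_bounds(2) bounded_cbox bounded_subset by blast

definition lq_norm :: "ennreal \<Rightarrow> (nat \<Rightarrow> real) \<Rightarrow> ennreal" where
  "lq_norm q X = (if q = \<infinity> then SUP j. ennreal (X j)
     else enn_powr (\<Sum>j. ennreal (X j powr enn2real q)) (1 / enn2real q))"

lemma lq_norm_measurable [measurable (raw)]:
  assumes [measurable]: "\<And>j. (\<lambda>x. X x j) \<in> borel_measurable M"
  shows "(\<lambda>x. lq_norm q (X x)) \<in> borel_measurable M"
  unfolding lq_norm_def by measurable

lemma infsum_single_value:
  fixes f :: "'a \<Rightarrow> ennreal"
  assumes "\<And>x. x \<noteq> a \<Longrightarrow> f x = 0"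
  shows "(\<Sum>\<^sub>\<infinity>x. f x) = f a"
proof -
  have "infsum f UNIV = infsum f {a}"
    using assms by (intro infsum_cong_neutral) auto
  then show ?thesis by simp
qed

text \<open>Each point lies in exactly one cube of generation \<open>j\<close>, so the sum over
  \<open>k\<close> in the sequence norm has a single possibly nonzero term. This is that term before
  the inner exponent is applied.\<close>

definition scaled_value :: "real \<Rightarrow> (nat \<times> (int ^ 'd) \<Rightarrow> complex) \<Rightarrow> real ^ 'd \<Rightarrow> nat \<Rightarrow> real" where
  "scaled_value s lam x j = 2 powr (s * real j) * cmod (lam (j, dyadic_index j x))"

lemma scaled_value_nonneg: "0 \<le> scaled_value s lam x j"
  by (simp add: scaled_value_def)

lemma scaled_value_measurable [measurable]: "(\<lambda>x. scaled_value s lam x j) \<in> borel_measurable lebesgue"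
  unfolding scaled_value_def
  by (rule measurable_compose[OF dyadic_index_measurable]) auto

lemma f_norm_eq:
  fixes lam :: "nat \<times> (int ^ 'd) \<Rightarrow> complex"
  shows "f_norm s p q w lam = Lp_weighted_norm p w (\<lambda>x. lq_norm q (scaled_value s lam x))"
  unfolding f_norm_def
proof (intro arg_cong2[where f = "Lp_weighted_norm p"] refl ext)
  fix x :: "real ^ 'd"
  have ind: "indicat_real (dyadic_cube j k) x = (if k = dyadic_index j x then 1 else 0)" for j k
    by (auto simp: indicator_def dyadic_cube_iff)
  have "(\<Sum>\<^sub>\<infinity>k. ennreal (2 powr (s * real j * enn2real q) * cmod (lam (j, k)) powr enn2real q
      * indicator (dyadic_cube j k) x)) = ennreal (scaled_value s lam x j powr enn2real q)" for j
    by (subst infsum_single_value[of "dyadic_index j x"])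
      (auto simp: ind scaled_value_def powr_mult powr_powr)
  moreover have "(SUP (j, k). ennreal (2 powr (s * real j) * cmod (lam (j, k)) * indicator (dyadic_cube j k) x))
      = (SUP j. ennreal (scaled_value s lam x j))"
  proof (intro antisym SUP_least)
    fix jk :: "nat \<times> (int ^ 'd)"
    show "(case jk of (j, k) \<Rightarrow> ennreal (2 powr (s * real j) * cmod (lam (j, k)) * indicator (dyadic_cube j k) x))
        \<le> (SUP j. ennreal (scaled_value s lam x j))"
      using SUP_upper[of "fst jk" UNIV "\<lambda>j. ennreal (scaled_value s lam x j)"]
      by (cases jk) (auto simp: ind scaled_value_def)
  next
    fix j
    show "ennreal (scaled_value s lam x j)
        \<le> (SUP (j, k). ennreal (2 powr (s * real j) * cmod (lam (j, k)) * indicator (dyadic_cube j k) x))"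
      by (rule SUP_upper2[of "(j, dyadic_index j x)"]) (auto simp: ind scaled_value_def)
  qed
  ultimately show "(if q = \<infinity> then SUP (j, k). ennreal (2 powr (s * real j) * cmod (lam (j, k)) * indicator (dyadic_cube j k) x)
     else enn_powr (\<Sum>j. \<Sum>\<^sub>\<infinity>k. ennreal (2 powr (s * real j * enn2real q) * cmod (lam (j, k)) powr enn2real q
              * indicator (dyadic_cube j k) x)) (1 / enn2real q)) = lq_norm q (scaled_value s lam x)"
    by (simp add: lq_norm_def)
qed

lemma lq_norm_mono:
  assumes "\<And>j. 0 \<le> X j" "\<And>j. X j \<le> Y j"
  shows "lq_norm q X \<le> lq_norm q Y"
  using assms unfolding lq_norm_def
  by (auto intro!: SUP_mono' enn_powr_mono suminf_le ennreal_leI powr_mono2)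

text \<open>The quotient \<open>q / r\<close> with the values at infinity that keep the weighted
  average of the two ratios equal to one. An infinite \<open>q\<close> occurs only together with an
  infinite \<open>r\<close>, and then the value must be 1.\<close>

definition exponent_ratio :: "ennreal \<Rightarrow> ennreal \<Rightarrow> real" where
  "exponent_ratio q r = (if q = \<infinity> then 1 else if r = \<infinity> then 0 else enn2real q / enn2real r)"

lemma lq_norm_powr_le:
  assumes "0 < q" "0 < r" "q = \<infinity> \<longrightarrow> r = \<infinity>" "\<And>j. 0 \<le> X j" "0 \<le> h"
  defines "t \<equiv> exponent_ratio q r"
  shows "lq_norm r (\<lambda>j. X j powr t * h) \<le> enn_powr (lq_norm q X) t * ennreal h"
proof (cases "r = \<infinity>")
  case True
  show ?thesis
  proof (cases "q = \<infinity>")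
    case True
    have "ennreal (X j * h) \<le> (SUP j. ennreal (X j)) * ennreal h" for j
      using assms(4,5) by (auto simp: ennreal_mult intro!: mult_right_mono SUP_upper)
    with True \<open>r = \<infinity>\<close> assms(4) show ?thesis
      by (auto simp: lq_norm_def t_def exponent_ratio_def intro!: SUP_least)
  next
    case False
    with True have "t = 0" by (simp add: t_def exponent_ratio_def)
    \<comment> \<open>\<open>0 powr 0\<close> is \<open>0\<close>, so equality may fail where
      \<open>X j\<close> vanishes; the upper bound is all that is used.\<close>
    moreover have "X j powr 0 * h \<le> h" for j
      using assms(5) by (auto simp: powr_def)
    ultimately show ?thesis
      using True by (auto simp: lq_norm_def intro!: SUP_least ennreal_leI)
  qed
next
  case False
  with assms have "q \<noteq> \<infinity>" by auto
  define Q R where "Q = enn2real q" and "R = enn2real r"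
  have QR: "0 < Q" "0 < R"
    using assms(1,2) False \<open>q \<noteq> \<infinity>\<close> unfolding Q_def R_def
    by (auto simp: enn2real_positive_iff less_top)
  have t: "t = Q / R" using False \<open>q \<noteq> \<infinity>\<close> by (simp add: t_def exponent_ratio_def Q_def R_def)
  have "(\<Sum>j. ennreal ((X j powr t * h) powr R)) = (\<Sum>j. ennreal (X j powr Q) * ennreal (h powr R))"
    using QR assms(4,5) by (simp add: t powr_mult powr_powr ennreal_mult)
  also have "\<dots> = (\<Sum>j. ennreal (X j powr Q)) * ennreal (h powr R)"
    by simp
  finally have "lq_norm r (\<lambda>j. X j powr t * h)
      = enn_powr (\<Sum>j. ennreal (X j powr Q)) (1 / R) * enn_powr (ennreal (h powr R)) (1 / R)"
    using False QR by (simp add: lq_norm_def R_def enn_powr_mult)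
  also have "enn_powr (ennreal (h powr R)) (1 / R) = ennreal h"
    using QR assms(5) by (simp add: enn_powr_ennreal powr_powr)
  also have "enn_powr (\<Sum>j. ennreal (X j powr Q)) (1 / R) = enn_powr (lq_norm q X) t"
    using QR \<open>q \<noteq> \<infinity>\<close> by (simp add: lq_norm_def Q_def enn_powr_powr t)
  finally show ?thesis by simp
qed

section \<open>Local Muckenhoupt weights on dyadic cubes\<close>

definition weighted_measure :: "(real ^ 'd \<Rightarrow> real) \<Rightarrow> (real ^ 'd) measure" where
  "weighted_measure w = density lebesgue (\<lambda>x. ennreal (w x))"

lemma sets_weighted_measure [measurable_cong, simp]: "sets (weighted_measure w) = sets lebesgue"
  and space_weighted_measure [simp]: "space (weighted_measure w) = UNIV"
  by (simp_all add: weighted_measure_def)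

lemma emeasure_weighted_measure:
  "weight w \<Longrightarrow> A \<in> sets lebesgue \<Longrightarrow> emeasure (weighted_measure w) A = (\<integral>\<^sup>+x\<in>A. ennreal (w x) \<partial>lebesgue)"
  unfolding weighted_measure_def
  by (intro emeasure_density measurable_compose[OF weight_measurable]) auto

lemma emeasure_ball_real:
  fixes c :: "real ^ 'd"
  assumes "0 < \<rho>"
  shows "emeasure lebesgue (ball c \<rho>) = ennreal (\<rho> ^ CARD('d) * measure lebesgue (ball (0 :: real ^ 'd) 1))"
proof -
  have "emeasure lebesgue (ball (0 :: real ^ 'd) 1) = ennreal (measure lebesgue (ball (0 :: real ^ 'd) 1))"
    by (intro emeasure_eq_ennreal_measure) (simp add: emeasure_ball emeasure_completion)
  then show ?thesis
    using assms emeasure_lebesgue_ball_conv_unit_ball[of \<rho> c] by (simp add: ennreal_mult)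
qed

lemma measure_unit_ball_pos: "0 < measure lebesgue (ball (0 :: real ^ 'd) 1)"
  by (simp add: content_ball_gt_0_iff measure_completion)

text \<open>The Muckenhoupt condition in the form that the share of \<open>E\<close> in a ball is at
  most a constant times the \<open>1 / r\<close>-th power of its share of the weight, with
  denominators cleared. It is Hoelder's inequality for the indicator of \<open>E\<close>, split into
  powers of \<open>w\<close> with exponents \<open>1 / r\<close> and \<open>- 1 / r\<close>.\<close>

lemma muckenhoupt_subset_bound:
  fixes w :: "real ^ 'd \<Rightarrow> real"
  assumes w: "w \<in> muckenhoupt_loc r" and r: "1 < r"
  obtains A where "0 \<le> A"
    and "\<And>c \<rho> E. 0 < \<rho> \<Longrightarrow> measure lebesgue (ball c \<rho>) \<le> 1 \<Longrightarrow> E \<in> sets lebesgue \<Longrightarrow> E \<subseteq> ball c \<rho> \<Longrightarrow>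
      emeasure lebesgue E * enn_powr (emeasure (weighted_measure w) (ball c \<rho>)) (1 / r)
      \<le> ennreal A * emeasure lebesgue (ball c \<rho>) * enn_powr (emeasure (weighted_measure w) E) (1 / r)"
proof -
  define r' where "r' = r / (r - 1)"
  have r': "1 < r'" "1 / r + 1 / r' = 1" using r by (auto simp: r'_def field_simps)
  define \<sigma> where "\<sigma> x = enn_powr (ennreal (w x)) (- (r' / r))" for x
  have weight: "weight w" and pos: "AE x in lebesgue. 0 < w x"
    using w by (auto simp: muckenhoupt_loc_def)
  have [measurable]: "w \<in> borel_measurable lebesgue"
    by (rule weight_measurable[OF weight])
  have [measurable]: "\<sigma> \<in> borel_measurable lebesgue"
    unfolding \<sigma>_def by measurable
  define T where "T = (\<lambda>(c, \<rho>). enn_powr ((1 / emeasure lebesgue (ball c \<rho>)) *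
             (\<integral>\<^sup>+ x \<in> ball c \<rho>. ennreal (w x) \<partial>lebesgue)) (1 / r) *
         enn_powr ((1 / emeasure lebesgue (ball c \<rho>)) *
             (\<integral>\<^sup>+ x \<in> ball c \<rho>. \<sigma> x \<partial>lebesgue)) (1 / r'))"
  have "(SUP z \<in> {(c, \<rho>). 0 < \<rho> \<and> measure lebesgue (ball c \<rho>) \<le> 1}. T z) < top"
    using w by (simp add: muckenhoupt_loc_def r'_def \<sigma>_def T_def Let_def)
  then obtain A where A: "0 \<le> A" "(SUP z \<in> {(c, \<rho>). 0 < \<rho> \<and> measure lebesgue (ball c \<rho>) \<le> 1}. T z) = ennreal A"
    by (rule less_top_ennreal)
  show thesis
  proof (rule that[OF A(1)])
    fix c :: "real ^ 'd" and \<rho> E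
    assume \<rho>: "0 < \<rho>" "measure lebesgue (ball c \<rho>) \<le> 1" and [measurable]: "E \<in> sets lebesgue" and E: "E \<subseteq> ball c \<rho>"
    define b where "b = \<rho> ^ CARD('d) * measure lebesgue (ball (0 :: real ^ 'd) 1)"
    have b: "0 < b" "emeasure lebesgue (ball c \<rho>) = ennreal b"
      unfolding b_def using \<rho>(1) by (intro mult_pos_pos measure_unit_ball_pos emeasure_ball_real; simp)+
    define W where "W = emeasure (weighted_measure w) (ball c \<rho>)"
    define S where "S = (\<integral>\<^sup>+x\<in>ball c \<rho>. \<sigma> x \<partial>lebesgue)"
    have "AE x in lebesgue. indicator E x
        = enn_powr (ennreal (w x) * indicator E x) (1 / r) * enn_powr (\<sigma> x * indicator E x) (1 / r')"
      using pos
    proof eventually_elim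
      case (elim x)
      have "enn_powr (ennreal (w x)) (1 / r) * enn_powr (\<sigma> x) (1 / r') = 1"
        using elim r r' by (simp add: \<sigma>_def enn_powr_ennreal_pos powr_powr ennreal_mult[symmetric] powr_add[symmetric])
      then show ?case
        using r r' by (auto split: split_indicator)
    qed
    then have "(\<integral>\<^sup>+x. indicator E x \<partial>lebesgue) = (\<integral>\<^sup>+x. enn_powr (ennreal (w x) * indicator E x) (1 / r)
        * enn_powr (\<sigma> x * indicator E x) (1 / r') \<partial>lebesgue)"
      by (rule nn_integral_cong_AE)
    also have "\<dots> \<le> enn_powr (\<integral>\<^sup>+x\<in>E. ennreal (w x) \<partial>lebesgue) (1 / r) * enn_powr (\<integral>\<^sup>+x\<in>E. \<sigma> x \<partial>lebesgue) (1 / r')"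
      using r r' by (intro nn_integral_Holder) auto
    also have "\<dots> \<le> enn_powr (emeasure (weighted_measure w) E) (1 / r) * enn_powr S (1 / r')"
      using E r r' unfolding S_def
      by (intro mult_mono enn_powr_mono nn_integral_mono)
        (auto simp: emeasure_weighted_measure weight split: split_indicator)
    also have "(\<integral>\<^sup>+x. indicator E x \<partial>lebesgue) = emeasure lebesgue E"
      by (rule nn_integral_indicator) simp
    finally have "emeasure lebesgue E \<le> enn_powr (emeasure (weighted_measure w) E) (1 / r) * enn_powr S (1 / r')" .
    from mult_left_mono[OF this, of "enn_powr W (1 / r)"]
    have "emeasure lebesgue E * enn_powr W (1 / r)
        \<le> (enn_powr W (1 / r) * enn_powr S (1 / r')) * enn_powr (emeasure (weighted_measure w) E) (1 / r)"
      by (simp only: mult_ac zero_le)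
    also have "enn_powr W (1 / r) * enn_powr S (1 / r') \<le> ennreal A * ennreal b"
    proof -
      \<comment> \<open>Takes the averaging factors out of the two terms of \<open>T\<close>. As
        \<open>1 / r + 1 / r' = 1\<close>, they recombine to the volume \<open>b\<close> of the
        ball.\<close>
      have scale: "enn_powr X e = ennreal (b powr e) * enn_powr (1 / ennreal b * X) e" if "0 < e" for X e
      proof -
        have "ennreal b * (1 / ennreal b) = 1"
          using b by (simp add: ennreal_divide_times[symmetric] divide_ennreal_def ennreal_mult[symmetric] inverse_ennreal)
        then have "X = ennreal b * (1 / ennreal b * X)"
          by (metis mult.assoc mult_1)
        then have "enn_powr X e = enn_powr (ennreal b) e * enn_powr (1 / ennreal b * X) e"
          using that enn_powr_mult[of e "ennreal b" "1 / ennreal b * X"] by simp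
        with b that show ?thesis by (simp add: enn_powr_ennreal)
      qed
      have "enn_powr W (1 / r) * enn_powr S (1 / r') = ennreal (b powr (1 / r)) * ennreal (b powr (1 / r')) * T (c, \<rho>)"
      proof -
        have "W = (\<integral>\<^sup>+x\<in>ball c \<rho>. ennreal (w x) \<partial>lebesgue)"
          unfolding W_def by (simp add: emeasure_weighted_measure weight)
        then have "T (c, \<rho>) = enn_powr (1 / ennreal b * W) (1 / r) * enn_powr (1 / ennreal b * S) (1 / r')"
          by (simp only: T_def prod.case b(2) S_def)
        then show ?thesis
          using r r' scale[of "1 / r" W] scale[of "1 / r'" S] by (simp add: mult_ac)
      qed
      also have "ennreal (b powr (1 / r)) * ennreal (b powr (1 / r')) = ennreal b"
        using b r' by (simp add: ennreal_mult[symmetric] powr_add[symmetric])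
      also have "ennreal b * T (c, \<rho>) \<le> ennreal b * ennreal A"
        unfolding A(2)[symmetric] using \<rho> by (intro mult_left_mono SUP_upper) auto
      finally show ?thesis by (simp only: mult_ac)
    qed
    finally show "emeasure lebesgue E * enn_powr (emeasure (weighted_measure w) (ball c \<rho>)) (1 / r)
      \<le> ennreal A * emeasure lebesgue (ball c \<rho>) * enn_powr (emeasure (weighted_measure w) E) (1 / r)"
      unfolding W_def b(2) by (simp add: mult_right_mono)
  qed
qed

lemma muckenhoupt_subset_ratio:
  fixes w :: "real ^ 'd \<Rightarrow> real"
  assumes w: "w \<in> muckenhoupt_loc_infinity" and \<theta>: "0 < \<theta>"
  obtains C where "1 \<le> C"
    and "\<And>c \<rho> E. 0 < \<rho> \<Longrightarrow> measure lebesgue (ball c \<rho>) \<le> 1 \<Longrightarrow> E \<in> sets lebesgue \<Longrightarrow> E \<subseteq> ball c \<rho> \<Longrightarrow>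
      ennreal \<theta> * emeasure lebesgue (ball c \<rho>) \<le> emeasure lebesgue E \<Longrightarrow>
      emeasure (weighted_measure w) (ball c \<rho>) \<le> ennreal C * emeasure (weighted_measure w) E"
proof -
  obtain r where r: "1 < r" and wr: "w \<in> muckenhoupt_loc r"
    using w by (auto simp: muckenhoupt_loc_infinity_def)
  obtain A where A: "0 \<le> A" and bound: "\<And>c \<rho> E. 0 < \<rho> \<Longrightarrow> measure lebesgue (ball c \<rho>) \<le> 1 \<Longrightarrow> E \<in> sets lebesgue \<Longrightarrow> E \<subseteq> ball c \<rho> \<Longrightarrow>
      emeasure lebesgue E * enn_powr (emeasure (weighted_measure w) (ball c \<rho>)) (1 / r)
      \<le> ennreal A * emeasure lebesgue (ball c \<rho>) * enn_powr (emeasure (weighted_measure w) E) (1 / r)"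
    using muckenhoupt_subset_bound[OF wr r] by blast
  \<comment> \<open>Solving the preceding bound for the weight of the ball raises
    \<open>A / \<theta>\<close> to the power \<open>r\<close>. The maximum keeps the constant
    positive even if \<open>A\<close> is zero.\<close>
  define C where "C = max 1 ((A / \<theta>) powr r)"
  show thesis
  proof (rule that[of C])
    fix c :: "real ^ 'd" and \<rho> E
    assume \<rho>: "0 < \<rho>" "measure lebesgue (ball c \<rho>) \<le> 1" and E: "E \<in> sets lebesgue" "E \<subseteq> ball c \<rho>"
      and ratio: "ennreal \<theta> * emeasure lebesgue (ball c \<rho>) \<le> emeasure lebesgue E"
    define b where "b = \<rho> ^ CARD('d) * measure lebesgue (ball (0 :: real ^ 'd) 1)"
    have b: "0 < b" "emeasure lebesgue (ball c \<rho>) = ennreal b"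
      unfolding b_def using \<rho>(1) by (intro mult_pos_pos measure_unit_ball_pos emeasure_ball_real; simp)+
    define WB WE where "WB = enn_powr (emeasure (weighted_measure w) (ball c \<rho>)) (1 / r)"
      and "WE = enn_powr (emeasure (weighted_measure w) E) (1 / r)"
    have "ennreal \<theta> * ennreal b * WB \<le> emeasure lebesgue E * WB"
      using ratio by (intro mult_right_mono) (auto simp: b)
    also have "\<dots> \<le> ennreal A * ennreal b * WE"
      using bound[OF \<rho> E] by (simp add: WB_def WE_def b)
    finally have "ennreal (1 / (\<theta> * b)) * (ennreal \<theta> * ennreal b * WB) \<le> ennreal (1 / (\<theta> * b)) * (ennreal A * ennreal b * WE)"
      by (rule mult_left_mono) simp
    moreover have "ennreal (1 / (\<theta> * b)) * (ennreal \<theta> * ennreal b * WB) = WB"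
      using b \<theta> by (simp add: mult.assoc[symmetric] ennreal_mult[symmetric])
    moreover have "ennreal (1 / (\<theta> * b)) * (ennreal A * ennreal b * WE) = ennreal (A / \<theta>) * WE"
      using b \<theta> A by (simp add: mult.assoc[symmetric] ennreal_mult[symmetric])
    ultimately have "WB \<le> ennreal (A / \<theta>) * WE" by simp
    then have "enn_powr WB r \<le> enn_powr (ennreal (A / \<theta>) * WE) r"
      using r by (intro enn_powr_mono) auto
    then have "emeasure (weighted_measure w) (ball c \<rho>) \<le> ennreal ((A / \<theta>) powr r) * emeasure (weighted_measure w) E"
      using r A \<theta> by (simp add: enn_powr_mult enn_powr_ennreal enn_powr_powr WB_def WE_def)
    also have "\<dots> \<le> ennreal C * emeasure (weighted_measure w) E"
      by (intro mult_right_mono ennreal_leI) (auto simp: C_def)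
    finally show "emeasure (weighted_measure w) (ball c \<rho>) \<le> ennreal C * emeasure (weighted_measure w) E" .
  qed (simp add: C_def)
qed

text \<open>A doubling property among balls of the same small radius: shifting a ball by at most its
  radius costs a factor \<open>C\<close>, because both positions contain a common ball of half the
  radius. Longer shifts are divided into \<open>n\<close> equal steps.\<close>

lemma muckenhoupt_ball_chain:
  fixes w :: "real ^ 'd \<Rightarrow> real"
  assumes w: "w \<in> muckenhoupt_loc_infinity"
  obtains C where "1 \<le> C"
    and "\<And>x y \<rho> n. 0 < \<rho> \<Longrightarrow> measure lebesgue (ball (0 :: real ^ 'd) \<rho>) \<le> 1 \<Longrightarrow> norm (y - x) \<le> real n * \<rho> \<Longrightarrow>
      emeasure (weighted_measure w) (ball y \<rho>) \<le> ennreal (C ^ n) * emeasure (weighted_measure w) (ball x \<rho>)"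
proof -
  define \<theta> :: real where "\<theta> = (1 / 2) ^ CARD('d)"
  have "0 < \<theta>" by (simp add: \<theta>_def)
  from muckenhoupt_subset_ratio[OF w this]
  obtain C where C: "1 \<le> C" and ratio: "\<And>c \<rho> E. 0 < \<rho> \<Longrightarrow> measure lebesgue (ball c \<rho>) \<le> 1 \<Longrightarrow> E \<in> sets lebesgue \<Longrightarrow> E \<subseteq> ball c \<rho> \<Longrightarrow>
      ennreal \<theta> * emeasure lebesgue (ball c \<rho>) \<le> emeasure lebesgue E \<Longrightarrow>
      emeasure (weighted_measure w) (ball c \<rho>) \<le> ennreal C * emeasure (weighted_measure w) E"
    by blast
  have measure_ball: "measure lebesgue (ball c \<rho>) = measure lebesgue (ball (0 :: real ^ 'd) \<rho>)" if "0 < \<rho>" for c :: "real ^ 'd" and \<rho>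
    using emeasure_ball_real[OF that, of c] emeasure_ball_real[OF that, of "0 :: real ^ 'd"]
    unfolding measure_def by (simp only:)
  have step: "emeasure (weighted_measure w) (ball (x + v) \<rho>) \<le> ennreal C * emeasure (weighted_measure w) (ball x \<rho>)"
    if \<rho>: "0 < \<rho>" "measure lebesgue (ball (0 :: real ^ 'd) \<rho>) \<le> 1" and v: "norm v \<le> \<rho>" for x v \<rho>
  proof -
    \<comment> \<open>The common ball is centred at the midpoint of the two centres. Its volume is
      the \<open>CARD('d)\<close>-th power of \<open>1 / 2\<close> times that of either ball, which
      is the origin of \<open>\<theta>\<close>.\<close>
    define B where "B = ball (x + v /\<^sub>R 2) (\<rho> / 2)"
    have "norm (v /\<^sub>R 2) \<le> \<rho> / 2"
      using v by simp
    moreover have "x + v /\<^sub>R 2 - x = v /\<^sub>R 2" "x + v - (x + v /\<^sub>R 2) = v /\<^sub>R 2"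
      by (simp_all add: vec_eq_iff)
    ultimately have "dist (x + v /\<^sub>R 2) x \<le> \<rho> / 2" "dist (x + v /\<^sub>R 2) (x + v) \<le> \<rho> / 2"
      by (metis dist_norm dist_commute)+
    then have sub: "B \<subseteq> ball x \<rho>" "B \<subseteq> ball (x + v) \<rho>"
      unfolding B_def using \<rho>(1) by (auto simp: ball_subset_ball_iff)
    have "ennreal \<theta> * emeasure lebesgue (ball (x + v) \<rho>) \<le> emeasure lebesgue B"
      using \<rho>(1) unfolding B_def
      by (subst (1 2) emeasure_ball_real) (auto simp: ennreal_mult[symmetric] \<theta>_def power_divide)
    then have "emeasure (weighted_measure w) (ball (x + v) \<rho>) \<le> ennreal C * emeasure (weighted_measure w) B"
      using \<rho> measure_ball[OF \<rho>(1), of "x + v"] sub by (intro ratio) (auto simp: B_def)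
    also have "\<dots> \<le> ennreal C * emeasure (weighted_measure w) (ball x \<rho>)"
      using sub by (intro mult_left_mono emeasure_mono) auto
    finally show ?thesis .
  qed
  have iter: "emeasure (weighted_measure w) (ball (x + real n *\<^sub>R v) \<rho>) \<le> ennreal (C ^ n) * emeasure (weighted_measure w) (ball x \<rho>)"
    if \<rho>: "0 < \<rho>" "measure lebesgue (ball (0 :: real ^ 'd) \<rho>) \<le> 1" and v: "norm v \<le> \<rho>" for x v \<rho> n
  proof (induction n)
    case (Suc n)
    have "emeasure (weighted_measure w) (ball (x + real (Suc n) *\<^sub>R v) \<rho>)
        \<le> ennreal C * emeasure (weighted_measure w) (ball (x + real n *\<^sub>R v) \<rho>)"
      using step[OF \<rho> v, of "x + real n *\<^sub>R v"] by (simp add: algebra_simps)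
    also have "\<dots> \<le> ennreal C * (ennreal (C ^ n) * emeasure (weighted_measure w) (ball x \<rho>))"
      by (intro mult_left_mono Suc) auto
    finally show ?case
      using C by (simp add: mult.assoc ennreal_mult)
  qed simp
  show thesis
  proof (rule that[OF C])
    fix x y :: "real ^ 'd" and \<rho> :: real and n :: nat
    assume \<rho>: "0 < \<rho>" "measure lebesgue (ball (0 :: real ^ 'd) \<rho>) \<le> 1" and xy: "norm (y - x) \<le> real n * \<rho>"
    \<comment> \<open>For \<open>n = 0\<close> the quotient is \<open>0\<close> by convention, and
      the hypothesis says \<open>y = x\<close>.\<close>
    have "norm ((y - x) /\<^sub>R real n) \<le> \<rho>"
      using xy \<rho> unfolding norm_scaleR by (cases "n = 0") (auto simp: field_simps)
    from iter[OF \<rho> this, of x n]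
    show "emeasure (weighted_measure w) (ball y \<rho>) \<le> ennreal (C ^ n) * emeasure (weighted_measure w) (ball x \<rho>)"
      using xy by (cases "n = 0") auto
  qed
qed

text \<open>The condition covers only balls of volume at most one, while a ball around a cube of
  side one is larger. So the cube is covered by a fixed number of small balls. One of them meets
  \<open>E\<close> in a fixed proportion, hence its weight is bounded by that of \<open>E\<close>,
  and chains carry the bound to the others. Scaling one finite net of the unit cube makes all
  constants independent of \<open>j\<close> and \<open>k\<close>.\<close>

lemma muckenhoupt_dyadic_half:
  fixes w :: "real ^ 'd \<Rightarrow> real"
  assumes w: "w \<in> muckenhoupt_loc_infinity"
  obtains K where "0 < K"
    and "\<And>j k E. E \<in> sets lebesgue \<Longrightarrow> E \<subseteq> dyadic_cube j k \<Longrightarrow>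
      emeasure lebesgue (dyadic_cube j k) \<le> 2 * emeasure lebesgue E \<Longrightarrow>
      emeasure (weighted_measure w) (dyadic_cube j k) \<le> ennreal K * emeasure (weighted_measure w) E"
proof -
  define V where "V = measure lebesgue (ball (0 :: real ^ 'd) 1)"
  \<comment> \<open>This radius is at most 1 and satisfies \<open>\<rho> * V \<le> 1\<close>. After
    scaling, each ball therefore has at most the volume of its cube, and hence volume at most
    one.\<close>
  define \<rho> where "\<rho> = 1 / (1 + V)"
  have V: "0 < V" using measure_unit_ball_pos by (simp add: V_def)
  have \<rho>: "0 < \<rho>" "\<rho> \<le> 1" "\<rho> * V \<le> 1" using V by (auto simp: \<rho>_def field_simps)
  have ball_eq: "emeasure lebesgue (ball x (\<rho> / 2 ^ j)) = ennreal ((1 / 2 ^ j) ^ CARD('d) * (\<rho> ^ CARD('d) * V))"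
    for x :: "real ^ 'd" and j
    using \<rho> by (subst emeasure_ball_real) (auto simp: V_def power_divide)
  have "\<rho> ^ CARD('d) * V \<le> \<rho> ^ 1 * V"
    using \<rho> V by (intro mult_right_mono power_decreasing) (auto simp: Suc_leI)
  then have \<rho>V: "\<rho> ^ CARD('d) * V \<le> 1" using \<rho> by simp
  have ball_le: "emeasure lebesgue (ball x (\<rho> / 2 ^ j)) \<le> ennreal ((1 / 2 ^ j) ^ CARD('d))" for x :: "real ^ 'd" and j
    unfolding ball_eq by (intro ennreal_leI mult_left_le \<rho>V) auto
  have small: "measure lebesgue (ball x (\<rho> / 2 ^ j)) \<le> 1" for x :: "real ^ 'd" and j
  proof -
    have "emeasure lebesgue (ball x (\<rho> / 2 ^ j)) \<le> ennreal 1"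
      using ball_le by (rule order_trans) (auto intro!: ennreal_leI power_le_one)
    then show ?thesis
      by (simp add: measure_def enn2real_leI)
  qed
  obtain Y where Y: "finite Y" "Y \<subseteq> cbox (0 :: real ^ 'd) 1" "cbox 0 1 \<subseteq> (\<Union>y\<in>Y. ball y \<rho>)"
    using seq_compact_imp_totally_bounded[of "cbox (0 :: real ^ 'd) 1"] \<rho>(1)
    by (metis compact_cbox compact_eq_seq_compact_metric)
  have "(0 :: real ^ 'd) \<in> cbox 0 1"
    by (simp add: mem_box_cart)
  then have "Y \<noteq> {}" using Y(3) by auto
  then have cardY: "0 < card Y" using Y(1) by (simp add: card_gt_0_iff)
  obtain D where D: "\<And>y. y \<in> Y \<Longrightarrow> norm y \<le> D"
    using bounded_cbox[of "0 :: real ^ 'd" 1] Y(2) by (auto simp: bounded_iff)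
  \<comment> \<open>Two points of the net are at distance at most \<open>2 * D\<close>, so
    \<open>n\<close> steps of length \<open>\<rho>\<close> connect them. Scaling by
    \<open>2 ^ j\<close> does not change the number of steps.\<close>
  obtain n :: nat where n: "2 * D / \<rho> \<le> real n"
    using real_arch_simple by blast
  \<comment> \<open>The factor 2 reflects that \<open>E\<close> fills only half of the cube;
    \<open>card Y\<close> is lost in choosing the ball that meets \<open>E\<close> most.\<close>
  define \<theta> :: real where "\<theta> = 1 / (2 * card Y)"
  have \<theta>: "0 < \<theta>" using cardY by (simp add: \<theta>_def)
  obtain C where C: "1 \<le> C" and ratio: "\<And>c \<rho> E. 0 < \<rho> \<Longrightarrow> measure lebesgue (ball c \<rho>) \<le> 1 \<Longrightarrow> E \<in> sets lebesgue \<Longrightarrow> E \<subseteq> ball c \<rho> \<Longrightarrow>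
      ennreal \<theta> * emeasure lebesgue (ball c \<rho>) \<le> emeasure lebesgue E \<Longrightarrow>
      emeasure (weighted_measure w) (ball c \<rho>) \<le> ennreal C * emeasure (weighted_measure w) E"
    using muckenhoupt_subset_ratio[OF w \<theta>] by blast
  obtain C' where C': "1 \<le> C'" and chain: "\<And>x y \<rho> n. 0 < \<rho> \<Longrightarrow> measure lebesgue (ball (0 :: real ^ 'd) \<rho>) \<le> 1 \<Longrightarrow> norm (y - x) \<le> real n * \<rho> \<Longrightarrow>
      emeasure (weighted_measure w) (ball y \<rho>) \<le> ennreal (C' ^ n) * emeasure (weighted_measure w) (ball x \<rho>)"
    using muckenhoupt_ball_chain[OF w] by blast
  show thesis
  proof (rule that[of "card Y * (C' ^ n * C)"])
    show "0 < card Y * (C' ^ n * C)" using cardY C C' by auto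
  next
    fix j and k :: "int ^ 'd" and E
    assume E [measurable]: "E \<in> sets lebesgue" and EQ: "E \<subseteq> dyadic_cube j k"
      and half: "emeasure lebesgue (dyadic_cube j k) \<le> 2 * emeasure lebesgue E"
    define B where "B y = ball ((1 / 2 ^ j) *\<^sub>R ((\<chi> l. real_of_int (k $ l)) + y)) (\<rho> / 2 ^ j)" for y :: "real ^ 'd"
    have cover: "dyadic_cube j k \<subseteq> (\<Union>y\<in>Y. B y)"
    proof
      fix x assume x: "x \<in> dyadic_cube j k"
      define z where "z = 2 ^ j *\<^sub>R x - (\<chi> l. real_of_int (k $ l))"
      have "z \<in> cbox 0 1"
        using x by (auto simp: z_def mem_box_cart dyadic_cube_def field_simps less_imp_le)
      then obtain y where y: "y \<in> Y" "dist y z < \<rho>"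
        using Y(3) by auto
      have "(1 / 2 ^ j) *\<^sub>R ((\<chi> l. real_of_int (k $ l)) + y) - x = (1 / 2 ^ j) *\<^sub>R (y - z)"
        by (simp add: z_def algebra_simps)
      then have "dist ((1 / 2 ^ j) *\<^sub>R ((\<chi> l. real_of_int (k $ l)) + y)) x < \<rho> / 2 ^ j"
        using y(2) by (simp add: dist_norm divide_strict_right_mono)
      with y(1) show "x \<in> (\<Union>y\<in>Y. B y)" by (auto simp: B_def)
    qed
    have [measurable]: "B y \<in> sets lebesgue" for y by (simp add: B_def)
    define q where "q = (1 / 2 ^ j :: real) ^ CARD('d)"
    have "\<exists>y\<in>Y. ennreal (\<theta> * q) \<le> emeasure lebesgue (E \<inter> B y)"
    proof -
      define m where "m = Max ((\<lambda>y. emeasure lebesgue (E \<inter> B y)) ` Y)"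
      have "m \<in> (\<lambda>y. emeasure lebesgue (E \<inter> B y)) ` Y"
        unfolding m_def using Y(1) \<open>Y \<noteq> {}\<close> by (intro Max_in) auto
      then obtain y where y: "y \<in> Y" "m = emeasure lebesgue (E \<inter> B y)"
        by blast
      have "emeasure lebesgue E \<le> emeasure lebesgue (\<Union>y\<in>Y. E \<inter> B y)"
        using Y(1) cover EQ by (intro emeasure_mono sets.finite_UN) auto
      also have "\<dots> \<le> (\<Sum>y\<in>Y. emeasure lebesgue (E \<inter> B y))"
        using Y(1) by (intro emeasure_subadditive_finite) auto
      also have "\<dots> \<le> of_nat (card Y) * m"
        unfolding m_def using Y(1) by (intro sum_bounded_above Max_ge) auto
      finally have "ennreal q \<le> 2 * (of_nat (card Y) * m)"
        using half unfolding emeasure_dyadic_cube q_def by (metis mult_left_mono order_trans zero_le)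
      then have "ennreal \<theta> * ennreal q \<le> ennreal \<theta> * (2 * (of_nat (card Y) * m))"
        by (rule mult_left_mono) simp
      also have "\<dots> = ennreal (\<theta> * (2 * card Y)) * m"
        using \<theta> by (simp add: ennreal_mult ennreal_of_nat_eq_real_of_nat mult.assoc)
      also have "\<theta> * (2 * card Y) = 1"
        using cardY by (simp add: \<theta>_def)
      finally show ?thesis
        using y \<theta> by (auto simp: ennreal_mult q_def)
    qed
    then obtain y where y: "y \<in> Y" and ylarge: "ennreal (\<theta> * q) \<le> emeasure lebesgue (E \<inter> B y)" by blast
    have "ennreal \<theta> * emeasure lebesgue (B y) \<le> ennreal \<theta> * ennreal q"
      unfolding B_def q_def by (intro mult_left_mono ball_le) auto
    with ylarge have "ennreal \<theta> * emeasure lebesgue (B y) \<le> emeasure lebesgue (E \<inter> B y)"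
      using \<theta> by (simp add: ennreal_mult q_def)
    then have "emeasure (weighted_measure w) (B y) \<le> ennreal C * emeasure (weighted_measure w) (E \<inter> B y)"
      using \<rho>(1) small unfolding B_def by (intro ratio) auto
    also have "\<dots> \<le> ennreal C * emeasure (weighted_measure w) E"
      by (intro mult_left_mono emeasure_mono) auto
    finally have By: "emeasure (weighted_measure w) (B y) \<le> ennreal C * emeasure (weighted_measure w) E" .
    have By': "emeasure (weighted_measure w) (B y') \<le> ennreal (C' ^ n * C) * emeasure (weighted_measure w) E" if "y' \<in> Y" for y'
    proof -
      have "norm (y' - y) \<le> 2 * D"
        using D[OF that] D[OF y] norm_triangle_ineq4[of y' y] by linarith
      also have "\<dots> \<le> real n * \<rho>"
        using n \<rho>(1) by (simp add: field_simps)
      finally have "norm (y' - y) / 2 ^ j \<le> real n * \<rho> / 2 ^ j"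
        by (rule divide_right_mono) simp
      moreover have "(1 / 2 ^ j) *\<^sub>R ((\<chi> l. real_of_int (k $ l)) + y') - (1 / 2 ^ j) *\<^sub>R ((\<chi> l. real_of_int (k $ l)) + y)
          = (1 / 2 ^ j) *\<^sub>R (y' - y)"
        by (simp add: algebra_simps)
      ultimately have "emeasure (weighted_measure w) (B y') \<le> ennreal (C' ^ n) * emeasure (weighted_measure w) (B y)"
        using \<rho>(1) small unfolding B_def by (intro chain) auto
      also have "\<dots> \<le> ennreal (C' ^ n) * (ennreal C * emeasure (weighted_measure w) E)"
        by (intro mult_left_mono By) auto
      finally show ?thesis
        using C C' by (simp add: ennreal_mult mult.assoc)
    qed
    have "emeasure (weighted_measure w) (dyadic_cube j k) \<le> emeasure (weighted_measure w) (\<Union>y\<in>Y. B y)"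
      using cover Y(1) by (intro emeasure_mono sets.finite_UN) auto
    also have "\<dots> \<le> (\<Sum>y\<in>Y. emeasure (weighted_measure w) (B y))"
      using Y(1) by (intro emeasure_subadditive_finite) auto
    also have "\<dots> \<le> (\<Sum>y\<in>Y. ennreal (C' ^ n * C) * emeasure (weighted_measure w) E)"
      by (intro sum_mono By')
    also have "\<dots> = ennreal (card Y * (C' ^ n * C)) * emeasure (weighted_measure w) E"
      using C C' by (simp add: ennreal_of_nat_eq_real_of_nat ennreal_mult mult.assoc)
    finally show "emeasure (weighted_measure w) (dyadic_cube j k)
        \<le> ennreal (card Y * (C' ^ n * C)) * emeasure (weighted_measure w) E" .
  qed
qed

section \<open>Medians of measurable functions\<close>

lemma ennreal_half_of_sum:
  assumes "ennreal a = x + y" "0 \<le> a" "x < ennreal (a / 2)"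
  shows "ennreal (a / 2) \<le> y"
proof -
  have "x + y < top" by (simp flip: assms(1))
  then obtain u v where "x = ennreal u" "y = ennreal v" "0 \<le> u" "0 \<le> v"
    by (metis ennreal_cases ennreal_add_eq_top less_irrefl)
  with assms show ?thesis
    by (simp add: ennreal_plus[symmetric] ennreal_less_iff ennreal_leI del: ennreal_plus)
qed

text \<open>Both inequalities are nonstrict because \<open>h\<close> may equal \<open>m\<close> on a
  large set, which then has to be counted on either side. The median is the last level whose
  superlevel set still carries half of the mass.\<close>

lemma median_exists:
  fixes h :: "'a \<Rightarrow> real"
  assumes [measurable]: "h \<in> borel_measurable M" "A \<in> sets M" and fin: "emeasure M A < top"
  obtains m where "emeasure M A \<le> 2 * emeasure M {x \<in> A. m \<le> h x}"
    and "emeasure M A \<le> 2 * emeasure M {x \<in> A. h x \<le> m}"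
proof -
  obtain a where a: "0 \<le> a" "emeasure M A = ennreal a"
    using fin by (rule less_top_ennreal)
  have sub: "A \<subseteq> space M" by (rule sets.sets_into_space) simp
  have meas [measurable]: "{x \<in> A. P x} \<in> sets M" if "Measurable.pred M P" for P
  proof -
    have "{x \<in> A. P x} = A \<inter> {x \<in> space M. P x}" using sub by auto
    with that show ?thesis by simp
  qed
  have INF: "(INF n. emeasure M (X n)) = emeasure M (\<Inter>n. X n)"
    if "decseq X" "\<And>n. X n \<in> sets M" "\<And>n. X n \<subseteq> A" for X :: "nat \<Rightarrow> 'a set"
  proof (rule INF_emeasure_decseq)
    fix n
    have "emeasure M (X n) \<le> emeasure M A"
      using that(3) by (rule emeasure_mono) simp
    with fin show "emeasure M (X n) \<noteq> \<infinity>" by (auto simp: top_unique)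
  qed (use that in auto)
  have split: "ennreal a = emeasure M {x \<in> A. t \<le> h x} + emeasure M {x \<in> A. h x < t}" for t
    unfolding a(2)[symmetric] by (subst plus_emeasure) (auto intro!: arg_cong[where f = "emeasure M"])
  show thesis
  proof (cases "a = 0")
    case True
    with a show thesis by (intro that[of 0]) auto
  next
    case False
    with a have pos: "0 < a" by simp
    \<comment> \<open>\<open>T\<close> is nonempty and bounded above because both tails of
      \<open>h\<close> shrink to the empty set inside \<open>A\<close>, whose measure is
      finite.\<close>
    define T where "T = {t. ennreal (a / 2) \<le> emeasure M {x \<in> A. t \<le> h x}}"
    have "(INF n. emeasure M {x \<in> A. h x < - real n}) = emeasure M (\<Inter>n. {x \<in> A. h x < - real n})"
      by (rule INF) (auto simp: decseq_def)
    also have "(\<Inter>n. {x \<in> A. h x < - real n}) = {}"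
    proof -
      have "\<exists>n. \<not> h x < - real n" for x
        using real_arch_simple[of "- h x"] by (auto simp: minus_le_iff not_less)
      then show ?thesis by blast
    qed
    finally have "(INF n. emeasure M {x \<in> A. h x < - real n}) < ennreal (a / 2)"
      using pos by simp
    then obtain n where "emeasure M {x \<in> A. h x < - real n} < ennreal (a / 2)"
      by (auto simp: INF_less_iff)
    then have "- real n \<in> T"
      unfolding T_def 
      using ennreal_half_of_sum[OF trans[OF split add.commute] a(1), of "- real n"] by simp
    then have "T \<noteq> {}" by auto
    have "(INF n. emeasure M {x \<in> A. real n \<le> h x}) = emeasure M (\<Inter>n. {x \<in> A. real n \<le> h x})"
      by (rule INF) (auto simp: decseq_def)
    also have "(\<Inter>n. {x \<in> A. real n \<le> h x}) = {}"
    proof -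
      have "\<exists>n. \<not> real n \<le> h x" for x
        using reals_Archimedean2[of "h x"] by (auto simp: not_le)
      then show ?thesis by blast
    qed
    finally have "(INF n. emeasure M {x \<in> A. real n \<le> h x}) < ennreal (a / 2)"
      using pos by simp
    then obtain n' where n': "emeasure M {x \<in> A. real n' \<le> h x} < ennreal (a / 2)"
      by (auto simp: INF_less_iff)
    have "t \<le> real n'" if "t \<in> T" for t
    proof (rule ccontr)
      assume "\<not> t \<le> real n'"
      then have "emeasure M {x \<in> A. t \<le> h x} \<le> emeasure M {x \<in> A. real n' \<le> h x}"
        by (intro emeasure_mono) auto
      with n' that show False by (simp add: T_def)
    qed
    then have bdd: "bdd_above T" by (rule bdd_aboveI)
    define m where "m = Sup T"
    \<comment> \<open>Levels in \<open>T\<close> come arbitrarily close to \<open>m\<close> from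
      below, and continuity of the measure from above carries the bound to \<open>m\<close>
      itself.\<close>
    have "ennreal (a / 2) \<le> (INF n. emeasure M {x \<in> A. m - 1 / real (Suc n) \<le> h x})"
    proof (rule INF_greatest)
      fix n
      obtain t where t: "t \<in> T" "m - 1 / real (Suc n) < t"
        using less_cSup_iff[OF \<open>T \<noteq> {}\<close> bdd, of "m - 1 / real (Suc n)"] by (auto simp: m_def)
      then have "ennreal (a / 2) \<le> emeasure M {x \<in> A. t \<le> h x}" by (simp add: T_def)
      also have "\<dots> \<le> emeasure M {x \<in> A. m - 1 / real (Suc n) \<le> h x}"
        using t by (intro emeasure_mono) auto
      finally show "ennreal (a / 2) \<le> emeasure M {x \<in> A. m - 1 / real (Suc n) \<le> h x}" .
    qed
    also have "\<dots> = emeasure M (\<Inter>n. {x \<in> A. m - 1 / real (Suc n) \<le> h x})"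
    proof (rule INF)
      show "decseq (\<lambda>n. {x \<in> A. m - 1 / real (Suc n) \<le> h x})"
        unfolding decseq_def
      proof (intro allI impI subsetI)
        fix i j :: nat and x
        assume "i \<le> j" and x: "x \<in> {x \<in> A. m - 1 / real (Suc j) \<le> h x}"
        then have "1 / real (Suc j) \<le> 1 / real (Suc i)"
          by (intro frac_le) auto
        with x show "x \<in> {x \<in> A. m - 1 / real (Suc i) \<le> h x}"
          by (simp del: of_nat_Suc)
      qed
    qed auto
    also have "(\<Inter>n. {x \<in> A. m - 1 / real (Suc n) \<le> h x}) = {x \<in> A. m \<le> h x}"
    proof -
      have "m \<le> h x" if "\<And>n. m - 1 / real (Suc n) \<le> h x" for x
      proof (rule ccontr)
        assume "\<not> m \<le> h x"
        then obtain n where "1 / real (Suc n) < m - h x"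
          using nat_approx_posE[of "m - h x"] by auto
        with that[of n] show False by linarith
      qed
      moreover have "m - 1 / real (Suc n) \<le> h x" if "m \<le> h x" for x n
        using that by (smt (verit) divide_nonneg_nonneg of_nat_0_le_iff)
      ultimately show ?thesis by blast
    qed
    finally have 1: "ennreal (a / 2) \<le> emeasure M {x \<in> A. m \<le> h x}" .
    \<comment> \<open>No level above \<open>m\<close> lies in \<open>T\<close>, so the complementary
      sublevel sets carry at least half; again the limit is taken by continuity from above.\<close>
    have "ennreal (a / 2) \<le> (INF n. emeasure M {x \<in> A. h x < m + 1 / real (Suc n)})"
    proof (rule INF_greatest)
      fix n
      have "m + 1 / real (Suc n) \<notin> T"
        using cSup_upper[OF _ bdd, of "m + 1 / real (Suc n)"] by (auto simp: m_def)
      then show "ennreal (a / 2) \<le> emeasure M {x \<in> A. h x < m + 1 / real (Suc n)}"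
        using ennreal_half_of_sum[OF split a(1), of "m + 1 / real (Suc n)"] by (auto simp: T_def not_le)
    qed
    also have "\<dots> = emeasure M (\<Inter>n. {x \<in> A. h x < m + 1 / real (Suc n)})"
    proof (rule INF)
      show "decseq (\<lambda>n. {x \<in> A. h x < m + 1 / real (Suc n)})"
        unfolding decseq_def
      proof (intro allI impI subsetI)
        fix i j :: nat and x
        assume "i \<le> j" and x: "x \<in> {x \<in> A. h x < m + 1 / real (Suc j)}"
        then have "1 / real (Suc j) \<le> 1 / real (Suc i)"
          by (intro frac_le) auto
        with x show "x \<in> {x \<in> A. h x < m + 1 / real (Suc i)}"
          by (simp del: of_nat_Suc)
      qed
    qed auto
    also have "(\<Inter>n. {x \<in> A. h x < m + 1 / real (Suc n)}) = {x \<in> A. h x \<le> m}"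
    proof -
      have "h x \<le> m" if "\<And>n. h x < m + 1 / real (Suc n)" for x
      proof (rule ccontr)
        assume "\<not> h x \<le> m"
        then obtain n where "1 / real (Suc n) < h x - m"
          using nat_approx_posE[of "h x - m"] by auto
        with that[of n] show False by linarith
      qed
      moreover have "h x < m + 1 / real (Suc n)" if "h x \<le> m" for x n
        using that by (smt (verit) divide_pos_pos of_nat_0_less_iff zero_less_Suc)
      ultimately show ?thesis by blast
    qed
    finally have 2: "ennreal (a / 2) \<le> emeasure M {x \<in> A. h x \<le> m}" .
    have "2 * ennreal (a / 2) = emeasure M A"
    proof -
      have "2 * ennreal (a / 2) = ennreal (2 * (a / 2))"
        using a(1) by (subst ennreal_mult) auto
      with a show ?thesis by simp
    qed
    with 1 2 show thesis
      by (intro that[of m]) (metis mult_left_mono zero_le)+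
  qed
qed

section \<open>Restricting the sequence norm to large subsets of the cubes\<close>

lemma le_lq_norm:
  assumes "\<And>j. 0 \<le> X j" "0 < q"
  shows "ennreal (X j) \<le> lq_norm q X"
proof (cases "q = \<infinity>")
  case True
  then show ?thesis by (auto simp: lq_norm_def intro: SUP_upper)
next
  case False
  define Q where "Q = enn2real q"
  have Q: "0 < Q"
    using assms(2) False unfolding Q_def by (auto simp: enn2real_positive_iff less_top)
  have "ennreal (X j powr Q) \<le> (\<Sum>j. ennreal (X j powr Q))"
  proof -
    have "(\<Sum>i\<in>{j}. ennreal (X i powr Q)) \<le> (\<Sum>i. ennreal (X i powr Q))"
      by (intro sum_le_suminf summableI) simp_all
    moreover have "(\<Sum>i\<in>{j}. ennreal (X i powr Q)) = ennreal (X j powr Q)"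
      by simp
    ultimately show ?thesis by (simp only:)
  qed
  then have "enn_powr (ennreal (X j powr Q)) (1 / Q) \<le> enn_powr (\<Sum>j. ennreal (X j powr Q)) (1 / Q)"
    using Q by (intro enn_powr_mono) auto
  moreover have "enn_powr (ennreal (X j powr Q)) (1 / Q) = ennreal (X j)"
    using Q assms(1) by (simp add: enn_powr_ennreal powr_powr)
  moreover have "lq_norm q X = enn_powr (\<Sum>j. ennreal (X j powr Q)) (1 / Q)"
    using False by (simp add: lq_norm_def Q_def)
  ultimately show ?thesis by simp
qed

lemma lq_norm_zero: "0 < q \<Longrightarrow> lq_norm q (\<lambda>j. 0) = 0"
  by (auto simp: lq_norm_def enn2real_positive_iff less_top)

lemma Lp_weighted_norm_eq:
  assumes "weight w" "F \<in> borel_measurable lebesgue"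
  shows "Lp_weighted_norm p w F = enn_powr (\<integral>\<^sup>+x. enn_powr (F x) p \<partial>weighted_measure w) (1 / p)"
proof -
  have [measurable]: "w \<in> borel_measurable lebesgue" "F \<in> borel_measurable lebesgue"
    using assms weight_measurable by auto
  show ?thesis
    unfolding Lp_weighted_norm_def weighted_measure_def
    by (subst nn_integral_density) (auto simp: mult.commute)
qed

lemma dyadic_filtration:
  assumes "weight w"
  shows "cell_filtration (weighted_measure w) dyadic_index"
proof
  fix j k
  have "{x \<in> space (weighted_measure w). dyadic_index j x = k} = dyadic_cube j k"
    by (auto simp: dyadic_cube_iff)
  then show "emeasure (weighted_measure w) {x \<in> space (weighted_measure w). dyadic_index j x = k} < top"
    using weight_locally_finite[OF assms bounded_dyadic_cube, of j k]
    by (simp add: emeasure_weighted_measure assms)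
next
  show "dyadic_index j \<in> measurable (weighted_measure w) (count_space UNIV)" for j
    using dyadic_index_measurable measurable_cong_sets sets_weighted_measure by blast
qed (rule dyadic_index_refine)

lemma muckenhoupt_loc_infinityD:
  assumes "w \<in> muckenhoupt_loc_infinity"
  shows "weight w" "AE x in lebesgue. 0 < w x"
  using assms by (auto simp: muckenhoupt_loc_infinity_def muckenhoupt_loc_def)

text \<open>Transfers the estimates for cell filtrations to the measure with density
  \<open>w\<close>, on which the Muckenhoupt condition turns Lebesgue halves into ample subsets. The
  constant is fixed before \<open>s\<close>, \<open>lam\<close> and \<open>E\<close>, since the sets
  will depend on the sequence.\<close>

lemma f_norm_le_restricted:
  fixes w :: "real ^ 'd \<Rightarrow> real"
  assumes w: "w \<in> muckenhoupt_loc_infinity" and p: "0 < p" and q: "0 < q"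
  obtains C where "0 < C"
    and "\<And>s lam E. (\<And>j. E j \<in> sets lebesgue) \<Longrightarrow>
      (\<And>j k. lam (j, k) \<noteq> 0 \<Longrightarrow> emeasure lebesgue (dyadic_cube j k) \<le> 2 * emeasure lebesgue (dyadic_cube j k \<inter> E j)) \<Longrightarrow>
      f_norm s p q w lam \<le> ennreal C * Lp_weighted_norm p w (\<lambda>x. lq_norm q (\<lambda>j. scaled_value s lam x j * indicator (E j) x))"
proof -
  note weight = muckenhoupt_loc_infinityD(1)[OF w]
  obtain K where K: "0 < K" and half: "\<And>j k E. E \<in> sets lebesgue \<Longrightarrow> E \<subseteq> dyadic_cube j k \<Longrightarrow>
      emeasure lebesgue (dyadic_cube j k) \<le> 2 * emeasure lebesgue E \<Longrightarrow>
      emeasure (weighted_measure w) (dyadic_cube j k) \<le> ennreal K * emeasure (weighted_measure w) E"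
    using muckenhoupt_dyadic_half[OF w] by blast
  interpret cell_filtration "weighted_measure w" dyadic_index
    by (rule dyadic_filtration[OF weight])
  define Q where "Q = enn2real q"
  have Q: "0 < Q" if "q \<noteq> \<infinity>"
    using q that unfolding Q_def by (auto simp: enn2real_positive_iff less_top)
  \<comment> \<open>For finite \<open>q\<close> the coefficients are the \<open>Q\<close>-th powers,
    which leaves the outer exponent \<open>p / Q\<close>; it may lie on either side of 1. For
    infinite \<open>q\<close> they are the \<open>p\<close>-th powers, and the supremum estimate
    costs only \<open>K\<close>.\<close>
  define D where "D = (if q = \<infinity> then K else ample_subsets.sum_const K (p / Q))"
  have subsets: "ample_subsets (weighted_measure w) dyadic_index K E
      (\<lambda>j k. (2 powr (s * real j) * cmod (lam (j, k))) powr e)"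
    if E: "\<And>j. E j \<in> sets lebesgue" and
      large: "\<And>j k. lam (j, k) \<noteq> 0 \<Longrightarrow> emeasure lebesgue (dyadic_cube j k) \<le> 2 * emeasure lebesgue (dyadic_cube j k \<inter> E j)"
    for E s lam e
  proof
    fix j k assume "(2 powr (s * real j) * cmod (lam (j, k))) powr e \<noteq> 0"
    then have "lam (j, k) \<noteq> 0" by auto
    then have "emeasure (weighted_measure w) (dyadic_cube j k) \<le> ennreal K * emeasure (weighted_measure w) (dyadic_cube j k \<inter> E j)"
      using E by (intro half large) auto
    moreover have "{x \<in> space (weighted_measure w). dyadic_index j x = k} = dyadic_cube j k"
      "{x \<in> space (weighted_measure w). dyadic_index j x = k \<and> x \<in> E j} = dyadic_cube j k \<inter> E j"
      by (auto simp: dyadic_cube_iff)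
    ultimately show "emeasure (weighted_measure w) {x \<in> space (weighted_measure w). dyadic_index j x = k}
      \<le> ennreal K * emeasure (weighted_measure w) {x \<in> space (weighted_measure w). dyadic_index j x = k \<and> x \<in> E j}"
      by simp
  qed (use K E in auto)
  have D: "0 < D"
  proof (cases "q = \<infinity>")
    case False
    \<comment> \<open>A trivial instance with zero coefficients and full sets, opened only to unfold
      the constant.\<close>
    interpret A: ample_subsets "weighted_measure w" dyadic_index K "\<lambda>_. UNIV"
        "\<lambda>j k. (2 powr (0 * real j) * cmod (0 :: complex)) powr 1"
      using subsets[of "\<lambda>_. UNIV" "\<lambda>_. 0" 0 1] by simp
    show ?thesis
      using False K Q p by (auto simp: D_def A.sum_const_def)
  qed (use K in \<open>simp add: D_def\<close>)
  show thesis
  proof (rule that[of "D powr (1 / p)"])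
    fix s and lam :: "nat \<times> (int ^ 'd) \<Rightarrow> complex" and E :: "nat \<Rightarrow> (real ^ 'd) set"
    assume E: "\<And>j. E j \<in> sets lebesgue" and
      large: "\<And>j k. lam (j, k) \<noteq> 0 \<Longrightarrow> emeasure lebesgue (dyadic_cube j k) \<le> 2 * emeasure lebesgue (dyadic_cube j k \<inter> E j)"
    note [measurable] = E
    define F where "F x = lq_norm q (scaled_value s lam x)" for x
    define G where "G x = lq_norm q (\<lambda>j. scaled_value s lam x j * indicator (E j) x)" for x
    have [measurable]: "F \<in> borel_measurable lebesgue" "G \<in> borel_measurable lebesgue"
      unfolding F_def G_def by measurable
    have "(\<integral>\<^sup>+x. enn_powr (F x) p \<partial>weighted_measure w) \<le> ennreal D * (\<integral>\<^sup>+x. enn_powr (G x) p \<partial>weighted_measure w)"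
    proof (cases "q = \<infinity>")
      case True
      interpret A: ample_subsets "weighted_measure w" dyadic_index K E
          "\<lambda>j k. (2 powr (s * real j) * cmod (lam (j, k))) powr p"
        by (rule subsets[OF E large])
      have F: "enn_powr (F x) p = (SUP j. ennreal ((2 powr (s * real j) * cmod (lam (j, dyadic_index j x))) powr p))" for x
        using True p by (simp add: F_def lq_norm_def enn_powr_SUP enn_powr_ennreal scaled_value_def)
      have G: "enn_powr (G x) p = (SUP j. ennreal ((2 powr (s * real j) * cmod (lam (j, dyadic_index j x))) powr p * indicator (E j) x))" for x
        using True p by (auto simp: G_def lq_norm_def enn_powr_SUP enn_powr_ennreal scaled_value_def
            intro!: SUP_cong split: split_indicator)
      show ?thesis
        unfolding F G D_def if_P[OF True] by (rule A.nn_integral_SUP_le)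
    next
      case False
      interpret A: ample_subsets "weighted_measure w" dyadic_index K E
          "\<lambda>j k. (2 powr (s * real j) * cmod (lam (j, k))) powr Q"
        by (rule subsets[OF E large])
      have F: "enn_powr (F x) p = enn_powr (\<Sum>j. ennreal ((2 powr (s * real j) * cmod (lam (j, dyadic_index j x))) powr Q)) (p / Q)" for x
        using False p Q by (simp add: F_def lq_norm_def enn_powr_powr scaled_value_def Q_def)
      have "((2 powr (s * real j) * cmod (lam (j, dyadic_index j x))) * indicator (E j) x) powr Q
          = (2 powr (s * real j) * cmod (lam (j, dyadic_index j x))) powr Q * indicator (E j) x" for x j
        by (auto split: split_indicator)
      then have G: "enn_powr (G x) p = enn_powr (\<Sum>j. ennreal ((2 powr (s * real j) * cmod (lam (j, dyadic_index j x))) powr Q * indicator (E j) x)) (p / Q)" for x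
        using False p Q by (simp add: G_def lq_norm_def enn_powr_powr scaled_value_def Q_def)
      show ?thesis
        unfolding F G D_def if_not_P[OF False] using False p Q by (intro A.nn_integral_sum_le) simp
    qed
    then have "enn_powr (\<integral>\<^sup>+x. enn_powr (F x) p \<partial>weighted_measure w) (1 / p)
        \<le> enn_powr (ennreal D * (\<integral>\<^sup>+x. enn_powr (G x) p \<partial>weighted_measure w)) (1 / p)"
      using p by (intro enn_powr_mono) auto
    then have "Lp_weighted_norm p w F \<le> ennreal (D powr (1 / p)) * Lp_weighted_norm p w G"
      using p D by (simp add: Lp_weighted_norm_eq weight enn_powr_mult enn_powr_ennreal)
    then show "f_norm s p q w lam \<le> ennreal (D powr (1 / p)) *
        Lp_weighted_norm p w (\<lambda>x. lq_norm q (\<lambda>j. scaled_value s lam x j * indicator (E j) x))"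
      unfolding f_norm_eq F_def G_def .
  qed (use D in simp)
qed

section \<open>Factorization of sequences\<close>

lemma exponent_ratio_nonneg: "0 \<le> exponent_ratio q r"
  by (simp add: exponent_ratio_def)

text \<open>The estimate of a single factor. Where \<open>m \<le> H\<close>, which is at least half
  of each relevant cube, the number \<open>m\<close> may be enlarged to the function
  \<open>H\<close>; the inner norm is then at most the \<open>t\<close>-th power of the norm of
  \<open>lam\<close> times \<open>H\<close>, and the last hypothesis bounds the resulting integral
  by that of \<open>lam\<close>.\<close>

lemma f_norm_powr_multiplier_le:
  fixes w\<^sub>i :: "real ^ 'd \<Rightarrow> real"
  assumes w\<^sub>i: "w\<^sub>i \<in> muckenhoupt_loc_infinity" and p\<^sub>i: "0 < p\<^sub>i" and q\<^sub>i: "0 < q\<^sub>i"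
    and q: "0 < q" "q = \<infinity> \<longrightarrow> q\<^sub>i = \<infinity>" and p: "0 < p"
  defines "t \<equiv> exponent_ratio q q\<^sub>i"
  obtains C where "0 < C"
    and "\<And>s s\<^sub>i w lam H m. H \<in> borel_measurable lebesgue \<Longrightarrow> (\<And>x. 0 \<le> H x) \<Longrightarrow> (\<And>j k. 0 \<le> m j k) \<Longrightarrow>
      (\<And>j k. lam (j, k) \<noteq> 0 \<Longrightarrow>
        emeasure lebesgue (dyadic_cube j k) \<le> 2 * emeasure lebesgue {x \<in> dyadic_cube j k. m j k \<le> H x}) \<Longrightarrow>
      (AE x in lebesgue. 0 < lq_norm q (scaled_value s lam x) \<longrightarrow>
        enn_powr (enn_powr (lq_norm q (scaled_value s lam x)) t * ennreal (H x)) p\<^sub>i * ennreal (w\<^sub>i x)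
        \<le> enn_powr (lq_norm q (scaled_value s lam x)) p * ennreal (w x)) \<Longrightarrow>
      f_norm s\<^sub>i p\<^sub>i q\<^sub>i w\<^sub>i (\<lambda>(j, k). of_real (2 powr (- s\<^sub>i * real j) * (2 powr (s * real j) * cmod (lam (j, k))) powr t * m j k))
      \<le> ennreal C * enn_powr (f_norm s p q w lam) (p / p\<^sub>i)"
proof -
  obtain C where C: "0 < C" and restricted: "\<And>s lam E. (\<And>j. E j \<in> sets lebesgue) \<Longrightarrow>
      (\<And>j k. lam (j, k) \<noteq> 0 \<Longrightarrow> emeasure lebesgue (dyadic_cube j k) \<le> 2 * emeasure lebesgue (dyadic_cube j k \<inter> E j)) \<Longrightarrow>
      f_norm s p\<^sub>i q\<^sub>i w\<^sub>i lam \<le> ennreal C * Lp_weighted_norm p\<^sub>i w\<^sub>i (\<lambda>x. lq_norm q\<^sub>i (\<lambda>j. scaled_value s lam x j * indicator (E j) x))"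
    using f_norm_le_restricted[OF w\<^sub>i p\<^sub>i q\<^sub>i] by blast
  have t: "0 \<le> t" unfolding t_def by (rule exponent_ratio_nonneg)
  show thesis
  proof (rule that[OF C])
    fix s s\<^sub>i and w :: "real ^ 'd \<Rightarrow> real" and lam :: "nat \<times> (int ^ 'd) \<Rightarrow> complex" and H m
    assume H [measurable]: "H \<in> borel_measurable lebesgue" and H_nonneg: "\<And>x. 0 \<le> H x" and m: "\<And>j k. 0 \<le> m j k"
      and half: "\<And>j k. lam (j, k) \<noteq> 0 \<Longrightarrow>
        emeasure lebesgue (dyadic_cube j k) \<le> 2 * emeasure lebesgue {x \<in> dyadic_cube j k. m j k \<le> H x}"
      and AE_le: "AE x in lebesgue. 0 < lq_norm q (scaled_value s lam x) \<longrightarrow>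
        enn_powr (enn_powr (lq_norm q (scaled_value s lam x)) t * ennreal (H x)) p\<^sub>i * ennreal (w\<^sub>i x)
        \<le> enn_powr (lq_norm q (scaled_value s lam x)) p * ennreal (w x)"
    define lam\<^sub>i :: "nat \<times> (int ^ 'd) \<Rightarrow> complex"
      where "lam\<^sub>i = (\<lambda>(j, k). of_real (2 powr (- s\<^sub>i * real j) * (2 powr (s * real j) * cmod (lam (j, k))) powr t * m j k))"
    define E where "E j = {x. m j (dyadic_index j x) \<le> H x}" for j
    have [measurable]: "(\<lambda>x. m j (dyadic_index j x)) \<in> borel_measurable lebesgue" for j
      by (rule measurable_compose[OF dyadic_index_measurable]) auto
    have E [measurable]: "E j \<in> sets lebesgue" for j
    proof -
      have "{x \<in> space lebesgue. m j (dyadic_index j x) \<le> H x} \<in> sets lebesgue"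
        by measurable
      then show ?thesis by (simp add: E_def)
    qed
    have QE: "dyadic_cube j k \<inter> E j = {x \<in> dyadic_cube j k. m j k \<le> H x}" for j k
      by (auto simp: E_def dyadic_cube_iff)
    have "emeasure lebesgue (dyadic_cube j k) \<le> 2 * emeasure lebesgue (dyadic_cube j k \<inter> E j)"
      if "lam\<^sub>i (j, k) \<noteq> 0" for j k
    proof -
      have "lam (j, k) \<noteq> 0" using that by (auto simp: lam\<^sub>i_def)
      from half[OF this] show ?thesis by (simp only: QE)
    qed
    with E have "f_norm s\<^sub>i p\<^sub>i q\<^sub>i w\<^sub>i lam\<^sub>i
        \<le> ennreal C * Lp_weighted_norm p\<^sub>i w\<^sub>i (\<lambda>x. lq_norm q\<^sub>i (\<lambda>j. scaled_value s\<^sub>i lam\<^sub>i x j * indicator (E j) x))"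
      by (rule restricted)
    also have "Lp_weighted_norm p\<^sub>i w\<^sub>i (\<lambda>x. lq_norm q\<^sub>i (\<lambda>j. scaled_value s\<^sub>i lam\<^sub>i x j * indicator (E j) x))
        \<le> enn_powr (\<integral>\<^sup>+x. enn_powr (lq_norm q (scaled_value s lam x)) p * ennreal (w x) \<partial>lebesgue) (1 / p\<^sub>i)"
      unfolding Lp_weighted_norm_def
    proof (intro enn_powr_mono nn_integral_mono_AE)
      show "AE x in lebesgue. enn_powr (lq_norm q\<^sub>i (\<lambda>j. scaled_value s\<^sub>i lam\<^sub>i x j * indicator (E j) x)) p\<^sub>i * ennreal (w\<^sub>i x)
        \<le> enn_powr (lq_norm q (scaled_value s lam x)) p * ennreal (w x)"
        using AE_le
      proof eventually_elim
        case (elim x)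
        \<comment> \<open>The power of 2 built into \<open>lam\<^sub>i\<close> cancels the scaling
          of the target space and installs that of the source.\<close>
        have val: "scaled_value s\<^sub>i lam\<^sub>i x j = scaled_value s lam x j powr t * m j (dyadic_index j x)" for j
        proof -
          have "2 powr (s\<^sub>i * real j) * 2 powr (- s\<^sub>i * real j) = 1"
            by (simp add: powr_add[symmetric])
          then show ?thesis
            using m[of j "dyadic_index j x"]
            by (simp add: scaled_value_def lam\<^sub>i_def norm_mult mult.assoc[symmetric] del: of_real_mult)
        qed
        show ?case
        proof (cases "0 < lq_norm q (scaled_value s lam x)")
          case True
          have "lq_norm q\<^sub>i (\<lambda>j. scaled_value s\<^sub>i lam\<^sub>i x j * indicator (E j) x) \<le> lq_norm q\<^sub>i (\<lambda>j. scaled_value s lam x j powr t * H x)"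
          proof (rule lq_norm_mono)
            show "scaled_value s\<^sub>i lam\<^sub>i x j * indicator (E j) x \<le> scaled_value s lam x j powr t * H x" for j
              using H_nonneg[of x] by (auto simp: val E_def intro!: mult_left_mono split: split_indicator)
          qed (auto simp: val m)
          also have "\<dots> \<le> enn_powr (lq_norm q (scaled_value s lam x)) t * ennreal (H x)"
            unfolding t_def by (rule lq_norm_powr_le) (use q q\<^sub>i H_nonneg scaled_value_nonneg in auto)
          finally have "enn_powr (lq_norm q\<^sub>i (\<lambda>j. scaled_value s\<^sub>i lam\<^sub>i x j * indicator (E j) x)) p\<^sub>i
              \<le> enn_powr (enn_powr (lq_norm q (scaled_value s lam x)) t * ennreal (H x)) p\<^sub>i"
            using p\<^sub>i by (intro enn_powr_mono) auto
          then show ?thesis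
            using elim True by (meson mult_right_mono order_trans zero_le)
        next
          case False
          then have "scaled_value s lam x j = 0" for j
            using le_lq_norm[of "scaled_value s lam x" q j] scaled_value_nonneg[of s lam x] q
            by (simp add: ennreal_eq_0_iff antisym not_less)
          then have "lq_norm q\<^sub>i (\<lambda>j. scaled_value s\<^sub>i lam\<^sub>i x j * indicator (E j) x) = 0"
            using lq_norm_zero[OF q\<^sub>i] by (simp add: val)
          then show ?thesis using p\<^sub>i by simp
        qed
      qed
    qed (use p\<^sub>i in auto)
    also have "enn_powr (\<integral>\<^sup>+x. enn_powr (lq_norm q (scaled_value s lam x)) p * ennreal (w x) \<partial>lebesgue) (1 / p\<^sub>i)
        = enn_powr (f_norm s p q w lam) (p / p\<^sub>i)"
      using p p\<^sub>i by (simp add: f_norm_eq Lp_weighted_norm_def enn_powr_powr)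
    finally show "f_norm s\<^sub>i p\<^sub>i q\<^sub>i w\<^sub>i (\<lambda>(j, k). of_real (2 powr (- s\<^sub>i * real j) * (2 powr (s * real j) * cmod (lam (j, k))) powr t * m j k))
      \<le> ennreal C * enn_powr (f_norm s p q w lam) (p / p\<^sub>i)"
      by (simp add: lam\<^sub>i_def mult_left_mono)
  qed
qed

section \<open>Relations between the exponents and Hoelder's inequality for the sequence
  norms\<close>

lemma exponent_ratio_convex:
  assumes \<Theta>: "0 < \<Theta>" "\<Theta> < 1" and q: "0 < q\<^sub>0" "0 < q\<^sub>1"
    and eq: "1 / q = ennreal (1 - \<Theta>) / q\<^sub>0 + ennreal \<Theta> / q\<^sub>1"
  shows "0 < q" "q = \<infinity> \<longrightarrow> q\<^sub>0 = \<infinity>" "q = \<infinity> \<longrightarrow> q\<^sub>1 = \<infinity>"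
    "(1 - \<Theta>) * exponent_ratio q q\<^sub>0 + \<Theta> * exponent_ratio q q\<^sub>1 = 1"
proof -
  have inv: "\<exists>b\<ge>0. ennreal a / r = ennreal (a * b) \<and> (r = \<infinity> \<longrightarrow> b = 0) \<and> (r \<noteq> \<infinity> \<longrightarrow> 0 < b \<and> b = 1 / enn2real r)"
    if "0 < r" "0 < a" for a r
  proof (cases r)
    case (real x)
    with that have "0 < x" by simp
    with real that show ?thesis
      by (intro exI[of _ "1 / x"]) (auto simp: divide_ennreal)
  qed (auto intro!: exI[of _ 0])
  obtain b\<^sub>0 where b\<^sub>0: "0 \<le> b\<^sub>0" "ennreal (1 - \<Theta>) / q\<^sub>0 = ennreal ((1 - \<Theta>) * b\<^sub>0)" "q\<^sub>0 = \<infinity> \<longrightarrow> b\<^sub>0 = 0"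
      "q\<^sub>0 \<noteq> \<infinity> \<longrightarrow> 0 < b\<^sub>0 \<and> b\<^sub>0 = 1 / enn2real q\<^sub>0"
    using inv[of q\<^sub>0 "1 - \<Theta>"] q \<Theta> by auto
  obtain b\<^sub>1 where b\<^sub>1: "0 \<le> b\<^sub>1" "ennreal \<Theta> / q\<^sub>1 = ennreal (\<Theta> * b\<^sub>1)" "q\<^sub>1 = \<infinity> \<longrightarrow> b\<^sub>1 = 0"
      "q\<^sub>1 \<noteq> \<infinity> \<longrightarrow> 0 < b\<^sub>1 \<and> b\<^sub>1 = 1 / enn2real q\<^sub>1"
    using inv[of q\<^sub>1 \<Theta>] q \<Theta> by auto
  have sum: "1 / q = ennreal ((1 - \<Theta>) * b\<^sub>0 + \<Theta> * b\<^sub>1)"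
    using eq b\<^sub>0 b\<^sub>1 \<Theta> by simp
  \<comment> \<open>The right-hand side is finite even if some \<open>q\<^sub>i\<close> is infinite,
    while \<open>1 / 0\<close> is infinite.\<close>
  show "0 < q"
  proof (rule ccontr)
    assume "\<not> 0 < q"
    with sum show False by (simp add: divide_ennreal_def)
  qed
  have q_inf: "q\<^sub>0 = \<infinity> \<and> q\<^sub>1 = \<infinity>" if "q = \<infinity>"
  proof -
    have "(1 - \<Theta>) * b\<^sub>0 + \<Theta> * b\<^sub>1 \<le> 0"
      using sum that b\<^sub>0 b\<^sub>1 \<Theta> by (simp add: ennreal_eq_0_iff)
    moreover have "0 \<le> (1 - \<Theta>) * b\<^sub>0" "0 \<le> \<Theta> * b\<^sub>1" using b\<^sub>0 b\<^sub>1 \<Theta> by auto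
    ultimately have "(1 - \<Theta>) * b\<^sub>0 = 0" "\<Theta> * b\<^sub>1 = 0" by linarith+
    with b\<^sub>0 b\<^sub>1 \<Theta> show ?thesis by auto
  qed
  then show "q = \<infinity> \<longrightarrow> q\<^sub>0 = \<infinity>" "q = \<infinity> \<longrightarrow> q\<^sub>1 = \<infinity>" by auto
  show "(1 - \<Theta>) * exponent_ratio q q\<^sub>0 + \<Theta> * exponent_ratio q q\<^sub>1 = 1"
  proof (cases q)
    case (real Q)
    with \<open>0 < q\<close> have "0 < Q" by simp
    then have "ennreal (1 / Q) = ennreal ((1 - \<Theta>) * b\<^sub>0 + \<Theta> * b\<^sub>1)"
      using sum real divide_ennreal[of 1 Q] by simp
    then have "1 / Q = (1 - \<Theta>) * b\<^sub>0 + \<Theta> * b\<^sub>1"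
      using \<open>0 < Q\<close> b\<^sub>0(1) b\<^sub>1(1) \<Theta> by (subst (asm) ennreal_inj) auto
    then have "Q * ((1 - \<Theta>) * b\<^sub>0 + \<Theta> * b\<^sub>1) = 1"
      using \<open>0 < Q\<close> by (simp add: field_simps)
    moreover have "exponent_ratio q q\<^sub>0 = Q * b\<^sub>0" "exponent_ratio q q\<^sub>1 = Q * b\<^sub>1"
      using b\<^sub>0(3,4) b\<^sub>1(3,4) real by (auto simp: exponent_ratio_def)
    ultimately show ?thesis by (simp add: algebra_simps)
  qed (use q_inf in \<open>simp add: exponent_ratio_def\<close>)
qed

text \<open>With one infinite exponent Hoelder's inequality degenerates: the supremum of
  \<open>X\<close> is taken out of the sum, and the whole exponent falls to
  \<open>Y\<close>.\<close>

lemma lq_norm_Holder_top: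
  assumes "0 < a" "0 < b" "0 < r" "r \<noteq> \<infinity>" "q \<noteq> \<infinity>" "0 < q" and r: "enn2real r = b * enn2real q"
    and nonneg: "\<And>j. 0 \<le> X j" "\<And>j. 0 \<le> Y j" "\<And>j. 0 \<le> Z j" and Z: "\<And>j. Z j \<le> X j powr a * Y j powr b"
  shows "lq_norm q Z \<le> enn_powr (lq_norm \<infinity> X) a * enn_powr (lq_norm r Y) b"
proof -
  define Q R where "Q = enn2real q" and "R = enn2real r"
  have QR: "0 < Q" "0 < R"
    using assms unfolding Q_def R_def by (auto simp: enn2real_positive_iff less_top)
  define S where "S = lq_norm \<infinity> X"
  have "(\<Sum>j. ennreal (Z j powr Q)) \<le> (\<Sum>j. enn_powr S (a * Q) * ennreal (Y j powr R))"
  proof (intro suminf_le summableI)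
    fix j
    have "Z j powr Q \<le> (X j powr a * Y j powr b) powr Q"
      using QR Z nonneg by (intro powr_mono2) auto
    also have "\<dots> = X j powr (a * Q) * Y j powr R"
      using r nonneg by (simp add: powr_mult powr_powr Q_def R_def)
    finally have "ennreal (Z j powr Q) \<le> enn_powr (ennreal (X j)) (a * Q) * ennreal (Y j powr R)"
      using nonneg assms(1) QR by (simp add: enn_powr_ennreal ennreal_mult[symmetric] ennreal_leI)
    also have "\<dots> \<le> enn_powr S (a * Q) * ennreal (Y j powr R)"
      using assms(1) QR nonneg unfolding S_def by (intro mult_right_mono enn_powr_mono le_lq_norm) auto
    finally show "ennreal (Z j powr Q) \<le> enn_powr S (a * Q) * ennreal (Y j powr R)" .
  qed
  also have "\<dots> = enn_powr S (a * Q) * (\<Sum>j. ennreal (Y j powr R))"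
    by simp
  finally have "enn_powr (\<Sum>j. ennreal (Z j powr Q)) (1 / Q) \<le> enn_powr (enn_powr S (a * Q) * (\<Sum>j. ennreal (Y j powr R))) (1 / Q)"
    using QR by (intro enn_powr_mono) auto
  also have "\<dots> = enn_powr S a * enn_powr (\<Sum>j. ennreal (Y j powr R)) (1 / Q)"
    using QR assms(1) by (simp add: enn_powr_mult enn_powr_powr)
  also have "enn_powr (\<Sum>j. ennreal (Y j powr R)) (1 / Q) = enn_powr (lq_norm r Y) b"
  proof -
    have "1 / R * b = 1 / Q"
      using QR r assms(2) by (simp add: Q_def R_def)
    then show ?thesis
      using QR assms(2,4) by (simp add: lq_norm_def R_def enn_powr_powr)
  qed
  finally show ?thesis
    using assms(5) by (simp add: lq_norm_def[of q] Q_def S_def)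
qed

lemma lq_norm_Holder:
  assumes \<Theta>: "0 < \<Theta>" "\<Theta> < 1" and q: "0 < q" "0 < q\<^sub>0" "0 < q\<^sub>1" "q = \<infinity> \<longrightarrow> q\<^sub>0 = \<infinity>" "q = \<infinity> \<longrightarrow> q\<^sub>1 = \<infinity>"
    and ratio: "(1 - \<Theta>) * exponent_ratio q q\<^sub>0 + \<Theta> * exponent_ratio q q\<^sub>1 = 1"
    and nonneg: "\<And>j. 0 \<le> X j" "\<And>j. 0 \<le> Y j" "\<And>j. 0 \<le> Z j"
    and Z: "\<And>j. Z j \<le> X j powr (1 - \<Theta>) * Y j powr \<Theta>"
  shows "lq_norm q Z \<le> enn_powr (lq_norm q\<^sub>0 X) (1 - \<Theta>) * enn_powr (lq_norm q\<^sub>1 Y) \<Theta>"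
proof (cases "q = \<infinity>")
  case True
  have "ennreal (Z j) \<le> enn_powr (lq_norm q\<^sub>0 X) (1 - \<Theta>) * enn_powr (lq_norm q\<^sub>1 Y) \<Theta>" for j
  proof -
    have "ennreal (Z j) \<le> enn_powr (ennreal (X j)) (1 - \<Theta>) * enn_powr (ennreal (Y j)) \<Theta>"
      using nonneg \<Theta> Z by (simp add: enn_powr_ennreal ennreal_mult[symmetric] ennreal_leI)
    also have "\<dots> \<le> enn_powr (lq_norm q\<^sub>0 X) (1 - \<Theta>) * enn_powr (lq_norm q\<^sub>1 Y) \<Theta>"
      using nonneg \<Theta> q by (intro mult_mono enn_powr_mono le_lq_norm) auto
    finally show ?thesis .
  qed
  then show ?thesis
    unfolding lq_norm_def[of q] if_P[OF True] by (rule SUP_least)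
next
  case False
  define Q Q\<^sub>0 Q\<^sub>1 where "Q = enn2real q" and "Q\<^sub>0 = enn2real q\<^sub>0" and "Q\<^sub>1 = enn2real q\<^sub>1"
  have Q: "0 < Q" using q False unfolding Q_def by (auto simp: enn2real_positive_iff less_top)
  have Q\<^sub>0: "0 < Q\<^sub>0" if "q\<^sub>0 \<noteq> \<infinity>" using q that unfolding Q\<^sub>0_def by (auto simp: enn2real_positive_iff less_top)
  have Q\<^sub>1: "0 < Q\<^sub>1" if "q\<^sub>1 \<noteq> \<infinity>" using q that unfolding Q\<^sub>1_def by (auto simp: enn2real_positive_iff less_top)
  \<comment> \<open>If both exponents were infinite while \<open>q\<close> is finite, both ratios
    would be zero and could not average to one.\<close>
  consider (both) "q\<^sub>0 \<noteq> \<infinity>" "q\<^sub>1 \<noteq> \<infinity>" | (top0) "q\<^sub>0 = \<infinity>" "q\<^sub>1 \<noteq> \<infinity>" | (top1) "q\<^sub>0 \<noteq> \<infinity>" "q\<^sub>1 = \<infinity>"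
    using ratio False by (cases "q\<^sub>0 = \<infinity>"; cases "q\<^sub>1 = \<infinity>") (auto simp: exponent_ratio_def)
  then show ?thesis
  proof cases
    case top0
    have "Q\<^sub>1 = \<Theta> * Q"
      using ratio False top0 Q\<^sub>1 by (simp add: exponent_ratio_def Q_def Q\<^sub>1_def field_simps)
    then show ?thesis
      using lq_norm_Holder_top[of "1 - \<Theta>" \<Theta> q\<^sub>1 q X Y Z] \<Theta> q top0 False nonneg Z by (simp add: Q_def Q\<^sub>1_def)
  next
    case top1
    have "Q\<^sub>0 = (1 - \<Theta>) * Q"
      using ratio False top1 Q\<^sub>0 by (simp add: exponent_ratio_def Q_def Q\<^sub>0_def field_simps)
    then show ?thesis
      using lq_norm_Holder_top[of \<Theta> "1 - \<Theta>" q\<^sub>0 q Y X Z] \<Theta> q top1 False nonneg Z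
      by (simp add: Q_def Q\<^sub>0_def mult.commute)
  next
    case both
    note Q\<^sub>0 = Q\<^sub>0[OF both(1)] and Q\<^sub>1 = Q\<^sub>1[OF both(2)]
    define a b where "a = (1 - \<Theta>) * Q / Q\<^sub>0" and "b = \<Theta> * Q / Q\<^sub>1"
    have ab: "0 < a" "0 < b" "a + b = 1"
      using ratio False both \<Theta> Q Q\<^sub>0 Q\<^sub>1 by (auto simp: exponent_ratio_def a_def b_def Q_def Q\<^sub>0_def Q\<^sub>1_def)
    have "(\<Sum>j. ennreal (Z j powr Q)) \<le> (\<Sum>j. enn_powr (ennreal (X j powr Q\<^sub>0)) a * enn_powr (ennreal (Y j powr Q\<^sub>1)) b)"
    proof (intro suminf_le summableI)
      fix j
      have "Z j powr Q \<le> (X j powr (1 - \<Theta>) * Y j powr \<Theta>) powr Q"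
        using Q Z nonneg by (intro powr_mono2) auto
      also have "\<dots> = (X j powr Q\<^sub>0) powr a * (Y j powr Q\<^sub>1) powr b"
        using Q\<^sub>0 Q\<^sub>1 nonneg by (simp add: powr_mult powr_powr a_def b_def)
      finally show "ennreal (Z j powr Q) \<le> enn_powr (ennreal (X j powr Q\<^sub>0)) a * enn_powr (ennreal (Y j powr Q\<^sub>1)) b"
        using ab by (simp add: enn_powr_ennreal ennreal_mult[symmetric] ennreal_leI)
    qed
    also have "\<dots> \<le> enn_powr (\<Sum>j. ennreal (X j powr Q\<^sub>0)) a * enn_powr (\<Sum>j. ennreal (Y j powr Q\<^sub>1)) b"
      by (rule nn_integral_Holder[where M = "count_space (UNIV :: nat set)", unfolded nn_integral_count_space_nat])
        (use ab in auto)
    finally have "enn_powr (\<Sum>j. ennreal (Z j powr Q)) (1 / Q)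
        \<le> enn_powr (enn_powr (\<Sum>j. ennreal (X j powr Q\<^sub>0)) a * enn_powr (\<Sum>j. ennreal (Y j powr Q\<^sub>1)) b) (1 / Q)"
      using Q by (intro enn_powr_mono) auto
    also have "\<dots> = enn_powr (\<Sum>j. ennreal (X j powr Q\<^sub>0)) (a / Q) * enn_powr (\<Sum>j. ennreal (Y j powr Q\<^sub>1)) (b / Q)"
      using Q ab by (simp add: enn_powr_mult enn_powr_powr)
    also have "a / Q = 1 / Q\<^sub>0 * (1 - \<Theta>)" using Q by (simp add: a_def)
    also have "b / Q = 1 / Q\<^sub>1 * \<Theta>" using Q by (simp add: b_def)
    finally show ?thesis
      using False both Q\<^sub>0 Q\<^sub>1 \<Theta> by (simp add: lq_norm_def Q_def Q\<^sub>0_def Q\<^sub>1_def enn_powr_powr)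
  qed
qed

text \<open>The numbers \<open>a\<close> and \<open>b\<close> are the Hoelder exponents for the
  integral and at the same time the exponents of the weights in \<open>w\<close>, so the weights
  split without loss. The constant is 1.\<close>

lemma f_norm_Holder:
  fixes w\<^sub>0 w\<^sub>1 w :: "real ^ 'd \<Rightarrow> real" and lam :: "nat \<times> (int ^ 'd) \<Rightarrow> complex"
  assumes \<Theta>: "0 < \<Theta>" "\<Theta> < 1" and p: "0 < p\<^sub>0" "0 < p\<^sub>1" "1 / p = (1 - \<Theta>) / p\<^sub>0 + \<Theta> / p\<^sub>1"
    and q: "0 < q\<^sub>0" "0 < q\<^sub>1" "1 / q = ennreal (1 - \<Theta>) / q\<^sub>0 + ennreal \<Theta> / q\<^sub>1"
    and s: "s = (1 - \<Theta>) * s\<^sub>0 + \<Theta> * s\<^sub>1"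
    and weights: "weight w\<^sub>0" "weight w\<^sub>1"
    and w: "w = (\<lambda>x. w\<^sub>0 x powr ((1 - \<Theta>) * p / p\<^sub>0) * w\<^sub>1 x powr (\<Theta> * p / p\<^sub>1))"
    and lam: "\<And>z. cmod (lam z) \<le> cmod (lam\<^sub>0 z) powr (1 - \<Theta>) * cmod (lam\<^sub>1 z) powr \<Theta>"
  shows "f_norm s p q w lam \<le> enn_powr (f_norm s\<^sub>0 p\<^sub>0 q\<^sub>0 w\<^sub>0 lam\<^sub>0) (1 - \<Theta>) * enn_powr (f_norm s\<^sub>1 p\<^sub>1 q\<^sub>1 w\<^sub>1 lam\<^sub>1) \<Theta>"
proof -
  have "0 < 1 / p"
    unfolding p(3) using p(1,2) \<Theta> by (intro add_pos_pos) auto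
  then have "0 < p" by simp
  define a b where "a = (1 - \<Theta>) * p / p\<^sub>0" and "b = \<Theta> * p / p\<^sub>1"
  have "a + b = p * ((1 - \<Theta>) / p\<^sub>0 + \<Theta> / p\<^sub>1)"
    by (simp add: a_def b_def algebra_simps)
  then have ab: "0 < a" "0 < b" "a + b = 1"
    using \<open>0 < p\<close> p(1,2) \<Theta> unfolding p(3)[symmetric] by (auto simp: a_def b_def)
  note ratio = exponent_ratio_convex[OF \<Theta> q]
  define F F\<^sub>0 F\<^sub>1 where "F x = lq_norm q (scaled_value s lam x)"
    and "F\<^sub>0 x = lq_norm q\<^sub>0 (scaled_value s\<^sub>0 lam\<^sub>0 x)" and "F\<^sub>1 x = lq_norm q\<^sub>1 (scaled_value s\<^sub>1 lam\<^sub>1 x)" for x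
  have [measurable]: "F\<^sub>0 \<in> borel_measurable lebesgue" "F\<^sub>1 \<in> borel_measurable lebesgue"
    unfolding F\<^sub>0_def F\<^sub>1_def by measurable
  have [measurable]: "w\<^sub>0 \<in> borel_measurable lebesgue" "w\<^sub>1 \<in> borel_measurable lebesgue"
    using weights by (auto intro: weight_measurable)
  have F: "F x \<le> enn_powr (F\<^sub>0 x) (1 - \<Theta>) * enn_powr (F\<^sub>1 x) \<Theta>" for x
    unfolding F_def F\<^sub>0_def F\<^sub>1_def
  proof (rule lq_norm_Holder[OF \<Theta> ratio(1) q(1,2) ratio(2-4)])
    fix j
    define c c\<^sub>0 c\<^sub>1 where "c = cmod (lam (j, dyadic_index j x))" and "c\<^sub>0 = cmod (lam\<^sub>0 (j, dyadic_index j x))"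
      and "c\<^sub>1 = cmod (lam\<^sub>1 (j, dyadic_index j x))"
    have "2 powr (s * real j) * c \<le> 2 powr (s * real j) * (c\<^sub>0 powr (1 - \<Theta>) * c\<^sub>1 powr \<Theta>)"
      unfolding c_def c\<^sub>0_def c\<^sub>1_def by (intro mult_left_mono lam) simp
    also have "\<dots> = (2 powr (s\<^sub>0 * real j) * c\<^sub>0) powr (1 - \<Theta>) * (2 powr (s\<^sub>1 * real j) * c\<^sub>1) powr \<Theta>"
    proof -
      have "2 powr (s * real j) = (2 powr (s\<^sub>0 * real j)) powr (1 - \<Theta>) * (2 powr (s\<^sub>1 * real j)) powr \<Theta>"
        by (simp add: powr_powr powr_add[symmetric] s algebra_simps)
      then show ?thesis by (simp add: powr_mult c\<^sub>0_def c\<^sub>1_def)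
    qed
    finally show "scaled_value s lam x j \<le> scaled_value s\<^sub>0 lam\<^sub>0 x j powr (1 - \<Theta>) * scaled_value s\<^sub>1 lam\<^sub>1 x j powr \<Theta>"
      by (simp add: scaled_value_def c_def c\<^sub>0_def c\<^sub>1_def)
  qed (auto simp: scaled_value_nonneg)
  have "(\<integral>\<^sup>+x. enn_powr (F x) p * ennreal (w x) \<partial>lebesgue)
      \<le> (\<integral>\<^sup>+x. enn_powr (enn_powr (F\<^sub>0 x) p\<^sub>0 * ennreal (w\<^sub>0 x)) a * enn_powr (enn_powr (F\<^sub>1 x) p\<^sub>1 * ennreal (w\<^sub>1 x)) b \<partial>lebesgue)"
  proof (rule nn_integral_mono)
    fix x
    have "enn_powr (F x) p \<le> enn_powr (enn_powr (F\<^sub>0 x) (1 - \<Theta>) * enn_powr (F\<^sub>1 x) \<Theta>) p"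
      using \<open>0 < p\<close> F by (intro enn_powr_mono) auto
    also have "\<dots> = enn_powr (F\<^sub>0 x) (p\<^sub>0 * a) * enn_powr (F\<^sub>1 x) (p\<^sub>1 * b)"
      using \<open>0 < p\<close> \<Theta> p(1,2) by (simp add: enn_powr_mult enn_powr_powr a_def b_def)
    finally have "enn_powr (F x) p * ennreal (w x) \<le> enn_powr (F\<^sub>0 x) (p\<^sub>0 * a) * enn_powr (F\<^sub>1 x) (p\<^sub>1 * b) * ennreal (w x)"
      by (rule mult_right_mono) simp
    also have "\<dots> = enn_powr (enn_powr (F\<^sub>0 x) p\<^sub>0 * ennreal (w\<^sub>0 x)) a * enn_powr (enn_powr (F\<^sub>1 x) p\<^sub>1 * ennreal (w\<^sub>1 x)) b"
    proof -
      have "ennreal (w x) = enn_powr (ennreal (w\<^sub>0 x)) a * enn_powr (ennreal (w\<^sub>1 x)) b"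
        using ab weights by (simp add: w a_def[symmetric] b_def[symmetric] weight_def enn_powr_ennreal ennreal_mult)
      then show ?thesis
        using ab p(1,2) by (simp add: enn_powr_mult enn_powr_powr mult_ac)
    qed
    finally show "enn_powr (F x) p * ennreal (w x)
        \<le> enn_powr (enn_powr (F\<^sub>0 x) p\<^sub>0 * ennreal (w\<^sub>0 x)) a * enn_powr (enn_powr (F\<^sub>1 x) p\<^sub>1 * ennreal (w\<^sub>1 x)) b" .
  qed
  also have "\<dots> \<le> enn_powr (\<integral>\<^sup>+x. enn_powr (F\<^sub>0 x) p\<^sub>0 * ennreal (w\<^sub>0 x) \<partial>lebesgue) a
      * enn_powr (\<integral>\<^sup>+x. enn_powr (F\<^sub>1 x) p\<^sub>1 * ennreal (w\<^sub>1 x) \<partial>lebesgue) b"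
    using ab by (intro nn_integral_Holder) auto
  finally have "f_norm s p q w lam \<le> enn_powr (enn_powr (\<integral>\<^sup>+x. enn_powr (F\<^sub>0 x) p\<^sub>0 * ennreal (w\<^sub>0 x) \<partial>lebesgue) a
      * enn_powr (\<integral>\<^sup>+x. enn_powr (F\<^sub>1 x) p\<^sub>1 * ennreal (w\<^sub>1 x) \<partial>lebesgue) b) (1 / p)"
    unfolding f_norm_eq Lp_weighted_norm_def F_def using \<open>0 < p\<close> by (intro enn_powr_mono) auto
  also have "\<dots> = enn_powr (f_norm s\<^sub>0 p\<^sub>0 q\<^sub>0 w\<^sub>0 lam\<^sub>0) (1 - \<Theta>) * enn_powr (f_norm s\<^sub>1 p\<^sub>1 q\<^sub>1 w\<^sub>1 lam\<^sub>1) \<Theta>"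
    using \<open>0 < p\<close> p(1,2) \<Theta> ab
    by (simp add: f_norm_eq Lp_weighted_norm_def F\<^sub>0_def F\<^sub>1_def enn_powr_mult enn_powr_powr) (simp add: a_def b_def)
  finally show ?thesis .
qed

text \<open>The identity from which the multipliers of the factorization are obtained: the second
  factor is the solution \<open>h\<close> of the equation between the \<open>p\<^sub>i\<close>-th
  power of \<open>f powr t\<close> times \<open>h\<close>, weighted by \<open>v\<^sub>i\<close>, and
  the \<open>p\<close>-th power of \<open>f\<close>, weighted by \<open>v\<close>.\<close>

lemma enn_powr_multiplier_eq:
  assumes "0 < f" "0 < v" "0 < v\<^sub>i" "0 < p\<^sub>i"
  shows "enn_powr (enn_powr (ennreal f) t * ennreal (f powr (p / p\<^sub>i - t) * (v / v\<^sub>i) powr (1 / p\<^sub>i))) p\<^sub>i * ennreal v\<^sub>i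
    = enn_powr (ennreal f) p * ennreal v"
proof -
  have "f powr t * (f powr (p / p\<^sub>i - t) * (v / v\<^sub>i) powr (1 / p\<^sub>i)) = f powr (p / p\<^sub>i) * (v / v\<^sub>i) powr (1 / p\<^sub>i)"
    by (simp add: powr_diff assms)
  moreover have "(f powr (p / p\<^sub>i) * (v / v\<^sub>i) powr (1 / p\<^sub>i)) powr p\<^sub>i * v\<^sub>i = f powr p * v"
    using assms by (simp add: powr_mult powr_powr)
  moreover have "enn_powr (enn_powr (ennreal f) t * ennreal (f powr (p / p\<^sub>i - t) * (v / v\<^sub>i) powr (1 / p\<^sub>i))) p\<^sub>i * ennreal v\<^sub>i
      = ennreal ((f powr t * (f powr (p / p\<^sub>i - t) * (v / v\<^sub>i) powr (1 / p\<^sub>i))) powr p\<^sub>i * v\<^sub>i)"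
    using assms by (simp add: enn_powr_ennreal_pos ennreal_mult[symmetric])
  moreover have "enn_powr (ennreal f) p * ennreal v = ennreal (f powr p * v)"
    using assms by (simp add: enn_powr_ennreal_pos ennreal_mult)
  ultimately show ?thesis by (simp only:)
qed

text \<open>The factors depend on \<open>lam\<close> through \<open>F\<close> and the medians, but
  the constant is the weighted geometric mean of the constants for the two weights and is fixed
  beforehand.\<close>

lemma f_norm_factorization:
  fixes w\<^sub>0 w\<^sub>1 w :: "real ^ 'd \<Rightarrow> real"
  assumes \<Theta>: "0 < \<Theta>" "\<Theta> < 1" and p: "0 < p\<^sub>0" "0 < p\<^sub>1" "1 / p = (1 - \<Theta>) / p\<^sub>0 + \<Theta> / p\<^sub>1"
    and q: "0 < q\<^sub>0" "0 < q\<^sub>1" "1 / q = ennreal (1 - \<Theta>) / q\<^sub>0 + ennreal \<Theta> / q\<^sub>1"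
    and s: "s = (1 - \<Theta>) * s\<^sub>0 + \<Theta> * s\<^sub>1"
    and weights: "w\<^sub>0 \<in> muckenhoupt_loc_infinity" "w\<^sub>1 \<in> muckenhoupt_loc_infinity"
    and w: "w = (\<lambda>x. w\<^sub>0 x powr ((1 - \<Theta>) * p / p\<^sub>0) * w\<^sub>1 x powr (\<Theta> * p / p\<^sub>1))"
  obtains C where "0 < C"
    and "\<And>lam. f_norm s p q w lam < top \<Longrightarrow> \<exists>lam\<^sub>0 lam\<^sub>1.
      (\<forall>z. cmod (lam z) \<le> cmod (lam\<^sub>0 z) powr (1 - \<Theta>) * cmod (lam\<^sub>1 z) powr \<Theta>)
      \<and> f_norm s\<^sub>0 p\<^sub>0 q\<^sub>0 w\<^sub>0 lam\<^sub>0 < top \<and> f_norm s\<^sub>1 p\<^sub>1 q\<^sub>1 w\<^sub>1 lam\<^sub>1 < top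
      \<and> enn_powr (f_norm s\<^sub>0 p\<^sub>0 q\<^sub>0 w\<^sub>0 lam\<^sub>0) (1 - \<Theta>) * enn_powr (f_norm s\<^sub>1 p\<^sub>1 q\<^sub>1 w\<^sub>1 lam\<^sub>1) \<Theta>
        \<le> ennreal C * f_norm s p q w lam"
proof -
  have "0 < 1 / p"
    unfolding p(3) using p(1,2) \<Theta> by (intro add_pos_pos) auto
  then have "0 < p" by simp
  note ratio = exponent_ratio_convex[OF \<Theta> q]
  define t\<^sub>0 t\<^sub>1 where "t\<^sub>0 = exponent_ratio q q\<^sub>0" and "t\<^sub>1 = exponent_ratio q q\<^sub>1"
  have t: "(1 - \<Theta>) * t\<^sub>0 + \<Theta> * t\<^sub>1 = 1" using ratio(4) by (simp add: t\<^sub>0_def t\<^sub>1_def)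
  have p_sum: "(1 - \<Theta>) * (p / p\<^sub>0) + \<Theta> * (p / p\<^sub>1) = 1"
  proof -
    have "(1 - \<Theta>) * (p / p\<^sub>0) + \<Theta> * (p / p\<^sub>1) = p * (1 / p)"
      unfolding p(3) by (simp add: algebra_simps)
    then show ?thesis using \<open>0 < p\<close> by simp
  qed
  obtain C\<^sub>0 where C\<^sub>0: "0 < C\<^sub>0"
    and bound\<^sub>0: "\<And>s s\<^sub>i w lam H m. H \<in> borel_measurable lebesgue \<Longrightarrow> (\<And>x. 0 \<le> H x) \<Longrightarrow> (\<And>j k. 0 \<le> m j k) \<Longrightarrow>
      (\<And>j k. lam (j, k) \<noteq> 0 \<Longrightarrow>
        emeasure lebesgue (dyadic_cube j k) \<le> 2 * emeasure lebesgue {x \<in> dyadic_cube j k. m j k \<le> H x}) \<Longrightarrow>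
      (AE x in lebesgue. 0 < lq_norm q (scaled_value s lam x) \<longrightarrow>
        enn_powr (enn_powr (lq_norm q (scaled_value s lam x)) t\<^sub>0 * ennreal (H x)) p\<^sub>0 * ennreal (w\<^sub>0 x)
        \<le> enn_powr (lq_norm q (scaled_value s lam x)) p * ennreal (w x)) \<Longrightarrow>
      f_norm s\<^sub>i p\<^sub>0 q\<^sub>0 w\<^sub>0 (\<lambda>(j, k). of_real (2 powr (- s\<^sub>i * real j) * (2 powr (s * real j) * cmod (lam (j, k))) powr t\<^sub>0 * m j k))
      \<le> ennreal C\<^sub>0 * enn_powr (f_norm s p q w lam) (p / p\<^sub>0)"
    using f_norm_powr_multiplier_le[OF weights(1) p(1) q(1) ratio(1,2) \<open>0 < p\<close>] unfolding t\<^sub>0_def by blast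
  obtain C\<^sub>1 where C\<^sub>1: "0 < C\<^sub>1"
    and bound\<^sub>1: "\<And>s s\<^sub>i w lam H m. H \<in> borel_measurable lebesgue \<Longrightarrow> (\<And>x. 0 \<le> H x) \<Longrightarrow> (\<And>j k. 0 \<le> m j k) \<Longrightarrow>
      (\<And>j k. lam (j, k) \<noteq> 0 \<Longrightarrow>
        emeasure lebesgue (dyadic_cube j k) \<le> 2 * emeasure lebesgue {x \<in> dyadic_cube j k. m j k \<le> H x}) \<Longrightarrow>
      (AE x in lebesgue. 0 < lq_norm q (scaled_value s lam x) \<longrightarrow>
        enn_powr (enn_powr (lq_norm q (scaled_value s lam x)) t\<^sub>1 * ennreal (H x)) p\<^sub>1 * ennreal (w\<^sub>1 x)
        \<le> enn_powr (lq_norm q (scaled_value s lam x)) p * ennreal (w x)) \<Longrightarrow>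
      f_norm s\<^sub>i p\<^sub>1 q\<^sub>1 w\<^sub>1 (\<lambda>(j, k). of_real (2 powr (- s\<^sub>i * real j) * (2 powr (s * real j) * cmod (lam (j, k))) powr t\<^sub>1 * m j k))
      \<le> ennreal C\<^sub>1 * enn_powr (f_norm s p q w lam) (p / p\<^sub>1)"
    using f_norm_powr_multiplier_le[OF weights(2) p(2) q(2) ratio(1,3) \<open>0 < p\<close>] unfolding t\<^sub>1_def by blast
  have [measurable]: "w\<^sub>0 \<in> borel_measurable lebesgue" "w\<^sub>1 \<in> borel_measurable lebesgue"
    using weights by (auto intro: weight_measurable muckenhoupt_loc_infinityD)
  then have [measurable]: "w \<in> borel_measurable lebesgue"
    unfolding w by measurable
  have w_pos: "AE x in lebesgue. 0 < w\<^sub>0 x \<and> 0 < w\<^sub>1 x \<and> 0 < w x"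
    using muckenhoupt_loc_infinityD(2)[OF weights(1)] muckenhoupt_loc_infinityD(2)[OF weights(2)]
    by eventually_elim (auto simp: w)
  show thesis
  proof (rule that[of "C\<^sub>0 powr (1 - \<Theta>) * C\<^sub>1 powr \<Theta>"])
    fix lam :: "nat \<times> (int ^ 'd) \<Rightarrow> complex"
    assume fin: "f_norm s p q w lam < top"
    define F where "F x = lq_norm q (scaled_value s lam x)" for x
    have [measurable]: "F \<in> borel_measurable lebesgue"
      unfolding F_def by measurable
    have "(\<integral>\<^sup>+x. enn_powr (F x) p * ennreal (w x) \<partial>lebesgue) \<noteq> \<infinity>"
      using fin \<open>0 < p\<close> unfolding f_norm_eq Lp_weighted_norm_def F_def[symmetric] by auto
    then have "AE x in lebesgue. enn_powr (F x) p * ennreal (w x) \<noteq> \<infinity>"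
      by (intro nn_integral_noteq_infinite) auto
    \<comment> \<open>A finite norm makes the integrand finite almost everywhere, and division by
      the positive weight leaves \<open>F\<close> finite. Only then does the real function
      \<open>f\<close> represent \<open>F\<close>.\<close>
    with w_pos have F_fin: "AE x in lebesgue. 0 < w\<^sub>0 x \<and> 0 < w\<^sub>1 x \<and> 0 < w x \<and> F x < top"
    proof eventually_elim
      case (elim x)
      then have "F x \<noteq> top"
        using \<open>0 < p\<close> by (auto simp: ennreal_top_mult)
      with elim show ?case by (simp add: less_top)
    qed
    define f where "f x = enn2real (F x)" for x
    define H\<^sub>0 where "H\<^sub>0 x = f x powr (p / p\<^sub>0 - t\<^sub>0) * (w x / w\<^sub>0 x) powr (1 / p\<^sub>0)" for x
    define H\<^sub>1 where "H\<^sub>1 x = f x powr (p / p\<^sub>1 - t\<^sub>1) * (w x / w\<^sub>1 x) powr (1 / p\<^sub>1)" for x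
    have [measurable]: "H\<^sub>0 \<in> borel_measurable lebesgue" "H\<^sub>1 \<in> borel_measurable lebesgue"
      unfolding H\<^sub>0_def H\<^sub>1_def f_def by measurable
    have dual: "AE x in lebesgue. 0 < F x \<longrightarrow> 0 < H\<^sub>0 x \<and> H\<^sub>1 x = H\<^sub>0 x powr (- ((1 - \<Theta>) / \<Theta>))"
      using F_fin
    proof eventually_elim
      case (elim x)
      show ?case
      proof
        assume "0 < F x"
        then have f: "0 < f x" using elim by (simp add: f_def enn2real_positive_iff)
        then have H: "0 < H\<^sub>0 x" "0 < H\<^sub>1 x" using elim by (auto simp: H\<^sub>0_def H\<^sub>1_def)
        define L L\<^sub>0 L\<^sub>1 where "L = ln (f x)" and "L\<^sub>0 = ln (w\<^sub>0 x)" and "L\<^sub>1 = ln (w\<^sub>1 x)"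
        have lw: "ln (w x) = p * ((1 - \<Theta>) / p\<^sub>0 * L\<^sub>0 + \<Theta> / p\<^sub>1 * L\<^sub>1)"
          using elim by (simp add: w ln_mult ln_powr L\<^sub>0_def L\<^sub>1_def algebra_simps)
        have lH: "ln (H\<^sub>0 x) = (p / p\<^sub>0 - t\<^sub>0) * L + 1 / p\<^sub>0 * (ln (w x) - L\<^sub>0)"
          "ln (H\<^sub>1 x) = (p / p\<^sub>1 - t\<^sub>1) * L + 1 / p\<^sub>1 * (ln (w x) - L\<^sub>1)"
          using elim f by (auto simp: H\<^sub>0_def H\<^sub>1_def ln_mult ln_powr ln_div L_def L\<^sub>0_def L\<^sub>1_def)
        \<comment> \<open>In logarithms the product relation is linear. The coefficient of
          \<open>L\<close> is a difference of two averages that are both one, and the remaining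
          terms cancel by the definition of \<open>w\<close>.\<close>
        have "(1 - \<Theta>) * ln (H\<^sub>0 x) + \<Theta> * ln (H\<^sub>1 x)
            = ((1 - \<Theta>) * (p / p\<^sub>0) + \<Theta> * (p / p\<^sub>1) - ((1 - \<Theta>) * t\<^sub>0 + \<Theta> * t\<^sub>1)) * L
              + ((1 - \<Theta>) / p\<^sub>0 + \<Theta> / p\<^sub>1) * ln (w x) - ((1 - \<Theta>) / p\<^sub>0 * L\<^sub>0 + \<Theta> / p\<^sub>1 * L\<^sub>1)"
          unfolding lH by (simp add: algebra_simps add_divide_distrib diff_divide_distrib)
        also have "\<dots> = 0"
          unfolding p_sum t p(3)[symmetric] lw using \<open>0 < p\<close> by simp
        finally have "ln (H\<^sub>1 x) = - ((1 - \<Theta>) / \<Theta>) * ln (H\<^sub>0 x)"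
          using \<Theta> by (simp add: field_simps)
        then have "H\<^sub>1 x = H\<^sub>0 x powr (- ((1 - \<Theta>) / \<Theta>))"
          using H by (metis exp_ln powr_def less_irrefl)
        with H show "0 < H\<^sub>0 x \<and> H\<^sub>1 x = H\<^sub>0 x powr (- ((1 - \<Theta>) / \<Theta>))" by simp
      qed
    qed
    define median where "median j k m \<longleftrightarrow> emeasure lebesgue (dyadic_cube j k) \<le> 2 * emeasure lebesgue {x \<in> dyadic_cube j k. m \<le> H\<^sub>0 x}
        \<and> emeasure lebesgue (dyadic_cube j k) \<le> 2 * emeasure lebesgue {x \<in> dyadic_cube j k. H\<^sub>0 x \<le> m}" for j k m
    have "\<exists>m. median j k m" for j and k :: "int ^ 'd"
    proof -
      have "emeasure lebesgue (dyadic_cube j k) < top" by (simp only: emeasure_dyadic_cube ennreal_less_top)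
      from median_exists[OF \<open>H\<^sub>0 \<in> borel_measurable lebesgue\<close> dyadic_cube_lebesgue this] show ?thesis
        unfolding median_def by blast
    qed
    then obtain m where median: "\<And>j k. median j k (m j k)" by metis
    have m: "emeasure lebesgue (dyadic_cube j k) \<le> 2 * emeasure lebesgue {x \<in> dyadic_cube j k. m j k \<le> H\<^sub>0 x}"
      "emeasure lebesgue (dyadic_cube j k) \<le> 2 * emeasure lebesgue {x \<in> dyadic_cube j k. H\<^sub>0 x \<le> m j k}" for j k
      using median[of j k] by (simp_all only: median_def)
    have F_pos: "0 < F x" if "lam (j, k) \<noteq> 0" "x \<in> dyadic_cube j k" for j k x
    proof -
      have "0 < scaled_value s lam x j"
        using that by (auto simp: scaled_value_def dyadic_cube_iff)
      then have "0 < ennreal (scaled_value s lam x j)" by simp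
      also have "\<dots> \<le> F x"
        unfolding F_def using ratio(1) by (intro le_lq_norm scaled_value_nonneg)
      finally show ?thesis .
    qed
    have meas: "{x \<in> dyadic_cube j k. P x} \<in> sets lebesgue" if "Measurable.pred lebesgue P" for P j and k :: "int ^ 'd"
    proof -
      have "{x \<in> dyadic_cube j k. P x} = dyadic_cube j k \<inter> {x \<in> space lebesgue. P x}" by auto
      with that show ?thesis by simp
    qed
    \<comment> \<open>On a cube with a nonzero coefficient \<open>F\<close> is positive, hence
      \<open>H\<^sub>0\<close> is positive almost everywhere. A median that is not positive would
      leave a null set below it, not half of the cube.\<close>
    have m_pos: "0 < m j k" if "lam (j, k) \<noteq> 0" for j k
    proof (rule ccontr)
      assume "\<not> 0 < m j k"
      have "emeasure lebesgue {x \<in> dyadic_cube j k. H\<^sub>0 x \<le> m j k} \<le> emeasure lebesgue ({} :: (real ^ 'd) set)"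
      proof (rule emeasure_mono_AE)
        show "AE x in lebesgue. x \<in> {x \<in> dyadic_cube j k. H\<^sub>0 x \<le> m j k} \<longrightarrow> x \<in> {}"
          using dual by eventually_elim (use F_pos[OF that] \<open>\<not> 0 < m j k\<close> in force)
      qed simp
      then have "emeasure lebesgue (dyadic_cube j k) \<le> 2 * 0"
        using m(2)[of j k] by (simp only: emeasure_empty) (metis le_zero_eq)
      moreover have "0 < (1 / 2 ^ j :: real) ^ CARD('d)"
        by (rule zero_less_power) simp
      ultimately show False
        unfolding emeasure_dyadic_cube by (metis ennreal_less_zero_iff mult_zero_right not_less)
    qed
    \<comment> \<open>Cubes with a zero coefficient may have a negative median; cutting it off at
      zero gives the nonnegativity required on all cubes.\<close>
    define m\<^sub>0 where "m\<^sub>0 j k = max 0 (m j k)" for j k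
    \<comment> \<open>With this exponent the factors contributed by the medians cancel exactly in
      the product of the two sequences.\<close>
    define m\<^sub>1 where "m\<^sub>1 j k = m\<^sub>0 j k powr (- ((1 - \<Theta>) / \<Theta>))" for j k
    define lam\<^sub>0 :: "nat \<times> (int ^ 'd) \<Rightarrow> complex"
      where "lam\<^sub>0 = (\<lambda>(j, k). of_real (2 powr (- s\<^sub>0 * real j) * (2 powr (s * real j) * cmod (lam (j, k))) powr t\<^sub>0 * m\<^sub>0 j k))"
    define lam\<^sub>1 :: "nat \<times> (int ^ 'd) \<Rightarrow> complex"
      where "lam\<^sub>1 = (\<lambda>(j, k). of_real (2 powr (- s\<^sub>1 * real j) * (2 powr (s * real j) * cmod (lam (j, k))) powr t\<^sub>1 * m\<^sub>1 j k))"
    have norm\<^sub>0: "f_norm s\<^sub>0 p\<^sub>0 q\<^sub>0 w\<^sub>0 lam\<^sub>0 \<le> ennreal C\<^sub>0 * enn_powr (f_norm s p q w lam) (p / p\<^sub>0)"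
      unfolding lam\<^sub>0_def
    proof (rule bound\<^sub>0)
      show "H\<^sub>0 \<in> borel_measurable lebesgue" by fact
      show "emeasure lebesgue (dyadic_cube j k) \<le> 2 * emeasure lebesgue {x \<in> dyadic_cube j k. m\<^sub>0 j k \<le> H\<^sub>0 x}"
        if "lam (j, k) \<noteq> 0" for j k
        using m(1)[of j k] m_pos[OF that] by (simp add: m\<^sub>0_def max_def)
      show "AE x in lebesgue. 0 < lq_norm q (scaled_value s lam x) \<longrightarrow>
        enn_powr (enn_powr (lq_norm q (scaled_value s lam x)) t\<^sub>0 * ennreal (H\<^sub>0 x)) p\<^sub>0 * ennreal (w\<^sub>0 x)
        \<le> enn_powr (lq_norm q (scaled_value s lam x)) p * ennreal (w x)"
        unfolding F_def[symmetric] using F_fin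
      proof eventually_elim
        case (elim x)
        then have "F x = ennreal (f x)" by (simp add: f_def)
        with elim show ?case
          using enn_powr_multiplier_eq[of "f x" "w x" "w\<^sub>0 x" p\<^sub>0 t\<^sub>0 p] p(1) by (auto simp: H\<^sub>0_def)
      qed
    qed (auto simp: H\<^sub>0_def m\<^sub>0_def)
    have norm\<^sub>1: "f_norm s\<^sub>1 p\<^sub>1 q\<^sub>1 w\<^sub>1 lam\<^sub>1 \<le> ennreal C\<^sub>1 * enn_powr (f_norm s p q w lam) (p / p\<^sub>1)"
      unfolding lam\<^sub>1_def
    proof (rule bound\<^sub>1)
      show "H\<^sub>1 \<in> borel_measurable lebesgue" by fact
      show "emeasure lebesgue (dyadic_cube j k) \<le> 2 * emeasure lebesgue {x \<in> dyadic_cube j k. m\<^sub>1 j k \<le> H\<^sub>1 x}"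
        if "lam (j, k) \<noteq> 0" for j k
      proof -
        \<comment> \<open>The negative exponent reverses the order, so the lower half for
          \<open>H\<^sub>0\<close> is, up to a null set, contained in the upper half for
          \<open>H\<^sub>1\<close>.\<close>
        have "emeasure lebesgue {x \<in> dyadic_cube j k. H\<^sub>0 x \<le> m j k} \<le> emeasure lebesgue {x \<in> dyadic_cube j k. m\<^sub>1 j k \<le> H\<^sub>1 x}"
        proof (rule emeasure_mono_AE)
          show "AE x in lebesgue. x \<in> {x \<in> dyadic_cube j k. H\<^sub>0 x \<le> m j k} \<longrightarrow> x \<in> {x \<in> dyadic_cube j k. m\<^sub>1 j k \<le> H\<^sub>1 x}"
            using dual
          proof eventually_elim
            case (elim x)
            have "m\<^sub>1 j k \<le> H\<^sub>1 x" if "x \<in> dyadic_cube j k" "H\<^sub>0 x \<le> m j k"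
            proof -
              have "0 < H\<^sub>0 x" "H\<^sub>1 x = H\<^sub>0 x powr (- ((1 - \<Theta>) / \<Theta>))"
                using elim F_pos[OF \<open>lam (j, k) \<noteq> 0\<close> that(1)] by auto
              then show ?thesis
                using that \<Theta> m_pos[OF \<open>lam (j, k) \<noteq> 0\<close>] by (auto simp: m\<^sub>1_def m\<^sub>0_def intro!: powr_mono2')
            qed
            then show ?case by auto
          qed
        qed (rule meas, measurable)
        with m(2)[of j k] show ?thesis by (meson mult_left_mono order_trans zero_le)
      qed
      show "AE x in lebesgue. 0 < lq_norm q (scaled_value s lam x) \<longrightarrow>
        enn_powr (enn_powr (lq_norm q (scaled_value s lam x)) t\<^sub>1 * ennreal (H\<^sub>1 x)) p\<^sub>1 * ennreal (w\<^sub>1 x)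
        \<le> enn_powr (lq_norm q (scaled_value s lam x)) p * ennreal (w x)"
        unfolding F_def[symmetric] using F_fin
      proof eventually_elim
        case (elim x)
        then have "F x = ennreal (f x)" by (simp add: f_def)
        with elim show ?case
          using enn_powr_multiplier_eq[of "f x" "w x" "w\<^sub>1 x" p\<^sub>1 t\<^sub>1 p] p(2) by (auto simp: H\<^sub>1_def)
      qed
    qed (auto simp: H\<^sub>1_def m\<^sub>1_def)
    have "cmod (lam z) \<le> cmod (lam\<^sub>0 z) powr (1 - \<Theta>) * cmod (lam\<^sub>1 z) powr \<Theta>" for z
    proof (cases z)
      case (Pair j k)
      show ?thesis
      proof (cases "lam (j, k) = 0")
        case False
        define X where "X = 2 powr (s * real j) * cmod (lam (j, k))"
        have X: "0 < X" using False by (simp add: X_def)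
        define \<mu> where "\<mu> = m\<^sub>0 j k"
        have \<mu>: "0 < \<mu>" using m_pos[OF False] by (simp add: \<mu>_def m\<^sub>0_def)
        have "cmod (lam\<^sub>0 (j, k)) = 2 powr (- s\<^sub>0 * real j) * X powr t\<^sub>0 * \<mu>"
          using \<mu> by (simp add: lam\<^sub>0_def X_def \<mu>_def norm_mult del: of_real_mult)
        moreover have "cmod (lam\<^sub>1 (j, k)) = 2 powr (- s\<^sub>1 * real j) * X powr t\<^sub>1 * \<mu> powr (- ((1 - \<Theta>) / \<Theta>))"
          by (simp add: lam\<^sub>1_def X_def \<mu>_def m\<^sub>1_def norm_mult del: of_real_mult)
        ultimately have "cmod (lam\<^sub>0 (j, k)) powr (1 - \<Theta>) * cmod (lam\<^sub>1 (j, k)) powr \<Theta>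
            = (2 powr (- s\<^sub>0 * real j * (1 - \<Theta>)) * 2 powr (- s\<^sub>1 * real j * \<Theta>)) * (X powr (t\<^sub>0 * (1 - \<Theta>)) * X powr (t\<^sub>1 * \<Theta>))
              * (\<mu> powr (1 - \<Theta>) * \<mu> powr (- ((1 - \<Theta>) / \<Theta>) * \<Theta>))"
          using \<mu> X by (simp add: powr_mult powr_powr mult_ac)
        also have "2 powr (- s\<^sub>0 * real j * (1 - \<Theta>)) * 2 powr (- s\<^sub>1 * real j * \<Theta>) = 2 powr (- (s * real j))"
          unfolding powr_add[symmetric] s by (simp add: algebra_simps)
        also have "X powr (t\<^sub>0 * (1 - \<Theta>)) * X powr (t\<^sub>1 * \<Theta>) = X"
          using t X unfolding powr_add[symmetric] by (simp add: mult.commute)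
        also have "\<mu> powr (1 - \<Theta>) * \<mu> powr (- ((1 - \<Theta>) / \<Theta>) * \<Theta>) = 1"
          using \<Theta> \<mu> unfolding powr_add[symmetric] by simp
        finally have "cmod (lam\<^sub>0 (j, k)) powr (1 - \<Theta>) * cmod (lam\<^sub>1 (j, k)) powr \<Theta> = cmod (lam (j, k))"
          by (simp add: X_def mult.assoc[symmetric] powr_add[symmetric])
        then show ?thesis by (simp add: Pair)
      qed (simp add: Pair)
    qed
    moreover have "f_norm s\<^sub>0 p\<^sub>0 q\<^sub>0 w\<^sub>0 lam\<^sub>0 < top"
      using norm\<^sub>0 enn_powr_less_top[OF fin, of "p / p\<^sub>0"] \<open>0 < p\<close> p(1)
      by (auto simp: ennreal_mult_less_top intro: le_less_trans)
    moreover have "f_norm s\<^sub>1 p\<^sub>1 q\<^sub>1 w\<^sub>1 lam\<^sub>1 < top"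
      using norm\<^sub>1 enn_powr_less_top[OF fin, of "p / p\<^sub>1"] \<open>0 < p\<close> p(2)
      by (auto simp: ennreal_mult_less_top intro: le_less_trans)
    moreover have "enn_powr (f_norm s\<^sub>0 p\<^sub>0 q\<^sub>0 w\<^sub>0 lam\<^sub>0) (1 - \<Theta>) * enn_powr (f_norm s\<^sub>1 p\<^sub>1 q\<^sub>1 w\<^sub>1 lam\<^sub>1) \<Theta>
        \<le> ennreal (C\<^sub>0 powr (1 - \<Theta>) * C\<^sub>1 powr \<Theta>) * f_norm s p q w lam"
    proof -
      have "enn_powr (f_norm s\<^sub>0 p\<^sub>0 q\<^sub>0 w\<^sub>0 lam\<^sub>0) (1 - \<Theta>) * enn_powr (f_norm s\<^sub>1 p\<^sub>1 q\<^sub>1 w\<^sub>1 lam\<^sub>1) \<Theta>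
          \<le> enn_powr (ennreal C\<^sub>0 * enn_powr (f_norm s p q w lam) (p / p\<^sub>0)) (1 - \<Theta>)
            * enn_powr (ennreal C\<^sub>1 * enn_powr (f_norm s p q w lam) (p / p\<^sub>1)) \<Theta>"
        using \<Theta> by (intro mult_mono enn_powr_mono norm\<^sub>0 norm\<^sub>1) auto
      also have "\<dots> = ennreal (C\<^sub>0 powr (1 - \<Theta>) * C\<^sub>1 powr \<Theta>)
          * (enn_powr (f_norm s p q w lam) ((1 - \<Theta>) * (p / p\<^sub>0)) * enn_powr (f_norm s p q w lam) (\<Theta> * (p / p\<^sub>1)))"
        using \<Theta> C\<^sub>0 C\<^sub>1 \<open>0 < p\<close> p(1,2)
        by (simp add: enn_powr_mult enn_powr_powr enn_powr_ennreal ennreal_mult mult_ac)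
      also have "enn_powr (f_norm s p q w lam) ((1 - \<Theta>) * (p / p\<^sub>0)) * enn_powr (f_norm s p q w lam) (\<Theta> * (p / p\<^sub>1)) = f_norm s p q w lam"
        using \<Theta> \<open>0 < p\<close> p(1,2) p_sum by (subst enn_powr_add[symmetric]) auto
      finally show ?thesis .
    qed
    ultimately show "\<exists>lam\<^sub>0 lam\<^sub>1.
      (\<forall>z. cmod (lam z) \<le> cmod (lam\<^sub>0 z) powr (1 - \<Theta>) * cmod (lam\<^sub>1 z) powr \<Theta>)
      \<and> f_norm s\<^sub>0 p\<^sub>0 q\<^sub>0 w\<^sub>0 lam\<^sub>0 < top \<and> f_norm s\<^sub>1 p\<^sub>1 q\<^sub>1 w\<^sub>1 lam\<^sub>1 < top
      \<and> enn_powr (f_norm s\<^sub>0 p\<^sub>0 q\<^sub>0 w\<^sub>0 lam\<^sub>0) (1 - \<Theta>) * enn_powr (f_norm s\<^sub>1 p\<^sub>1 q\<^sub>1 w\<^sub>1 lam\<^sub>1) \<Theta>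
        \<le> ennreal (C\<^sub>0 powr (1 - \<Theta>) * C\<^sub>1 powr \<Theta>) * f_norm s p q w lam"
      by blast
  qed (use C\<^sub>0 C\<^sub>1 in simp)
qed

theorem theorem12:
  fixes \<Theta> p\<^sub>0 p\<^sub>1 p s\<^sub>0 s\<^sub>1 s :: real
    and q\<^sub>0 q\<^sub>1 q :: ennreal
    and w\<^sub>0 w\<^sub>1 w :: "real ^ 'd \<Rightarrow> real"
  assumes "0 < \<Theta>" "\<Theta> < 1"
    and "0 < p\<^sub>0" "0 < p\<^sub>1" "0 < q\<^sub>0" "0 < q\<^sub>1"
    and "1 / p = (1 - \<Theta>) / p\<^sub>0 + \<Theta> / p\<^sub>1"
    and "1 / q = ennreal (1 - \<Theta>) / q\<^sub>0 + ennreal \<Theta> / q\<^sub>1"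
    and "s = (1 - \<Theta>) * s\<^sub>0 + \<Theta> * s\<^sub>1"
    and "w\<^sub>0 \<in> muckenhoupt_loc_infinity" "w\<^sub>1 \<in> muckenhoupt_loc_infinity"
    and "w = (\<lambda>x. w\<^sub>0 x powr ((1 - \<Theta>) * p / p\<^sub>0) * w\<^sub>1 x powr (\<Theta> * p / p\<^sub>1))"
  shows "calderon_product (count_space UNIV) \<Theta>
             (f_space s\<^sub>0 p\<^sub>0 q\<^sub>0 w\<^sub>0) (f_norm s\<^sub>0 p\<^sub>0 q\<^sub>0 w\<^sub>0)
             (f_space s\<^sub>1 p\<^sub>1 q\<^sub>1 w\<^sub>1) (f_norm s\<^sub>1 p\<^sub>1 q\<^sub>1 w\<^sub>1)
           = f_space s p q w
       \<and> equivalent_norms_on (f_space s p q w) (f_norm s p q w)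
           (calderon_norm (count_space UNIV) \<Theta>
             (f_space s\<^sub>0 p\<^sub>0 q\<^sub>0 w\<^sub>0) (f_norm s\<^sub>0 p\<^sub>0 q\<^sub>0 w\<^sub>0)
             (f_space s\<^sub>1 p\<^sub>1 q\<^sub>1 w\<^sub>1) (f_norm s\<^sub>1 p\<^sub>1 q\<^sub>1 w\<^sub>1))"
proof -
  define n where "n = calderon_norm (count_space UNIV) \<Theta>
      (f_space s\<^sub>0 p\<^sub>0 q\<^sub>0 w\<^sub>0) (f_norm s\<^sub>0 p\<^sub>0 q\<^sub>0 w\<^sub>0) (f_space s\<^sub>1 p\<^sub>1 q\<^sub>1 w\<^sub>1) (f_norm s\<^sub>1 p\<^sub>1 q\<^sub>1 w\<^sub>1)"
  have lower: "f_norm s p q w lam \<le> n lam" for lam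
    unfolding n_def calderon_norm_def
  proof (rule Inf_greatest)
    fix y
    assume "y \<in> {enn_powr (f_norm s\<^sub>0 p\<^sub>0 q\<^sub>0 w\<^sub>0 f\<^sub>0) (1 - \<Theta>) * enn_powr (f_norm s\<^sub>1 p\<^sub>1 q\<^sub>1 w\<^sub>1 f\<^sub>1) \<Theta> | f\<^sub>0 f\<^sub>1.
        f\<^sub>0 \<in> f_space s\<^sub>0 p\<^sub>0 q\<^sub>0 w\<^sub>0 \<and> f\<^sub>1 \<in> f_space s\<^sub>1 p\<^sub>1 q\<^sub>1 w\<^sub>1 \<and>
        (AE z in count_space UNIV. cmod (lam z) \<le> cmod (f\<^sub>0 z) powr (1 - \<Theta>) * cmod (f\<^sub>1 z) powr \<Theta>)}"
    then obtain f\<^sub>0 f\<^sub>1 where y: "y = enn_powr (f_norm s\<^sub>0 p\<^sub>0 q\<^sub>0 w\<^sub>0 f\<^sub>0) (1 - \<Theta>) * enn_powr (f_norm s\<^sub>1 p\<^sub>1 q\<^sub>1 w\<^sub>1 f\<^sub>1) \<Theta>"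
      and le: "\<And>z. cmod (lam z) \<le> cmod (f\<^sub>0 z) powr (1 - \<Theta>) * cmod (f\<^sub>1 z) powr \<Theta>"
      by (auto simp: AE_count_space)
    show "f_norm s p q w lam \<le> y"
      unfolding y using assms le by (intro f_norm_Holder muckenhoupt_loc_infinityD) auto
  qed
  obtain C where C: "0 < C" and factor: "\<And>lam. f_norm s p q w lam < top \<Longrightarrow> \<exists>lam\<^sub>0 lam\<^sub>1.
      (\<forall>z. cmod (lam z) \<le> cmod (lam\<^sub>0 z) powr (1 - \<Theta>) * cmod (lam\<^sub>1 z) powr \<Theta>)
      \<and> f_norm s\<^sub>0 p\<^sub>0 q\<^sub>0 w\<^sub>0 lam\<^sub>0 < top \<and> f_norm s\<^sub>1 p\<^sub>1 q\<^sub>1 w\<^sub>1 lam\<^sub>1 < top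
      \<and> enn_powr (f_norm s\<^sub>0 p\<^sub>0 q\<^sub>0 w\<^sub>0 lam\<^sub>0) (1 - \<Theta>) * enn_powr (f_norm s\<^sub>1 p\<^sub>1 q\<^sub>1 w\<^sub>1 lam\<^sub>1) \<Theta>
        \<le> ennreal C * f_norm s p q w lam"
    using f_norm_factorization[OF assms(1,2,3,4,7,5,6,8-12)] by blast
  have upper: "n lam \<le> ennreal C * f_norm s p q w lam" if "lam \<in> f_space s p q w" for lam
  proof -
    have "f_norm s p q w lam < top" using that by (simp add: f_space_def)
    then obtain lam\<^sub>0 lam\<^sub>1 where
      le: "\<forall>z. cmod (lam z) \<le> cmod (lam\<^sub>0 z) powr (1 - \<Theta>) * cmod (lam\<^sub>1 z) powr \<Theta>"
      and fin: "f_norm s\<^sub>0 p\<^sub>0 q\<^sub>0 w\<^sub>0 lam\<^sub>0 < top" "f_norm s\<^sub>1 p\<^sub>1 q\<^sub>1 w\<^sub>1 lam\<^sub>1 < top"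
      and norm: "enn_powr (f_norm s\<^sub>0 p\<^sub>0 q\<^sub>0 w\<^sub>0 lam\<^sub>0) (1 - \<Theta>) * enn_powr (f_norm s\<^sub>1 p\<^sub>1 q\<^sub>1 w\<^sub>1 lam\<^sub>1) \<Theta>
        \<le> ennreal C * f_norm s p q w lam"
      using factor by blast
    have "n lam \<le> enn_powr (f_norm s\<^sub>0 p\<^sub>0 q\<^sub>0 w\<^sub>0 lam\<^sub>0) (1 - \<Theta>) * enn_powr (f_norm s\<^sub>1 p\<^sub>1 q\<^sub>1 w\<^sub>1 lam\<^sub>1) \<Theta>"
      unfolding n_def calderon_norm_def using le fin
      by (intro Inf_lower CollectI exI[of _ lam\<^sub>0] exI[of _ lam\<^sub>1]) (auto simp: f_space_def AE_count_space)
    with norm show ?thesis by order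
  qed
  \<comment> \<open>On a counting measure every function is measurable, so membership in the product
    is just finiteness of \<open>n\<close>.\<close>
  have "n lam < top \<longleftrightarrow> lam \<in> f_space s p q w" for lam
  proof
    assume "n lam < top"
    with lower[of lam] show "lam \<in> f_space s p q w" by (auto simp: f_space_def)
  next
    assume "lam \<in> f_space s p q w"
    with upper[of lam] show "n lam < top"
      by (auto simp: f_space_def ennreal_mult_less_top intro: le_less_trans)
  qed
  then have "calderon_product (count_space UNIV) \<Theta>
      (f_space s\<^sub>0 p\<^sub>0 q\<^sub>0 w\<^sub>0) (f_norm s\<^sub>0 p\<^sub>0 q\<^sub>0 w\<^sub>0) (f_space s\<^sub>1 p\<^sub>1 q\<^sub>1 w\<^sub>1) (f_norm s\<^sub>1 p\<^sub>1 q\<^sub>1 w\<^sub>1) = f_space s p q w"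
    by (auto simp: calderon_product_def n_def)
  \<comment> \<open>The lower constant is 1, from Hoelder's inequality; the upper one comes from the
    factorization.\<close>
  moreover have "equivalent_norms_on (f_space s p q w) (f_norm s p q w) n"
    unfolding equivalent_norms_on_def using C lower upper by (intro exI[of _ 1] exI[of _ C]) auto
  ultimately show ?thesis by (simp add: n_def)
qed

end
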